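(* Let $n\ge1$ be an integer. For $v\ge1$ define $$\Phi(v)=\sum_{T}\gcd[\{V(T_i)\}],$$ where the sum ranges over all (non-rooted) forests $T$ on $v$ labeled vertices, the $T_i$ are the trees (connected components) of $T$, and $V(T_i)$ is the number of vertices of $T_i$. Let $\varphi(n)$ be the number of (non-rooted) forests on $n$ labeled vertices. Then $$\Lambda(\mathcal{CP}_{n+1})=\varphi(n)-\sum_{v=1}^{n-1}\binom{n}{v}(-v)^{n-v-1}\,\Phi(v)=\Lambda(\Pi_n)-\sum_{v=1}^{n-1}\binom{n}{v}(-v)^{n-v-1}\,\Phi(v).$$
   Context: Let $e_1,\dots,e_n$ be the standard basis of $\mathbb{R}^n$ and $e=(1,\dots,1)\in\mathbb{R}^n$. For $1\le i<j\le n$ let $q_{ij}=[e_i,e_j]$. For $1\le i\le n$ let $R_i=\sum_{j=1}^n(e_i-e_j)$, i.e. the vector with $i$-th coordinate $n-1$ and all other coordinates $-1$, and let $r_i=[0,R_i]$. $\Pi_n$ is the standard permutohedron, the convex hull of all points obtained by permuting the coordinates of $(1,2,\dots,n)$; one has $\Pi_n=\bigoplus_{i<j}q_{ij}+e$. Convex polytopes in $\mathbb{R}^n$ form a cancellative commutative semigroup under Minkowski addition; the elements of its Grothendieck group are called virtual polytopes. The cyclopermutohedron is the virtual polytope $$\mathcal{CP}_{n+1}=\bigoplus_{1\le i<j\le n}q_{ij}+e-\bigoplus_{i=1}^n r_i=\Pi_n-\bigoplus_{i=1}^n r_i .$$ Number of integer points $\Lambda$: for a convex lattice polytope, $\Lambda$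 is the number of points of $\mathbb{Z}^n$ it contains. For non-negative integers $\lambda_{ij},\mu_k$, the number $\Lambda\big(\bigoplus_{i<j}\lambda_{ij}q_{ij}\oplus\bigoplus_k\mu_kr_k\big)$ is a polynomial in the $\lambda_{ij},\mu_k$; for arbitrary integers $\lambda_{ij},\mu_k$ the number of integer points of the corresponding virtual zonotope is defined as the value of this polynomial (possibly negative). Translation by integer vectors does not change $\Lambda$. Thus $\Lambda(\mathcal{CP}_{n+1})$ is the value of this polynomial at $\lambda_{ij}=1$, $\mu_k=-1$. *)

theory Defs
  imports "HOL-Analysis.Analysis" "HOL-Library.Set_Algebras"
begin

text \<open>The empty set is excluded: it would be absorbing for Minkowski addition.\<close>

typedef (overloaded) ('a::euclidean_space) convex_polytope =
  "{P :: 'a set. polytope P \<and> P \<noteq> {}}"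
  morphisms points_of Abs_convex_polytope
  by (rule exI[of _ "{0}"]) (simp add: polytope_sing)

setup_lifting type_definition_convex_polytope

lemma polytope_Minkowski_sum:
  fixes A B :: "'a::euclidean_space set"
  assumes "polytope A" "polytope B"
  shows "polytope (A + B)"
proof -
  obtain V W where "finite V" "A = convex hull V" "finite W" "B = convex hull W"
    using assms unfolding polytope_def by blast
  then have "finite (V + W)" "A + B = convex hull (V + W)"
    by (simp_all add: convex_hull_set_plus finite_set_plus)
  then show ?thesis
    unfolding polytope_def by blast
qed

lemma Minkowski_cancel_subset:
  fixes A B C :: "'a::euclidean_space set"
  assumes B: "closed B" "convex B" and C: "compact C" "C \<noteq> {}"
    and sub: "C + A \<subseteq> C + B"
  shows "A \<subseteq> B"
proof
  fix x assume x: "x \<in> A"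
  show "x \<in> B"
  proof (rule ccontr)
    assume "x \<notin> B"
    then obtain a b where ab: "inner a x < b" "\<And>y. y \<in> B \<Longrightarrow> inner a y > b"
      using separating_hyperplane_closed_point[OF B(2,1)] by blast
    have "continuous_on C (inner a)" by (intro continuous_intros)
    then obtain c where c: "c \<in> C" "\<And>y. y \<in> C \<Longrightarrow> inner a c \<le> inner a y"
      using continuous_attains_inf[OF C] by blast
    have "c + x \<in> C + B" using sub c(1) x by (blast intro: set_plus_intro)
    then obtain d y where dy: "c + x = d + y" "d \<in> C" "y \<in> B"
      by (auto elim: set_plus_elim)
    have "inner a c + inner a x = inner a d + inner a y"
      using dy(1) by (metis inner_add_right)
    with ab(1) ab(2)[OF dy(3)] c(2)[OF dy(2)] show False by linarith
  qed
qed

lemma polytope_cancel: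
  fixes A B C :: "'a::euclidean_space set"
  assumes "polytope A" "polytope B" "polytope C" "C \<noteq> {}" "C + A = C + B"
  shows "A = B"
proof -
  note props = polytope_imp_closed polytope_imp_convex polytope_imp_compact
  show ?thesis
  proof (rule subset_antisym)
    show "A \<subseteq> B"
      by (rule Minkowski_cancel_subset[where C = C]) (use assms in \<open>simp_all add: props\<close>)
    show "B \<subseteq> A"
      by (rule Minkowski_cancel_subset[where C = C]) (use assms in \<open>simp_all add: props\<close>)
  qed
qed

instantiation convex_polytope :: (euclidean_space) comm_monoid_add
begin

lift_definition zero_convex_polytope :: "'a convex_polytope" is "{0}"
  by (simp add: polytope_sing)

lift_definition plus_convex_polytope ::
    "'a convex_polytope \<Rightarrow> 'a convex_polytope \<Rightarrow> 'a convex_polytope" is "(+)"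
  using polytope_Minkowski_sum by (auto simp: set_plus_def)

instance
proof
  fix a b c :: "'a convex_polytope"
  show "a + b + c = a + (b + c)" by transfer (rule add.assoc)
  show "a + b = b + a" by transfer (rule add.commute)
  show "0 + a = a" by transfer (simp add: set_plus_def)
qed

end

instance convex_polytope :: (euclidean_space) cancel_semigroup_add
proof
  fix a b c :: "'a convex_polytope"
  show *: "a + b = a + c \<Longrightarrow> b = c"
    by transfer (use polytope_cancel in blast)
  show "b + a = c + a \<Longrightarrow> b = c"
    using * by (simp add: add.commute)
qed

definition virt_eq :: "'a::euclidean_space convex_polytope \<times> 'a convex_polytope \<Rightarrow>
    'a convex_polytope \<times> 'a convex_polytope \<Rightarrow> bool" where
  "virt_eq X Y \<longleftrightarrow> fst X + snd Y = fst Y + snd X"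

lemma equivp_virt_eq:
  "equivp (virt_eq :: 'a::euclidean_space convex_polytope \<times> 'a convex_polytope \<Rightarrow> _)"
  (is "equivp ?R")
proof (rule equivpI)
  show "reflp ?R" by (rule reflpI) (simp add: virt_eq_def)
  show "symp ?R" by (rule sympI) (unfold virt_eq_def, rule sym)
  show "transp ?R"
  proof (rule transpI)
    fix X Y Z :: "'a convex_polytope \<times> 'a convex_polytope"
    assume "virt_eq X Y" "virt_eq Y Z"
    then have XY: "fst X + snd Y = fst Y + snd X" and YZ: "fst Y + snd Z = fst Z + snd Y"
      by (simp_all add: virt_eq_def)
    have "snd Y + (fst X + snd Z) = (fst X + snd Y) + snd Z" by (simp only: ac_simps)
    also have "\<dots> = (fst Y + snd Z) + snd X" unfolding XY by (simp only: ac_simps)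
    also have "\<dots> = snd Y + (fst Z + snd X)" unfolding YZ by (simp only: ac_simps)
    finally show "virt_eq X Z"
      unfolding virt_eq_def by (rule add_left_imp_eq)
  qed
qed

quotient_type (overloaded) 'a virtual_polytope =
    "('a::euclidean_space) convex_polytope \<times> 'a convex_polytope" / virt_eq
  by (rule equivp_virt_eq)

instantiation virtual_polytope :: (euclidean_space) ab_group_add
begin

lift_definition zero_virtual_polytope :: "'a virtual_polytope" is "(0, 0)" .

lift_definition plus_virtual_polytope ::
    "'a virtual_polytope \<Rightarrow> 'a virtual_polytope \<Rightarrow> 'a virtual_polytope"
  is "\<lambda>X Y. (fst X + fst Y, snd X + snd Y)"
proof -
  fix X X' Y Y' :: "'a convex_polytope \<times> 'a convex_polytope"
  assume "virt_eq X X'" "virt_eq Y Y'"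
  then have X: "fst X + snd X' = fst X' + snd X" and Y: "fst Y + snd Y' = fst Y' + snd Y"
    by (simp_all add: virt_eq_def)
  have "(fst X + fst Y) + (snd X' + snd Y') = (fst X + snd X') + (fst Y + snd Y')"
    by (simp only: ac_simps)
  also have "\<dots> = (fst X' + fst Y') + (snd X + snd Y)"
    unfolding X Y by (simp only: ac_simps)
  finally show "virt_eq (fst X + fst Y, snd X + snd Y) (fst X' + fst Y', snd X' + snd Y')"
    by (simp add: virt_eq_def)
qed

lift_definition uminus_virtual_polytope :: "'a virtual_polytope \<Rightarrow> 'a virtual_polytope"
  is "\<lambda>X. (snd X, fst X)"
  unfolding virt_eq_def fst_conv snd_conv by (metis add.commute)

definition minus_virtual_polytope ::
    "'a virtual_polytope \<Rightarrow> 'a virtual_polytope \<Rightarrow> 'a virtual_polytope" where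
  "minus_virtual_polytope X Y = X + - Y"

instance
proof
  fix a b c :: "'a virtual_polytope"
  show "a + b + c = a + (b + c)" by transfer (simp add: virt_eq_def ac_simps)
  show "a + b = b + a" by transfer (simp add: virt_eq_def ac_simps)
  show "0 + a = a" by transfer (simp add: virt_eq_def)
  show "- a + a = 0" by transfer (simp add: virt_eq_def ac_simps)
  show "a - b = a + - b" by (rule minus_virtual_polytope_def)
qed

end

definition virt :: "'a::euclidean_space convex_polytope \<Rightarrow> 'a virtual_polytope" where
  "virt P = abs_virtual_polytope (P, 0)"

definition nat_multiple :: "nat \<Rightarrow> 'a::comm_monoid_add \<Rightarrow> 'a" where
  "nat_multiple k x = (\<Sum>_<k. x)"

definition int_multiple :: "int \<Rightarrow> 'a::ab_group_add \<Rightarrow> 'a" where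
  "int_multiple k x = nat_multiple (nat k) x - nat_multiple (nat (- k)) x"

text \<open>\<open>\<real>\<^sup>n\<close> is \<open>real ^ 'n\<close> with \<open>n = CARD('n)\<close>; the linear order on \<open>'n\<close> plays the role of
  the usual order on the coordinate indices \<open>1, \<dots>, n\<close>.\<close>

lift_definition point :: "'a::euclidean_space \<Rightarrow> 'a convex_polytope" is "\<lambda>a. {a}"
  by (simp add: polytope_sing)

lift_definition q_seg :: "'n \<Rightarrow> 'n \<Rightarrow> (real ^ 'n::finite) convex_polytope"
  is "\<lambda>i j. closed_segment (axis i 1) (axis j 1)"
  by (simp add: segment_convex_hull polytope_convex_hull)

definition R_vec :: "'n \<Rightarrow> real ^ 'n::finite" where
  "R_vec i = (\<Sum>j\<in>UNIV. axis i 1 - axis j 1)"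

lift_definition r_seg :: "'n \<Rightarrow> (real ^ 'n::finite) convex_polytope"
  is "\<lambda>i. closed_segment 0 (R_vec i)"
  by (simp add: segment_convex_hull polytope_convex_hull)

lift_definition permutohedron :: "(real ^ 'n::finite) convex_polytope"
  is "convex hull ((\<lambda>\<pi>. \<chi> i. real (\<pi> i)) ` {\<pi>. bij_betw \<pi> (UNIV :: 'n set) {1..CARD('n)}})"
proof -
  let ?B = "{\<pi>. bij_betw \<pi> (UNIV :: 'n set) {1..CARD('n)}}"
  have "finite (PiE (UNIV :: 'n set) (\<lambda>_. {1..CARD('n)}))"
    by (intro finite_PiE) auto
  moreover have "?B \<subseteq> PiE UNIV (\<lambda>_. {1..CARD('n)})"
    by (auto simp: bij_betw_def)
  ultimately have "finite ((\<lambda>\<pi>. (\<chi> i. real (\<pi> i)) :: real ^ 'n) ` ?B)"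
    using finite_subset by blast
  then have "polytope (convex hull ((\<lambda>\<pi>. (\<chi> i. real (\<pi> i)) :: real ^ 'n) ` ?B))"
    by (rule polytope_convex_hull)
  moreover have "?B \<noteq> {}"
    using finite_same_card_bij[of "UNIV :: 'n set" "{1..CARD('n)}"] by auto
  ultimately show ?thesis
    by simp
qed

definition cyclopermutohedron :: "(real ^ 'n::{finite,linorder}) virtual_polytope" where
  "cyclopermutohedron =
     (\<Sum>(i, j)\<in>{(i, j). i < j}. virt (q_seg i j)) + virt (point (\<chi> i. 1))
       - (\<Sum>i\<in>UNIV. virt (r_seg i))"

definition lattice_count :: "(real ^ 'n::finite) convex_polytope \<Rightarrow> nat" where
  "lattice_count P = card {x \<in> points_of P. \<forall>i. x $ i \<in> \<int>}"

definition zonotope ::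
    "('n::{finite,linorder} \<Rightarrow> 'n \<Rightarrow> nat) \<Rightarrow> ('n \<Rightarrow> nat) \<Rightarrow>
      (real ^ 'n::{finite,linorder}) convex_polytope" where
  "zonotope l m =
     (\<Sum>(i, j)\<in>{(i, j). i < j}. nat_multiple (l i j) (q_seg i j))
       + (\<Sum>k\<in>UNIV. nat_multiple (m k) (r_seg k))"

definition virtual_zonotope ::
    "('n::{finite,linorder} \<Rightarrow> 'n \<Rightarrow> int) \<Rightarrow> ('n \<Rightarrow> int) \<Rightarrow>
      (real ^ 'n::{finite,linorder}) virtual_polytope" where
  "virtual_zonotope l m =
     (\<Sum>(i, j)\<in>{(i, j). i < j}. int_multiple (l i j) (virt (q_seg i j)))
       + (\<Sum>k\<in>UNIV. int_multiple (m k) (virt (r_seg k)))"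

text \<open>The variables \<open>\<lambda>\<^sub>i\<^sub>j\<close> form a matrix of which only the entries with \<open>i < j\<close> matter:
  \<^const>\<open>zonotope\<close> ignores the others, hence so does the polynomial.\<close>

definition count_poly ::
    "((real ^ 'n::{finite,linorder}) ^ 'n::{finite,linorder}) \<times> (real ^ 'n::{finite,linorder}) \<Rightarrow> real" where
  "count_poly = (THE p. real_polynomial_function p \<and>
     (\<forall>l m. p (\<chi> i j. real (l i j), \<chi> k. real (m k)) = real (lattice_count (zonotope l m))))"

text \<open>Defined on the virtual polytope itself, not on the coefficients. This is unambiguous for integer
  translates of virtual zonotopes: different representations give the same value.\<close>

definition virtual_lattice_count ::
    "(real ^ 'n::{finite,linorder}) virtual_polytope \<Rightarrow> real" where
  "virtual_lattice_count X = (THE c. \<exists>l m t. (\<forall>i. t $ i \<in> \<int>) \<and>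
     X = virtual_zonotope l m + virt (point t) \<and>
     c = count_poly (\<chi> i j. real_of_int (l i j), \<chi> k. real_of_int (m k)))"

definition is_graph :: "'v set \<Rightarrow> 'v set set \<Rightarrow> bool" where
  "is_graph V E \<longleftrightarrow> (\<forall>e\<in>E. e \<subseteq> V \<and> card e = 2)"

definition is_cycle :: "'v set set \<Rightarrow> 'v list \<Rightarrow> bool" where
  "is_cycle E c \<longleftrightarrow> length c \<ge> 3 \<and> distinct c \<and>
     (\<forall>i<length c. {c ! i, c ! (Suc i mod length c)} \<in> E)"

definition is_forest :: "'v set \<Rightarrow> 'v set set \<Rightarrow> bool" where
  "is_forest V E \<longleftrightarrow> is_graph V E \<and> (\<nexists>c. is_cycle E c)"

definition components :: "'v set \<Rightarrow> 'v set set \<Rightarrow> 'v set set" where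
  "components V E = V // {(x, y). x \<in> V \<and> y \<in> V \<and> (x, y) \<in> {(u, w). {u, w} \<in> E}\<^sup>*}"

definition forests :: "nat \<Rightarrow> nat set set set" where
  "forests v = {E. is_forest {1..v} E}"

definition num_forests :: "nat \<Rightarrow> nat" where
  "num_forests n = card (forests n)"

definition Phi :: "nat \<Rightarrow> nat" where
  "Phi v = (\<Sum>E\<in>forests v. Gcd (card ` components {1..v} E))"

end

theory Submission
  imports Defs
begin

text \<open>
  Up to an integer translation, all polytopes involved are sums of lattice segments \<open>[0, v\<^sub>a]\<close>. Let
  \<open>g(S)\<close> be the number of points \<open>t\<close> of the half-open cube \<open>[0, 1)\<^sup>S\<close> for which
  \<open>\<Sum>a\<in>S. t\<^sub>a v\<^sub>a\<close> is a lattice point. Then \<open>\<Sum>a. \<lambda>\<^sub>a [0, v\<^sub>a]\<close> contains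
  \<open>\<Sum>S. (\<Prod>a\<in>S. \<lambda>\<^sub>a) g(S)\<close> lattice points, the sum being over the linearly independent \<open>S\<close>
  (\<open>card_lattice_points_segment_sum\<close>). The proof is by deletion and contraction: adding \<open>\<lambda>[0, v]\<close>
  to a convex body lengthens every fibre in the direction \<open>v\<close> by a half-open segment, so the new
  lattice points are counted by the lattice points of the projection along \<open>v\<close>. The formula is a
  polynomial in the \<open>\<lambda>\<^sub>a\<close>, hence it also gives the number for negative coefficients, which depends
  only on the virtual polytope (\<open>virtual_lattice_count_eq\<close>).

  For the cyclopermutohedron, \<open>S\<close> consists of a set \<open>F\<close> of edges of the complete graph (vectors
  \<open>e\<^sub>j - e\<^sub>i\<close>, coefficient \<open>1\<close>) and a set \<open>M\<close> of vertices (vectors \<open>R\<^sub>k\<close>, coefficient \<open>-1\<close>).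
  Independence means that \<open>F\<close> is a forest, that no tree of \<open>F\<close> contains two elements of \<open>M\<close>, and that
  \<open>M\<close> does not meet all trees. Modulo the span of \<open>F\<close> only the sums of the coordinates over the trees
  matter. From this, \<open>g(F \<union> M) = 1\<close> if \<open>M\<close> is empty, and otherwise \<open>g(F \<union> M)\<close> is \<open>n ^ (card M - 1)\<close>
  times the gcd of the sizes of the trees that \<open>M\<close> misses (\<open>card_torus_kernel_forest_roots\<close>).

  The terms with empty \<open>M\<close> count the forests, and so do the lattice points of the
  permutohedron, which is the sum of the segments of all edges (\<open>permutohedron_eq_zonotope\<close>).
  In the other terms, let \<open>U\<close> be the set of the vertices of the trees missed by \<open>M\<close>, and \<open>v\<close> its size.
  The forest on \<open>U\<close> is arbitrary and contributes \<open>\<Phi>(v)\<close>; on the remaining \<open>m = n - v\<close> vertices there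
  is a forest rooted at \<open>M\<close>. There are \<open>r m ^ (m - r - 1)\<close> forests with \<open>r\<close> given roots
  (\<open>card_rooted_forests\<close>, a form of Cayley's formula), so the sum over \<open>M\<close> collapses by the binomial
  theorem to \<open>- (m - n) ^ (m - 1) = - (- v) ^ (n - v - 1)\<close> (\<open>sum_signed_rooted_forests\<close>).
\<close>

section \<open>Lattice points in sums of lattice segments\<close>

text \<open>More general than \<open>\<int>\<^sup>n\<close>, because the induction on the number of segments replaces a lattice by its
  projections.\<close>

definition discrete_subgroup :: "'a::real_normed_vector set \<Rightarrow> bool" where
  "discrete_subgroup L \<longleftrightarrow> 0 \<in> L \<and> (\<forall>x\<in>L. \<forall>y\<in>L. x - y \<in> L) \<and>
     (\<forall>B. bounded B \<longrightarrow> finite (L \<inter> B))"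

text \<open>The kernel of \<open>(\<real>/\<int>)\<^sup>S \<rightarrow> V/L\<close>, with the torus represented by a half-open cube. For
  independent \<open>v\<^sub>a\<close> in a lattice \<open>L\<close> its size is the index of the lattice spanned by the \<open>v\<^sub>a\<close> in the
  lattice points of their linear span. For dependent \<open>v\<^sub>a\<close> it is infinite, so that \<^const>\<open>card\<close> gives
  \<open>0\<close>: sums over all \<open>S\<close> are in effect sums over independent \<open>S\<close>.\<close>

definition torus_kernel :: "'a::real_vector set \<Rightarrow> ('i \<Rightarrow> 'a) \<Rightarrow> 'i set \<Rightarrow> ('i \<Rightarrow> real) set" where
  "torus_kernel L v S = {t \<in> S \<rightarrow>\<^sub>E {0..<1}. (\<Sum>a\<in>S. t a *\<^sub>R v a) \<in> L}"

definition segment_sum :: "('i \<Rightarrow> 'a::real_vector) \<Rightarrow> ('i \<Rightarrow> nat) \<Rightarrow> 'i set \<Rightarrow> 'a set" where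
  "segment_sum v l A = {(\<Sum>a\<in>A. s a *\<^sub>R v a) | s. \<forall>a\<in>A. 0 \<le> s a \<and> s a \<le> real (l a)}"

lemma discrete_subgroupD:
  assumes "discrete_subgroup L"
  shows discrete_subgroup_zero: "0 \<in> L"
    and discrete_subgroup_diff: "\<And>x y. x \<in> L \<Longrightarrow> y \<in> L \<Longrightarrow> x - y \<in> L"
    and discrete_subgroup_uminus: "\<And>x. x \<in> L \<Longrightarrow> - x \<in> L"
    and discrete_subgroup_add: "\<And>x y. x \<in> L \<Longrightarrow> y \<in> L \<Longrightarrow> x + y \<in> L"
    and discrete_subgroup_finite: "\<And>B. bounded B \<Longrightarrow> finite (L \<inter> B)"
proof -
  show 0: "0 \<in> L" and d: "\<And>x y. x \<in> L \<Longrightarrow> y \<in> L \<Longrightarrow> x - y \<in> L"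
    and "\<And>B. bounded B \<Longrightarrow> finite (L \<inter> B)"
    using assms by (auto simp: discrete_subgroup_def)
  show m: "- x \<in> L" if "x \<in> L" for x using d[OF 0 that] by simp
  show "x + y \<in> L" if "x \<in> L" "y \<in> L" for x y using d[OF that(1) m[OF that(2)]] by simp
qed

lemma discrete_subgroup_scale_int:
  assumes "discrete_subgroup L" "x \<in> L" "k \<in> \<int>"
  shows "k *\<^sub>R x \<in> L"
proof -
  have n: "real n *\<^sub>R x \<in> L" for n
    by (induction n) (auto simp: assms discrete_subgroup_zero discrete_subgroup_add scaleR_add_left)
  obtain z where z: "k = of_int z" using assms(3) by (auto elim: Ints_cases)
  show ?thesis
  proof (cases "z \<ge> 0")
    case True then show ?thesis using n[of "nat z"] z by simp
  next
    case False
    then have "k *\<^sub>R x = - (real (nat (- z)) *\<^sub>R x)" using z by simp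
    then show ?thesis using n discrete_subgroup_uminus[OF assms(1)] by metis
  qed
qed

lemma discrete_subgroup_sum:
  assumes "discrete_subgroup L" "\<And>a. a \<in> A \<Longrightarrow> f a \<in> L"
  shows "sum f A \<in> L"
  using assms(2)
  by (induction A rule: infinite_finite_induct)
     (auto simp: assms(1) discrete_subgroup_zero discrete_subgroup_add)

text \<open>The multiples of a linear relation, reduced modulo \<open>1\<close>, form a curve in the torus kernel.\<close>

lemma card_torus_kernel_dependent:
  assumes L: "discrete_subgroup L" and S: "finite S" "\<And>a. a \<in> S \<Longrightarrow> v a \<in> L"
    and dep: "(\<Sum>a\<in>S. c a *\<^sub>R v a) = 0" and b: "b \<in> S" "c b \<noteq> 0"
  shows "card (torus_kernel L v S) = 0"
proof -
  \<comment> \<open>scaled in such a way that the coordinate \<open>b\<close> is \<open>x\<close> itself for \<open>0 < x < 1\<close>\<close>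
  define f where "f x = (\<lambda>a\<in>S. frac (x / c b * c a))" for x
  have fb: "f x b = x" if "x \<in> {0<..<1}" for x
    using that b by (simp add: f_def frac_eq)
  then have inj: "inj_on f {0<..<1}" by (metis inj_onI)
  have "f x \<in> torus_kernel L v S" for x
  proof -
    have "(\<Sum>a\<in>S. f x a *\<^sub>R v a) = (\<Sum>a\<in>S. (x / c b) *\<^sub>R (c a *\<^sub>R v a)) -
        (\<Sum>a\<in>S. of_int \<lfloor>x / c b * c a\<rfloor> *\<^sub>R v a)"
      by (simp add: f_def frac_def scaleR_diff_left sum_subtractf)
    also have "(\<Sum>a\<in>S. (x / c b) *\<^sub>R (c a *\<^sub>R v a)) = 0"
      using dep by (simp only: scaleR_sum_right[symmetric] scaleR_zero_right)
    finally have "(\<Sum>a\<in>S. f x a *\<^sub>R v a) = - (\<Sum>a\<in>S. of_int \<lfloor>x / c b * c a\<rfloor> *\<^sub>R v a)" by simp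
    also have "\<dots> \<in> L"
      using S by (intro discrete_subgroup_uminus[OF L] discrete_subgroup_sum[OF L]
          discrete_subgroup_scale_int[OF L]) auto
    finally show ?thesis by (auto simp: torus_kernel_def f_def frac_lt_1)
  qed
  then have "f ` {0<..<1} \<subseteq> torus_kernel L v S" by auto
  moreover have "infinite (f ` {0<..<1})"
    using inj by (simp add: finite_image_iff)
  ultimately have "infinite (torus_kernel L v S)" using finite_subset by blast
  then show ?thesis by simp
qed

lemma segment_sum_empty [simp]: "segment_sum v l {} = {0}"
  by (auto simp: segment_sum_def)

lemma segment_sum_insert:
  assumes "finite A" "b \<notin> A"
  shows "segment_sum v l (insert b A) =
    {x + y | x y. x \<in> segment_sum v l A \<and> y \<in> (\<lambda>s. s *\<^sub>R v b) ` {0..real (l b)}}"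
proof (intro equalityI subsetI)
  fix x assume "x \<in> segment_sum v l (insert b A)"
  then obtain s where s: "x = (\<Sum>a\<in>insert b A. s a *\<^sub>R v a)"
      "\<forall>a\<in>insert b A. 0 \<le> s a \<and> s a \<le> real (l a)"
    by (auto simp: segment_sum_def)
  then have "x = (\<Sum>a\<in>A. s a *\<^sub>R v a) + s b *\<^sub>R v b" using assms by simp
  moreover have "(\<Sum>a\<in>A. s a *\<^sub>R v a) \<in> segment_sum v l A"
    using s by (auto simp: segment_sum_def)
  ultimately show "x \<in> {x + y | x y. x \<in> segment_sum v l A \<and> y \<in> (\<lambda>s. s *\<^sub>R v b) ` {0..real (l b)}}"
    using s by (auto intro!: exI)
next
  fix x assume "x \<in> {x + y | x y. x \<in> segment_sum v l A \<and> y \<in> (\<lambda>s. s *\<^sub>R v b) ` {0..real (l b)}}"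
  then obtain s r where s: "x = (\<Sum>a\<in>A. s a *\<^sub>R v a) + r *\<^sub>R v b"
      "\<forall>a\<in>A. 0 \<le> s a \<and> s a \<le> real (l a)" "0 \<le> r" "r \<le> real (l b)"
    by (auto simp: segment_sum_def)
  have "(\<Sum>a\<in>A. s a *\<^sub>R v a) = (\<Sum>a\<in>A. (s(b:=r)) a *\<^sub>R v a)"
    using assms by (intro sum.cong) auto
  then have "x = (\<Sum>a\<in>insert b A. (s(b:=r)) a *\<^sub>R v a)" using assms s by simp
  then show "x \<in> segment_sum v l (insert b A)"
    unfolding segment_sum_def using s by (intro CollectI exI[of _ "s(b:=r)"]) auto
qed

lemma compact_segment_sum:
  fixes v :: "'i \<Rightarrow> 'a::real_normed_vector"
  assumes "finite A" shows "compact (segment_sum v l A)"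
  using assms
proof (induction A)
  case (insert b A)
  have "compact ((\<lambda>s. s *\<^sub>R v b) ` {0..real (l b)})"
    by (intro compact_continuous_image continuous_intros) auto
  then show ?case using insert by (simp add: segment_sum_insert compact_sums)
qed simp

lemma convex_segment_sum:
  fixes v :: "'i \<Rightarrow> 'a::real_normed_vector"
  shows "convex (segment_sum v l A)"
proof (rule convexI)
  fix x y :: 'a and p q :: real
  assume "x \<in> segment_sum v l A" "y \<in> segment_sum v l A" and pq: "0 \<le> p" "0 \<le> q" "p + q = 1"
  then obtain s r where s: "x = (\<Sum>a\<in>A. s a *\<^sub>R v a)" "\<forall>a\<in>A. 0 \<le> s a \<and> s a \<le> real (l a)"
      and r: "y = (\<Sum>a\<in>A. r a *\<^sub>R v a)" "\<forall>a\<in>A. 0 \<le> r a \<and> r a \<le> real (l a)"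
    by (auto simp: segment_sum_def)
  have "p *\<^sub>R x + q *\<^sub>R y = (\<Sum>a\<in>A. (p * s a + q * r a) *\<^sub>R v a)"
    by (simp add: s r scaleR_sum_right scaleR_add_left sum.distrib)
  moreover have "0 \<le> p * s a + q * r a \<and> p * s a + q * r a \<le> real (l a)" if "a \<in> A" for a
  proof -
    have "p * s a + q * r a \<le> p * real (l a) + q * real (l a)"
      using s r pq that by (intro add_mono mult_left_mono) auto
    also have "\<dots> = real (l a)" using pq by (simp flip: distrib_right)
    finally show ?thesis using s r pq that by auto
  qed
  ultimately show "p *\<^sub>R x + q *\<^sub>R y \<in> segment_sum v l A" by (auto simp: segment_sum_def)
qed

lemma linear_image_segment_sum:
  assumes "linear f"
  shows "segment_sum (f \<circ> v) l A = f ` segment_sum v l A"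
proof -
  have "(\<Sum>a\<in>A. s a *\<^sub>R (f \<circ> v) a) = f (\<Sum>a\<in>A. s a *\<^sub>R v a)" for s
    using assms by (simp add: linear_sum linear_cmul)
  then have "segment_sum (f \<circ> v) l A =
      {f (\<Sum>a\<in>A. s a *\<^sub>R v a) | s. \<forall>a\<in>A. 0 \<le> s a \<and> s a \<le> real (l a)}"
    unfolding segment_sum_def by simp
  then show ?thesis unfolding segment_sum_def by blast
qed

lemma bounded_Minkowski_sum:
  fixes S T :: "'a::real_normed_vector set"
  assumes "bounded S" "bounded T"
  shows "bounded {x + y | x y. x \<in> S \<and> y \<in> T}"
proof -
  have "{x + y | x y. x \<in> S \<and> y \<in> T} = (\<Union>x\<in>S. \<Union>y\<in>T. {x + y})" by auto
  then show ?thesis using bounded_sums[OF assms] by simp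
qed

definition coord_along :: "'a::real_inner \<Rightarrow> 'a \<Rightarrow> real" where
  "coord_along u x = inner x u / inner u u"

definition proj_along :: "'a::real_inner \<Rightarrow> 'a \<Rightarrow> 'a" where
  "proj_along u x = x - coord_along u x *\<^sub>R u"

lemma linear_coord_along: "linear (coord_along u)"
  by (rule linearI) (auto simp: coord_along_def inner_add_left add_divide_distrib)

lemma linear_proj_along: "linear (proj_along u)"
  by (rule linearI)
     (auto simp: proj_along_def linear_add[OF linear_coord_along]
        linear_cmul[OF linear_coord_along] algebra_simps)

lemma coord_along_self: "u \<noteq> 0 \<Longrightarrow> coord_along u u = 1"
  by (simp add: coord_along_def)

lemma proj_along_add_self: "u \<noteq> 0 \<Longrightarrow> proj_along u (x + s *\<^sub>R u) = proj_along u x"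
  by (simp add: proj_along_def linear_add[OF linear_coord_along]
      linear_cmul[OF linear_coord_along] coord_along_self algebra_simps)

lemma coord_along_add_self: "u \<noteq> 0 \<Longrightarrow> coord_along u (x + s *\<^sub>R u) = coord_along u x + s"
  by (simp add: linear_add[OF linear_coord_along]
      linear_cmul[OF linear_coord_along] coord_along_self)

lemma proj_along_eqD:
  assumes "proj_along u x = proj_along u y"
  shows "x = y + (coord_along u x - coord_along u y) *\<^sub>R u"
  using assms by (auto simp: proj_along_def algebra_simps)

text \<open>A point of the projected lattice has a preimage in the lattice whose coordinate along \<open>u\<close> is in
  \<open>[0, 1)\<close>, so bounded parts of the projection come from bounded parts of the lattice.\<close>

lemma discrete_subgroup_proj_along:
  assumes L: "discrete_subgroup L" and u: "u \<in> L" "u \<noteq> 0"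
  shows "discrete_subgroup (proj_along u ` L)"
  unfolding discrete_subgroup_def
proof (intro conjI ballI allI impI)
  show "0 \<in> proj_along u ` L"
    using discrete_subgroup_zero[OF L] linear_0[OF linear_proj_along] by (metis imageI)
next
  fix x y assume "x \<in> proj_along u ` L" "y \<in> proj_along u ` L"
  then show "x - y \<in> proj_along u ` L"
    using discrete_subgroup_diff[OF L]
    by (auto simp flip: linear_diff[OF linear_proj_along])
next
  fix B :: "'a set" assume "bounded B"
  let ?B = "{x + y | x y. x \<in> B \<and> y \<in> (\<lambda>s. s *\<^sub>R u) ` {0..1}}"
  have "bounded ((\<lambda>s. s *\<^sub>R u) ` {0..1})"
    by (intro compact_imp_bounded compact_continuous_image continuous_intros) auto
  then have "bounded ?B" by (rule bounded_Minkowski_sum[OF \<open>bounded B\<close>])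
  then have "finite (proj_along u ` (L \<inter> ?B))" using discrete_subgroup_finite[OF L] by blast
  moreover have "proj_along u ` L \<inter> B \<subseteq> proj_along u ` (L \<inter> ?B)"
  proof
    fix y assume y: "y \<in> proj_along u ` L \<inter> B"
    then obtain x where x: "x \<in> L" "y = proj_along u x" by auto
    \<comment> \<open>the translate of \<open>x\<close> by a multiple of \<open>u\<close> with coordinate in \<open>[0, 1)\<close>\<close>
    define x' where "x' = x + (- of_int \<lfloor>coord_along u x\<rfloor>) *\<^sub>R u"
    have xL: "x' \<in> L" unfolding x'_def
      by (intro discrete_subgroup_add[OF L] discrete_subgroup_scale_int[OF L] x u) auto
    have "x' = y + frac (coord_along u x) *\<^sub>R u"
      unfolding x'_def x proj_along_def by (simp add: frac_def algebra_simps)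
    moreover have "frac (coord_along u x) \<in> {0..1}" by (simp add: less_imp_le[OF frac_lt_1])
    ultimately have "x' \<in> ?B" using y by blast
    moreover note xL
    moreover have "proj_along u x' = y"
      unfolding x'_def x(2) by (rule proj_along_add_self[OF u(2)])
    ultimately show "y \<in> proj_along u ` (L \<inter> ?B)" by blast
  qed
  ultimately show "finite (proj_along u ` L \<inter> B)" using finite_subset by blast
qed

text \<open>Every class modulo \<open>1\<close> meets a half-open interval of length \<open>k\<close> exactly \<open>k\<close> times.\<close>

lemma card_Int_halfopen_interval:
  fixes H :: "real set"
  assumes H: "\<And>s z. s \<in> H \<Longrightarrow> s + of_int z \<in> H"
  shows "card (H \<inter> {\<beta><..\<beta> + real k}) = k * card (H \<inter> {0..<1})"
proof -
  \<comment> \<open>the \<open>j\<close>-th point above \<open>\<beta>\<close> that is congruent to \<open>r\<close>\<close>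
  define f where "f = (\<lambda>(j::nat, r). r + of_int (\<lfloor>\<beta> - r\<rfloor> + 1 + int j))"
  have fr: "frac (f (j, r)) = r" if "r \<in> {0..<1}" for j r
    using that unfolding f_def prod.case by (subst frac_unique_iff) auto
  have "bij_betw f ({0..<k} \<times> (H \<inter> {0..<1})) (H \<inter> {\<beta><..\<beta> + real k})"
    unfolding bij_betw_def
  proof (intro conjI equalityI subsetI)
    show "inj_on f ({0..<k} \<times> (H \<inter> {0..<1}))"
    proof (rule inj_onI, clarify)
      fix j r j' r' assume a: "r \<in> H" "r \<in> {0..<1::real}" "r' \<in> H" "r' \<in> {0..<1::real}"
        and eq: "f (j, r) = f (j', r')"
      have "r = r'" using fr[OF a(2), of j] fr[OF a(4), of j'] eq by simp
      then show "j = j' \<and> r = r'" using eq by (simp add: f_def)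
    qed
  next
    fix x assume "x \<in> f ` ({0..<k} \<times> (H \<inter> {0..<1}))"
    then obtain j r where jr: "j < k" "r \<in> H" "x = f (j, r)" by auto
    have "real j + 1 \<le> real k" using jr(1) by linarith
    moreover have "of_int \<lfloor>\<beta> - r\<rfloor> \<le> \<beta> - r" "\<beta> - r < of_int \<lfloor>\<beta> - r\<rfloor> + 1" by linarith+
    ultimately have "\<beta> < x" "x \<le> \<beta> + real k"
      unfolding jr(3) f_def prod.case of_int_add of_int_1 of_int_of_nat_eq by linarith+
    moreover have "x \<in> H" unfolding jr(3) f_def prod.case by (rule H[OF jr(2)])
    ultimately show "x \<in> H \<inter> {\<beta><..\<beta> + real k}" by simp
  next
    fix x assume x: "x \<in> H \<inter> {\<beta><..\<beta> + real k}"
    define r where "r = frac x"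
    define j where "j = nat (\<lfloor>x\<rfloor> - \<lfloor>\<beta> - r\<rfloor> - 1)"
    have xr: "x = r + of_int \<lfloor>x\<rfloor>" by (simp add: r_def frac_def)
    have "r \<in> H" using H[of x "- \<lfloor>x\<rfloor>"] x by (simp add: r_def frac_def)
    have r01: "r \<in> {0..<1}" by (simp add: r_def frac_lt_1)
    have 1: "\<lfloor>\<beta> - r\<rfloor> < \<lfloor>x\<rfloor>" using x xr by (simp add: floor_less_iff)
    have 2: "\<lfloor>x\<rfloor> - int k \<le> \<lfloor>\<beta> - r\<rfloor>" using x xr by (simp add: le_floor_iff)
    from 1 2 have "j < k" by (simp add: j_def)
    moreover have "f (j, r) = x" using 1 xr by (simp add: f_def j_def)
    ultimately show "x \<in> f ` ({0..<k} \<times> (H \<inter> {0..<1}))" using \<open>r \<in> H\<close> r01 by force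
  qed
  then have "card ({0..<k} \<times> (H \<inter> {0..<1})) = card (H \<inter> {\<beta><..\<beta> + real k})"
    by (rule bij_betw_same_card)
  then show ?thesis by (simp add: card_cartesian_product)
qed

text \<open>The lattice points of a fibre form a translate of \<open>L \<inter> \<real>u\<close>, so their number in a half-open segment
  depends neither on the fibre nor on the position of the segment.\<close>

lemma card_fibre_halfopen:
  assumes L: "discrete_subgroup L" and u: "u \<in> L" "u \<noteq> 0" and y: "y \<in> proj_along u ` L"
  shows "card {x \<in> L. proj_along u x = y \<and> \<beta> < coord_along u x \<and> coord_along u x \<le> \<beta> + real k}
    = k * card {s \<in> {0..<1}. s *\<^sub>R u \<in> L}"
proof -
  define H where "H = {s. s *\<^sub>R u \<in> L}"
  have H: "s + of_int z \<in> H" if "s \<in> H" for s z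
    using that unfolding H_def
    by (auto simp: scaleR_add_left intro!: discrete_subgroup_add[OF L] discrete_subgroup_scale_int[OF L] u)
  obtain x0 where x0: "x0 \<in> L" "proj_along u x0 = y" using y by auto
  let ?c = "coord_along u x0"
  have "bij_betw (\<lambda>s. x0 + s *\<^sub>R u) (H \<inter> {\<beta> - ?c<..\<beta> - ?c + real k})
     {x \<in> L. proj_along u x = y \<and> \<beta> < coord_along u x \<and> coord_along u x \<le> \<beta> + real k}"
    unfolding bij_betw_def
  proof (intro conjI equalityI subsetI)
    show "inj_on (\<lambda>s. x0 + s *\<^sub>R u) (H \<inter> {\<beta> - ?c<..\<beta> - ?c + real k})"
      using u by (auto intro!: inj_onI)
  next
    fix x assume "x \<in> (\<lambda>s. x0 + s *\<^sub>R u) ` (H \<inter> {\<beta> - ?c<..\<beta> - ?c + real k})"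
    then obtain s where s: "x = x0 + s *\<^sub>R u" "s \<in> H" "\<beta> - ?c < s" "s \<le> \<beta> - ?c + real k"
      unfolding image_iff Bex_def Int_iff greaterThanAtMost_iff by blast
    have "x \<in> L" using s x0 by (auto simp: H_def intro: discrete_subgroup_add[OF L])
    then show "x \<in> {x \<in> L. proj_along u x = y \<and> \<beta> < coord_along u x \<and> coord_along u x \<le> \<beta> + real k}"
      using s x0 u by (simp add: proj_along_add_self coord_along_add_self)
  next
    fix x assume x: "x \<in> {x \<in> L. proj_along u x = y \<and> \<beta> < coord_along u x \<and> coord_along u x \<le> \<beta> + real k}"
    define s where "s = coord_along u x - ?c"
    have xs: "x = x0 + s *\<^sub>R u" unfolding s_def using x x0 by (intro proj_along_eqD) auto
    have "s *\<^sub>R u = x - x0" using xs by simp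
    then have "s \<in> H" using discrete_subgroup_diff[OF L, of x x0] x x0 by (simp add: H_def)
    moreover have "s \<in> {\<beta> - ?c<..\<beta> - ?c + real k}" using x by (simp add: s_def)
    ultimately show "x \<in> (\<lambda>s. x0 + s *\<^sub>R u) ` (H \<inter> {\<beta> - ?c<..\<beta> - ?c + real k})"
      using xs by blast
  qed
  from bij_betw_same_card[OF this] card_Int_halfopen_interval[OF H]
  have "card {x \<in> L. proj_along u x = y \<and> \<beta> < coord_along u x \<and> coord_along u x \<le> \<beta> + real k} =
      k * card (H \<inter> {0..<1})" by metis
  also have "H \<inter> {0..<1} = {s \<in> {0..<1}. s *\<^sub>R u \<in> L}" by (auto simp: H_def)
  finally show ?thesis .
qed

text \<open>The fibres of \<open>Z\<close> in direction \<open>u\<close> are compact segments, and adding \<open>[0, k]u\<close> extends each at its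
  upper end by a half-open segment of length \<open>k\<close>. So the new lattice points lie over the points of the
  projected lattice in the projection of \<open>Z\<close>, with a constant number over each of them.\<close>

lemma card_Int_add_segment:
  fixes Z :: "'a::euclidean_space set"
  assumes L: "discrete_subgroup L" and u: "u \<in> L" "u \<noteq> 0" and Z: "compact Z" "convex Z"
  shows "card (L \<inter> {x + y | x y. x \<in> Z \<and> y \<in> (\<lambda>s. s *\<^sub>R u) ` {0..real k}}) =
    card (L \<inter> Z) + k * card {s \<in> {0..<1}. s *\<^sub>R u \<in> L} * card (proj_along u ` L \<inter> proj_along u ` Z)"
proof -
  define Y where "Y = proj_along u ` L \<inter> proj_along u ` Z"
  have "\<exists>z. z \<in> Z \<and> proj_along u z = y \<and> (\<forall>x\<in>Z. proj_along u x = y \<longrightarrow> coord_along u x \<le> coord_along u z)"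
    if "y \<in> proj_along u ` Z" for y
  proof -
    have c: "continuous_on UNIV (proj_along u)" "continuous_on UNIV (coord_along u)"
      using linear_proj_along[of u] linear_coord_along[of u]
      by (auto intro: linear_continuous_on simp: linear_conv_bounded_linear)
    have "closed {x. proj_along u x = y}"
      using closed_Collect_eq[OF c(1) continuous_on_const] by simp
    then have "compact (Z \<inter> {x. proj_along u x = y})" using Z(1) by blast
    moreover have "Z \<inter> {x. proj_along u x = y} \<noteq> {}" using that by auto
    ultimately show ?thesis
      using continuous_attains_sup[of "Z \<inter> {x. proj_along u x = y}" "coord_along u"]
        continuous_on_subset[OF c(2) subset_UNIV] by auto
  qed
  \<comment> \<open>\<open>top y\<close> is the upper end of the fibre of \<open>Z\<close> over \<open>y\<close>\<close>
  then obtain top where top: "\<And>y. y \<in> proj_along u ` Z \<Longrightarrow> top y \<in> Z"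
      "\<And>y. y \<in> proj_along u ` Z \<Longrightarrow> proj_along u (top y) = y"
      "\<And>y x. y \<in> proj_along u ` Z \<Longrightarrow> x \<in> Z \<Longrightarrow> proj_along u x = y \<Longrightarrow> coord_along u x \<le> coord_along u (top y)"
    by metis
  define N where "N y = {x \<in> L. proj_along u x = y \<and> coord_along u (top y) < coord_along u x \<and>
      coord_along u x \<le> coord_along u (top y) + real k}" for y
  let ?Z' = "{x + y | x y. x \<in> Z \<and> y \<in> (\<lambda>s. s *\<^sub>R u) ` {0..real k}}"
  have "bounded ((\<lambda>s. s *\<^sub>R u) ` {0..real k})"
    by (intro compact_imp_bounded compact_continuous_image continuous_intros) auto
  then have "bounded ?Z'" by (rule bounded_Minkowski_sum[OF compact_imp_bounded[OF Z(1)]])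
  then have fin: "finite (L \<inter> ?Z')" by (rule discrete_subgroup_finite[OF L])
  have dec: "L \<inter> ?Z' = (L \<inter> Z) \<union> (\<Union>y\<in>Y. N y)"
  proof (intro equalityI subsetI)
    fix x assume x: "x \<in> L \<inter> ?Z'"
    then obtain z s where zs: "x = z + s *\<^sub>R u" "z \<in> Z" "0 \<le> s" "s \<le> real k" by auto
    let ?y = "proj_along u x"
    have y: "proj_along u z = ?y" unfolding zs(1) by (rule proj_along_add_self[OF u(2), symmetric])
    have yZ: "?y \<in> proj_along u ` Z" using imageI[OF zs(2), of "proj_along u"] unfolding y .
    have yY: "?y \<in> Y" unfolding Y_def by (rule IntI[OF _ yZ], rule imageI, rule IntD1[OF x])
    have cx: "coord_along u x = coord_along u z + s" using zs u by (simp add: coord_along_add_self)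
    have cz: "coord_along u z \<le> coord_along u (top ?y)" using top(3)[OF yZ zs(2) y] .
    show "x \<in> (L \<inter> Z) \<union> (\<Union>y\<in>Y. N y)"
    proof (cases "coord_along u x \<le> coord_along u (top ?y)")
      case False
      then have "x \<in> N ?y" using x cx cz zs by (auto simp: N_def)
      then show ?thesis using yY by blast
    next
      case True
      define d where "d = coord_along u (top ?y) - coord_along u z"
      have tz: "top ?y = z + d *\<^sub>R u" unfolding d_def
        using top(2)[OF yZ] y by (intro proj_along_eqD) simp
      have "x \<in> Z"
      proof (cases "d = 0")
        case True
        then have "s = 0" using \<open>coord_along u x \<le> _\<close> cx zs by (simp add: d_def)
        then show ?thesis using zs by simp
      next
        case False
        then have "d > 0" using cz by (simp add: d_def)
        have "s / d \<le> 1" using True cx \<open>d > 0\<close> by (simp add: d_def)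
        have "(1 - s / d) *\<^sub>R z + (s / d) *\<^sub>R top ?y \<in> Z"
          using \<open>s / d \<le> 1\<close> \<open>d > 0\<close> zs top(1)[OF yZ] by (intro convexD[OF Z(2)]) auto
        also have "(1 - s / d) *\<^sub>R z + (s / d) *\<^sub>R top ?y = x"
          unfolding tz using zs(1) \<open>d > 0\<close> by (simp add: algebra_simps)
        finally show ?thesis .
      qed
      then show ?thesis using x by blast
    qed
  next
    fix x assume "x \<in> (L \<inter> Z) \<union> (\<Union>y\<in>Y. N y)"
    then consider "x \<in> L" "x \<in> Z" | y where "y \<in> Y" "x \<in> N y" by auto
    then show "x \<in> L \<inter> ?Z'"
    proof cases
      case 1
      have "x = x + 0 *\<^sub>R u" "(0::real) \<in> {0..real k}" by simp_all
      then show ?thesis using 1 by blast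
    next
      case 2
      then have yZ: "y \<in> proj_along u ` Z" by (simp add: Y_def)
      define s where "s = coord_along u x - coord_along u (top y)"
      have "x = top y + s *\<^sub>R u" unfolding s_def
        using top(2)[OF yZ] 2 by (intro proj_along_eqD) (simp add: N_def)
      moreover have "s \<in> {0..real k}" using 2 by (auto simp: N_def s_def)
      moreover have "x \<in> L" using 2 by (simp add: N_def)
      ultimately show ?thesis using top(1)[OF yZ] by blast
    qed
  qed
  have disj: "(L \<inter> Z) \<inter> (\<Union>y\<in>Y. N y) = {}"
    using top(3) by (force simp: N_def Y_def)
  have finY: "finite Y" unfolding Y_def
    by (intro discrete_subgroup_finite[OF discrete_subgroup_proj_along[OF L u]]
        bounded_linear_image compact_imp_bounded Z)
       (rule linear_proj_along[of u, unfolded linear_conv_bounded_linear])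
  have finN: "finite (\<Union>y\<in>Y. N y)" using fin unfolding dec by simp
  have "card (L \<inter> ?Z') = card (L \<inter> Z) + card (\<Union>y\<in>Y. N y)"
    unfolding dec using disj fin finN unfolding dec by (intro card_Un_disjoint) auto
  also have "card (\<Union>y\<in>Y. N y) = (\<Sum>y\<in>Y. card (N y))"
    using finY finN by (intro card_UN_disjoint) (auto simp: N_def intro: finite_subset[OF _ finN])
  also have "\<dots> = (\<Sum>y\<in>Y. k * card {s \<in> {0..<1}. s *\<^sub>R u \<in> L})"
    by (intro sum.cong refl, unfold N_def, rule card_fibre_halfopen[OF L u]) (simp add: Y_def)
  finally show ?thesis by (simp add: Y_def mult_ac)
qed

text \<open>Forgetting the coordinate \<open>b\<close> maps the torus kernel onto that of the projected vectors, and the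
  fibres are cosets of the torus kernel of the single vector \<open>v b\<close>.\<close>

lemma card_torus_kernel_insert:
  assumes L: "discrete_subgroup L" and S: "finite S" "b \<notin> S" and u: "v b \<in> L" "v b \<noteq> 0"
  shows "card (torus_kernel L v (insert b S)) = card {s \<in> {0..<1}. s *\<^sub>R v b \<in> L} *
     card (torus_kernel (proj_along (v b) ` L) (proj_along (v b) \<circ> v) S)"
proof -
  let ?p = "proj_along (v b)"
  define K where "K = torus_kernel (?p ` L) (?p \<circ> v) S"
  define H where "H = {s \<in> {0..<1}. s *\<^sub>R v b \<in> L}"
  have psum: "(\<Sum>a\<in>S. t a *\<^sub>R (?p \<circ> v) a) = ?p (\<Sum>a\<in>S. t a *\<^sub>R v a)" for t
    by (simp add: linear_sum[OF linear_proj_along] linear_cmul[OF linear_proj_along])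
  have "\<exists>c. (\<Sum>a\<in>S. t a *\<^sub>R v a) + c *\<^sub>R v b \<in> L" if t: "t \<in> K" for t
  proof -
    have "?p (\<Sum>a\<in>S. t a *\<^sub>R v a) \<in> ?p ` L"
      using t unfolding K_def torus_kernel_def psum by blast
    then obtain x where x: "x \<in> L" "?p x = ?p (\<Sum>a\<in>S. t a *\<^sub>R v a)"
      unfolding image_iff by metis
    show ?thesis using proj_along_eqD[OF x(2)] x(1) by metis
  qed
  then obtain c where c: "\<And>t. t \<in> K \<Longrightarrow> (\<Sum>a\<in>S. t a *\<^sub>R v a) + c t *\<^sub>R v b \<in> L" by metis
  define f where "f = (\<lambda>(r, t). t(b := frac (r + c t)))"
  have sumf: "(\<Sum>a\<in>insert b S. (t(b := r)) a *\<^sub>R v a) = (\<Sum>a\<in>S. t a *\<^sub>R v a) + r *\<^sub>R v b" for t r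
  proof -
    have "(\<Sum>a\<in>S. (t(b := r)) a *\<^sub>R v a) = (\<Sum>a\<in>S. t a *\<^sub>R v a)"
      using S by (intro sum.cong) auto
    then show ?thesis using S by simp
  qed
  have "bij_betw f (H \<times> K) (torus_kernel L v (insert b S))"
    unfolding bij_betw_def
  proof (intro conjI equalityI subsetI)
    show "inj_on f (H \<times> K)"
    proof (rule inj_onI, clarify)
      fix r t r' t' assume a: "r \<in> H" "t \<in> K" "r' \<in> H" "t' \<in> K" and eq: "f (r, t) = f (r', t')"
      have res: "t = restrict (f (r, t)) S" if "t \<in> K" for r t
        using that S by (auto simp: f_def K_def torus_kernel_def PiE_def extensional_def fun_eq_iff)
      then have t: "t = t'" using res[OF a(2), of r] res[OF a(4), of r'] eq by simp
      have "f (r, t) b = f (r', t') b" using eq by simp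
      then have "frac (r + c t) = frac (r' + c t)" by (simp add: f_def t)
      then have "r - r' = of_int (\<lfloor>r + c t\<rfloor> - \<lfloor>r' + c t\<rfloor>)" by (simp add: frac_def)
      then have "r - r' \<in> \<int>" by (metis Ints_of_int)
      moreover have "\<bar>r - r'\<bar> < 1" using a by (auto simp: H_def)
      ultimately have "r = r'" using Ints_nonzero_abs_ge1[of "r - r'"] by linarith
      then show "r = r' \<and> t = t'" using t by simp
    qed
  next
    fix t assume "t \<in> f ` (H \<times> K)"
    then obtain r t' where t: "t = t'(b := frac (r + c t'))" "r \<in> H" "t' \<in> K" by (auto simp: f_def)
    have "(\<Sum>a\<in>insert b S. t a *\<^sub>R v a) = (\<Sum>a\<in>S. t' a *\<^sub>R v a) + frac (r + c t') *\<^sub>R v b"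
      unfolding t by (rule sumf)
    also have "\<dots> = ((\<Sum>a\<in>S. t' a *\<^sub>R v a) + c t' *\<^sub>R v b) + r *\<^sub>R v b - of_int \<lfloor>r + c t'\<rfloor> *\<^sub>R v b"
      by (simp add: frac_def algebra_simps)
    also have "\<dots> \<in> L"
      using t(2) by (intro discrete_subgroup_diff[OF L _ discrete_subgroup_scale_int[OF L u(1)]]
          discrete_subgroup_add[OF L c[OF t(3)]]) (auto simp: H_def)
    finally show "t \<in> torus_kernel L v (insert b S)"
      using t by (auto simp: torus_kernel_def K_def frac_lt_1 PiE_def extensional_def)
  next
    fix t assume t: "t \<in> torus_kernel L v (insert b S)"
    define t' where "t' = restrict t S"
    have s: "(\<Sum>a\<in>S. t' a *\<^sub>R v a) = (\<Sum>a\<in>S. t a *\<^sub>R v a)"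
      unfolding t'_def by (intro sum.cong) auto
    have tL: "(\<Sum>a\<in>S. t' a *\<^sub>R v a) + t b *\<^sub>R v b \<in> L"
      using t S unfolding s by (simp add: torus_kernel_def add.commute)
    have "t' \<in> S \<rightarrow>\<^sub>E {0..<1}" using t by (auto simp: t'_def torus_kernel_def)
    moreover have "(\<Sum>a\<in>S. t' a *\<^sub>R (?p \<circ> v) a) \<in> ?p ` L"
      using imageI[OF tL, of ?p] unfolding psum proj_along_add_self[OF u(2)] .
    ultimately have K: "t' \<in> K" unfolding K_def torus_kernel_def by blast
    define r where "r = frac (t b - c t')"
    have "(t b - c t') *\<^sub>R v b \<in> L"
      using discrete_subgroup_diff[OF L tL c[OF K]] by (simp add: algebra_simps)
    then have "(t b - c t') *\<^sub>R v b - of_int \<lfloor>t b - c t'\<rfloor> *\<^sub>R v b \<in> L"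
      by (rule discrete_subgroup_diff[OF L _ discrete_subgroup_scale_int[OF L u(1)]]) simp
    then have "r \<in> H" by (simp add: H_def r_def frac_def frac_lt_1[unfolded frac_def] scaleR_diff_left)
    have "t b \<in> {0..<1}" using t by (auto simp: torus_kernel_def)
    then have "frac (r + c t') = t b"
      by (subst frac_unique_iff) (auto simp: r_def frac_def)
    then have "f (r, t') = t"
      using t by (auto simp: f_def t'_def torus_kernel_def fun_eq_iff PiE_def extensional_def)
    then show "t \<in> f ` (H \<times> K)" using K \<open>r \<in> H\<close> by force
  qed
  from bij_betw_same_card[OF this] show ?thesis
    by (simp add: card_cartesian_product H_def K_def)
qed

text \<open>Induction on \<open>A\<close>: the sets \<open>S\<close> without the new index \<open>b\<close> account for the old lattice points, and
  the sets with \<open>b\<close> for the new ones, which are counted in the projection along \<open>v b\<close>.\<close>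

theorem card_lattice_points_segment_sum:
  fixes v :: "'i \<Rightarrow> 'a::euclidean_space"
  assumes "finite A" "discrete_subgroup L" "\<And>a. a \<in> A \<Longrightarrow> v a \<in> L"
  shows "card (L \<inter> segment_sum v l A) = (\<Sum>S\<in>Pow A. (\<Prod>a\<in>S. l a) * card (torus_kernel L v S))"
  using assms
proof (induction A arbitrary: L v rule: finite_induct)
  case empty
  have "torus_kernel L v {} = {\<lambda>_. undefined}"
    using discrete_subgroup_zero[OF empty(1)] by (auto simp: torus_kernel_def)
  then show ?case using discrete_subgroup_zero[OF empty(1)] by simp
next
  case (insert b A)
  note L = insert.prems(1)
  have u: "v b \<in> L" using insert by simp
  let ?g = "\<lambda>S. (\<Prod>a\<in>S. l a) * card (torus_kernel L v S)"
  have fin: "finite S" "b \<notin> S" if "S \<in> Pow A" for S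
    using that insert.hyps finite_subset by auto
  have "(\<Sum>S\<in>Pow (insert b A). ?g S) = (\<Sum>S\<in>Pow A. ?g S) + (\<Sum>S\<in>insert b ` Pow A. ?g S)"
    unfolding Pow_insert using insert.hyps by (intro sum.union_disjoint) auto
  also have "(\<Sum>S\<in>Pow A. ?g S) = card (L \<inter> segment_sum v l A)"
    using insert.IH[OF L, of v] insert.prems by simp
  also have "(\<Sum>S\<in>insert b ` Pow A. ?g S) = (\<Sum>S\<in>Pow A. ?g (insert b S))"
    using insert.hyps by (intro sum.reindex_cong[of "insert b"]) (auto intro!: inj_onI)
  finally have step: "(\<Sum>S\<in>Pow (insert b A). ?g S) =
      card (L \<inter> segment_sum v l A) + (\<Sum>S\<in>Pow A. ?g (insert b S))" .
  show ?case
  proof (cases "v b = 0")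
    case True
    have "card (torus_kernel L v (insert b S)) = 0" if "S \<in> Pow A" for S
      using that insert.prems fin[OF that] True
      by (intro card_torus_kernel_dependent[OF L, where b = b and c = "\<lambda>a. if a = b then 1 else 0"])
         (auto simp: sum.insert if_distrib[of "\<lambda>x. x *\<^sub>R _"] cong: if_cong)
    then have "(\<Sum>S\<in>Pow A. ?g (insert b S)) = 0" by simp
    moreover have "segment_sum v l (insert b A) = segment_sum v l A"
      unfolding segment_sum_insert[OF insert.hyps] using True by (auto simp: image_iff)
    ultimately show ?thesis using step by simp
  next
    case False
    let ?p = "proj_along (v b)"
    let ?h = "card {s \<in> {0..<1}. s *\<^sub>R v b \<in> L}"
    have "(\<Sum>S\<in>Pow A. ?g (insert b S)) =
        (\<Sum>S\<in>Pow A. l b * ?h * ((\<Prod>a\<in>S. l a) * card (torus_kernel (?p ` L) (?p \<circ> v) S)))"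
      using fin by (intro sum.cong refl)
        (simp add: card_torus_kernel_insert[where b = b and v = v, OF L _ _ u False])
    also have "\<dots> = l b * ?h * card (?p ` L \<inter> segment_sum (?p \<circ> v) l A)"
      unfolding sum_distrib_left[symmetric]
      using insert.IH[OF discrete_subgroup_proj_along[OF L u False], of "?p \<circ> v"] insert.prems by (simp del: comp_apply add: comp_def)
    also have "segment_sum (?p \<circ> v) l A = ?p ` segment_sum v l A"
      by (rule linear_image_segment_sum[OF linear_proj_along])
    also have "card (L \<inter> segment_sum v l A) + l b * ?h * card (?p ` L \<inter> ?p ` segment_sum v l A)
        = card (L \<inter> segment_sum v l (insert b A))"
      unfolding segment_sum_insert[OF insert.hyps]
      by (rule card_Int_add_segment[OF L u False compact_segment_sum[OF insert.hyps(1)]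
            convex_segment_sum, symmetric])
    finally show ?thesis using step by simp
  qed
qed

section \<open>Counting polynomials of virtual zonotopes\<close>

text \<open>The coordinates are freed from the condition to be natural one after the other: on a line parallel
  to an axis, \<open>p\<close> is a polynomial in one variable with infinitely many zeros.\<close>

lemma polynomial_zero_of_zero_on_nats:
  fixes p :: "'a::euclidean_space \<Rightarrow> real"
  assumes p: "real_polynomial_function p"
    and zero: "\<And>x. (\<forall>b\<in>Basis. x \<bullet> b \<in> \<nat>) \<Longrightarrow> p x = 0"
  shows "p x = 0"
proof -
  have "p x = 0" if "finite D" "D \<subseteq> Basis" "\<forall>b\<in>Basis - D. x \<bullet> b \<in> \<nat>" for D x
    using that
  proof (induction D arbitrary: x rule: finite_induct)
    case empty
    then show ?case using zero by simp
  next
    case (insert d D)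
    define f where "f t = p (x + (t - x \<bullet> d) *\<^sub>R d)" for t
    have "polynomial_function (\<lambda>t. x + (t - x \<bullet> d) *\<^sub>R d)"
      by (intro polynomial_function_add polynomial_function_const polynomial_function_mult
          polynomial_function_diff polynomial_function_id)
    from real_polynomial_function_compose[OF this p]
    moreover have "p \<circ> (\<lambda>t. x + (t - x \<bullet> d) *\<^sub>R d) = f" by (simp add: f_def fun_eq_iff)
    ultimately have "real_polynomial_function f" by simp
    then obtain a m where am: "f = (\<lambda>t. \<Sum>i\<le>m. a i * t ^ i)"
      using real_polynomial_function_iff_sum by blast
    have "f (real k) = 0" for k
      unfolding f_def
    proof (rule insert.IH)
      show "D \<subseteq> Basis" using insert.prems by simp
      show "\<forall>b\<in>Basis - D. (x + (real k - x \<bullet> d) *\<^sub>R d) \<bullet> b \<in> \<nat>"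
        using insert.prems insert.hyps by (auto simp: inner_add_left inner_Basis)
    qed
    then have "\<nat> \<subseteq> {t. f t = 0}" by (auto elim: Nats_cases)
    moreover have "infinite (\<nat> :: real set)" using Nats_infinite .
    ultimately have "infinite {t. f t = 0}" using finite_subset by blast
    then have "\<forall>i\<le>m. a i = 0" unfolding am using polyfun_finite_roots by blast
    then have "f (x \<bullet> d) = 0" unfolding am by simp
    then show ?case by (simp add: f_def)
  qed
  from this[OF finite_Basis subset_refl] show ?thesis by simp
qed

lemma points_of_plus: "points_of (P + Q) = points_of P + points_of Q"
  by (simp add: plus_convex_polytope.rep_eq)

lemma points_of_zero: "points_of 0 = {0}"
  by (simp add: zero_convex_polytope.rep_eq)

lemma points_of_plus_point: "points_of (P + point t) = (\<lambda>x. x + t) ` points_of P"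
  by (auto simp: points_of_plus point.rep_eq set_plus_def)

lemma points_of_inject_iff: "P = Q \<longleftrightarrow> points_of P = points_of Q"
  by (simp add: points_of_inject)

lemma virt_eq_iff: "virt P = virt Q \<longleftrightarrow> P = Q"
  unfolding virt_def
  by (simp add: virtual_polytope.abs_eq_iff virt_eq_def)

lemma virt_add: "virt (P + Q) = virt P + virt Q"
  by (simp add: virt_def plus_virtual_polytope.abs_eq)

lemma virt_zero: "virt 0 = 0"
  by (simp add: virt_def zero_virtual_polytope_def)

lemma virt_sum: "virt (sum f A) = (\<Sum>a\<in>A. virt (f a))"
  by (induction A rule: infinite_finite_induct) (simp_all add: virt_zero virt_add)

lemma nat_multiple_simps [simp]:
  "nat_multiple 0 x = 0" "nat_multiple (Suc k) x = nat_multiple k x + x"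
  by (simp_all add: nat_multiple_def)

lemma nat_multiple_add: "nat_multiple (j + k) x = nat_multiple j x + nat_multiple k x"
  by (induction k) (simp_all add: add.assoc)

lemma virt_nat_multiple: "virt (nat_multiple k P) = nat_multiple k (virt P)"
  by (simp add: nat_multiple_def virt_sum)

lemma int_multiple_add_nat:
  assumes "k + int j \<ge> 0"
  shows "int_multiple k x + nat_multiple j x = nat_multiple (nat (k + int j)) x"
proof (cases "k \<ge> 0")
  case True
  then show ?thesis by (simp add: int_multiple_def nat_add_distrib nat_multiple_add)
next
  case False
  then have "j = nat (k + int j) + nat (- k)" using assms by simp
  then have "nat_multiple j x = nat_multiple (nat (k + int j)) x + nat_multiple (nat (- k)) x"
    by (metis nat_multiple_add)
  then show ?thesis using False by (simp add: int_multiple_def)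
qed

lemma zonotope_add:
  "zonotope (\<lambda>i j. l i j + a i j) (\<lambda>k. m k + b k) = zonotope l m + zonotope a b"
  by (simp add: zonotope_def nat_multiple_add sum.distrib case_prod_beta ac_simps)

text \<open>Enough copies of all segments make a virtual zonotope an honest one.\<close>

lemma virtual_zonotope_add_zonotope:
  fixes l :: "'n::{finite,linorder} \<Rightarrow> 'n \<Rightarrow> int"
  assumes "\<And>i j. l i j + int K \<ge> 0" "\<And>k. m k + int K \<ge> 0"
  shows "virtual_zonotope l m + virt (zonotope (\<lambda>_ _. K) (\<lambda>_. K)) =
    virt (zonotope (\<lambda>i j. nat (l i j + int K)) (\<lambda>k. nat (m k + int K)))"
proof -
  have "virtual_zonotope l m + virt (zonotope (\<lambda>_ _. K) (\<lambda>_. K)) =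
      (\<Sum>(i, j)\<in>{(i, j). i < j}. int_multiple (l i j) (virt (q_seg i j)) + nat_multiple K (virt (q_seg i j)))
      + (\<Sum>k\<in>UNIV. int_multiple (m k) (virt (r_seg k)) + nat_multiple K (virt (r_seg k)))"
    by (simp add: virtual_zonotope_def zonotope_def virt_add virt_sum virt_nat_multiple
        sum.distrib case_prod_beta)
  also have "\<dots> = virt (zonotope (\<lambda>i j. nat (l i j + int K)) (\<lambda>k. nat (m k + int K)))"
    using assms by (simp add: int_multiple_add_nat zonotope_def virt_add virt_sum virt_nat_multiple
        case_prod_beta)
  finally show ?thesis .
qed

lemma lattice_count_add_point:
  fixes t :: "real ^ 'n::finite"
  assumes "\<forall>i. t $ i \<in> \<int>"
  shows "lattice_count (P + point t) = lattice_count P"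
proof -
  have "x $ i + t $ i \<in> \<int> \<longleftrightarrow> x $ i \<in> \<int>" for x i
    using assms by (metis Ints_add Ints_diff add_diff_cancel_right')
  then have "{x \<in> points_of (P + point t). \<forall>i. x $ i \<in> \<int>} =
      (\<lambda>x. x + t) ` {x \<in> points_of P. \<forall>i. x $ i \<in> \<int>}"
    by (auto simp: points_of_plus_point)
  then show ?thesis by (simp add: lattice_count_def card_image)
qed

lemma nat_point_cases:
  fixes x :: "((real, 'n::finite) vec, 'm::finite) vec \<times> (real, 'k::finite) vec"
  assumes x: "\<forall>b\<in>Basis. x \<bullet> b \<in> \<nat>"
  obtains l m where "x = (\<chi> i j. real (l i j), \<chi> k. real (m k))"
proof -
  have "fst x $ i $ j \<in> \<nat>" for i j
    using bspec[OF x, of "(axis i (axis j 1), 0)"]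
    by (simp add: Basis_prod_def axis_in_Basis_iff inner_axis inner_prod_def)
  then have "\<exists>k. fst x $ i $ j = real k" for i j by (metis Nats_cases)
  then obtain l where l: "\<And>i j. fst x $ i $ j = real (l i j)" by metis
  have "snd x $ i \<in> \<nat>" for i
    using bspec[OF x, of "(0, axis i 1)"]
    by (simp add: Basis_prod_def axis_in_Basis_iff inner_axis inner_prod_def)
  then have "\<exists>k. snd x $ i = real k" for i by (metis Nats_cases)
  then obtain m where m: "\<And>i. snd x $ i = real (m i)" by metis
  show ?thesis by (rule that[of l m]) (simp add: prod_eq_iff vec_eq_iff l m)
qed

lemma count_poly_eq:
  fixes p :: "((real ^ 'n::{finite,linorder}) ^ 'n::{finite,linorder}) \<times> (real ^ 'n::{finite,linorder}) \<Rightarrow> real"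
  assumes p: "real_polynomial_function p"
    and count: "\<And>l m. p (\<chi> i j. real (l i j), \<chi> k. real (m k)) = real (lattice_count (zonotope l m))"
  shows "count_poly = p"
  unfolding count_poly_def
proof (rule the_equality)
  show "real_polynomial_function p \<and>
     (\<forall>l m. p (\<chi> i j. real (l i j), \<chi> k. real (m k)) = real (lattice_count (zonotope l m)))"
    using assms by simp
next
  fix q :: "((real, 'n) vec, 'n) vec \<times> (real, 'n) vec \<Rightarrow> real"
  assume q: "real_polynomial_function q \<and>
     (\<forall>l m. q (\<chi> i j. real (l i j), \<chi> k. real (m k)) = real (lattice_count (zonotope l m)))"
  have "q x - p x = 0" for x
  proof (rule polynomial_zero_of_zero_on_nats[of "\<lambda>x. q x - p x"])
    show "real_polynomial_function (\<lambda>x. q x - p x)"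
      using p q by (intro real_polynomial_function_diff) auto
  next
    fix x :: "((real, 'n) vec, 'n) vec \<times> (real, 'n) vec"
    assume x: "\<forall>b\<in>Basis. x \<bullet> b \<in> \<nat>"
    obtain l m where "x = (\<chi> i j. real (l i j), \<chi> k. real (m k))"
      using x by (rule nat_point_cases)
    then show "q x - p x = 0" using q count by simp
  qed
  then show "q = p" by (simp add: fun_eq_iff)
qed

text \<open>Two representations of the same virtual polytope become zonotopes that are integer translates of each
  other when the same large zonotope is added to both. So the two shifted counting polynomials agree at
  all natural points, hence everywhere, in particular where the shift is undone.\<close>

lemma virtual_lattice_count_eq:
  fixes l :: "'n::{finite,linorder} \<Rightarrow> 'n \<Rightarrow> int" and t :: "(real, 'n) vec"
  assumes p: "real_polynomial_function p"
    and count: "\<And>(l::'n \<Rightarrow> 'n \<Rightarrow> nat) (m::'n \<Rightarrow> nat). p (\<chi> i j. real (l i j), \<chi> k. real (m k)) = real (lattice_count (zonotope l m))"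
    and t: "\<forall>i. t $ i \<in> \<int>"
  shows "virtual_lattice_count (virtual_zonotope l m + virt (point t)) =
    p (\<chi> i j. real_of_int (l i j), \<chi> k. real_of_int (m k))"
  unfolding virtual_lattice_count_def count_poly_eq[OF p count]
proof (rule the_equality)
  show "\<exists>l' m' t'. (\<forall>i. t' $ i \<in> \<int>) \<and>
     virtual_zonotope l m + virt (point t) = virtual_zonotope l' m' + virt (point t') \<and>
     p (\<chi> i j. real_of_int (l i j), \<chi> k. real_of_int (m k)) =
       p (\<chi> i j. real_of_int (l' i j), \<chi> k. real_of_int (m' k))"
    using t by blast
next
  fix c
  assume "\<exists>l' m' t'. (\<forall>i. t' $ i \<in> \<int>) \<and>
     virtual_zonotope l m + virt (point t) = virtual_zonotope l' m' + virt (point t') \<and>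
     c = p (\<chi> i j. real_of_int (l' i j), \<chi> k. real_of_int (m' k))"
  then obtain l' m' t' where t': "\<forall>i. t' $ i \<in> \<int>"
    and eq: "virtual_zonotope l m + virt (point t) = virtual_zonotope l' m' + virt (point t')"
    and c: "c = p (\<chi> i j. real_of_int (l' i j), \<chi> k. real_of_int (m' k))" by blast
  define B where "B = (\<Union>i j. {\<bar>l i j\<bar>, \<bar>l' i j\<bar>}) \<union> (\<Union>k. {\<bar>m k\<bar>, \<bar>m' k\<bar>})"
  define K where "K = nat (Max B)"
  have finB: "finite B" by (simp add: B_def)
  have le: "x \<le> int K" if "x \<in> B" for x
    using Max_ge[OF finB that] by (simp add: K_def)
  have bnd: "\<bar>l i j\<bar> \<le> int K" "\<bar>l' i j\<bar> \<le> int K" "\<bar>m k\<bar> \<le> int K" "\<bar>m' k\<bar> \<le> int K" for i j k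
    by (rule le, force simp: B_def)+
  define sh where "sh = (\<lambda>(a::'n \<Rightarrow> 'n \<Rightarrow> int) (b::'n \<Rightarrow> int).
     ((\<chi> i j. real_of_int (a i j) + real K, \<chi> k. real_of_int (b k) + real K) ::
       ((real, 'n) vec, 'n) vec \<times> (real, 'n) vec))"
  have "p (x + sh l m) - p (x + sh l' m') = 0" for x
  proof (rule polynomial_zero_of_zero_on_nats[of "\<lambda>x. p (x + sh l m) - p (x + sh l' m')"])
    have "real_polynomial_function (\<lambda>x. p (x + a))" for a
      using real_polynomial_function_compose[OF polynomial_function_add[OF polynomial_function_id polynomial_function_const] p]
      by (simp add: comp_def)
    then show "real_polynomial_function (\<lambda>x. p (x + sh l m) - p (x + sh l' m'))"
      by (intro real_polynomial_function_diff)
  next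
    fix x :: "((real, 'n) vec, 'n) vec \<times> (real, 'n) vec"
    assume x: "\<forall>b\<in>Basis. x \<bullet> b \<in> \<nat>"
    obtain a b where ab: "x = (\<chi> i j. real (a i j), \<chi> k. real (b k))"
      using x by (rule nat_point_cases)
    let ?Z = "\<lambda>(l::'n \<Rightarrow> 'n \<Rightarrow> int) m. zonotope (\<lambda>i j. nat (l i j + int K) + a i j) (\<lambda>k. nat (m k + int K) + b k)"
    have val: "p (x + sh l m) = real (lattice_count (?Z l m))"
      if "\<And>i j. \<bar>l i j\<bar> \<le> int K" "\<And>k. \<bar>m k\<bar> \<le> int K" for l m
    proof -
      have "real (nat (l i j + int K)) = real_of_int (l i j) + real K"
           "real (nat (m k + int K)) = real_of_int (m k) + real K" for i j k
        using that(1)[of i j] that(2)[of k] by simp_all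
      then have "x + sh l m = (\<chi> i j. real (nat (l i j + int K) + a i j), \<chi> k. real (nat (m k + int K) + b k))"
        by (simp add: prod_eq_iff vec_eq_iff sh_def ab)
      then show ?thesis by (simp only: count)
    qed
    have Z: "virt (?Z l m) = virtual_zonotope l m + virt (zonotope (\<lambda>_ _. K) (\<lambda>_. K)) + virt (zonotope a b)"
      if "\<And>i j. \<bar>l i j\<bar> \<le> int K" "\<And>k. \<bar>m k\<bar> \<le> int K" for l m
    proof -
      have "l i j + int K \<ge> 0" "m k + int K \<ge> 0" for i j k
        using that(1)[of i j] that(2)[of k] by linarith+
      then show ?thesis
        by (simp add: virtual_zonotope_add_zonotope zonotope_add virt_add)
    qed
    have "virt (?Z l m + point t) = virt (?Z l' m' + point t')"
      unfolding virt_add Z[OF bnd(1,3)] Z[OF bnd(2,4)] using eq by (simp add: algebra_simps)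
    then have "?Z l m + point t = ?Z l' m' + point t'" by (simp add: virt_eq_iff)
    then have "lattice_count (?Z l m) = lattice_count (?Z l' m')"
      using lattice_count_add_point[OF t, of "?Z l m"] lattice_count_add_point[OF t', of "?Z l' m'"]
      by simp
    then show "p (x + sh l m) - p (x + sh l' m') = 0"
      using val[OF bnd(1,3)] val[OF bnd(2,4)] by simp
  qed
  \<comment> \<open>undo the shift by \<open>K\<close>\<close>
  from this[of "(\<chi> i j. - real K, \<chi> k. - real K)"]
  show "c = p (\<chi> i j. real_of_int (l i j), \<chi> k. real_of_int (m k))"
    by (simp add: c sh_def plus_vec_def)
qed

section \<open>The generators of the cyclopermutohedron\<close>

definition edges_of :: "'v set \<Rightarrow> 'v set set" where
  "edges_of W = {e. e \<subseteq> W \<and> card e = 2}"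

text \<open>Edges are sets of two vertices and not pairs, so that a set of generators is the edge set of a
  graph.\<close>

definition edge_vec :: "'n::{finite,linorder} set \<Rightarrow> (real, 'n) vec" where
  "edge_vec e = axis (Max e) 1 - axis (Min e) 1"

definition gen :: "'n::{finite,linorder} set + 'n \<Rightarrow> (real, 'n) vec" where
  "gen = case_sum edge_vec R_vec"

definition int_vecs :: "(real ^ 'n::finite) set" where
  "int_vecs = {x. \<forall>i. x $ i \<in> \<int>}"

lemma gen_simps [simp]: "gen (Inl e) = edge_vec e" "gen (Inr k) = R_vec k"
  by (simp_all add: gen_def)

lemma edges_of_card_2_cases:
  fixes e :: "'n::linorder set"
  assumes "card e = 2"
  obtains i j where "i < j" "e = {i, j}" "Min e = i" "Max e = j"
proof -
  obtain x y where xy: "e = {x, y}" "x \<noteq> y" using assms by (auto simp: card_2_iff)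
  show ?thesis
  proof (cases "x < y")
    case True
    then show ?thesis using xy that[of x y] by (simp add: min_def max_def)
  next
    case False
    then show ?thesis using xy that[of y x] by (auto simp: min_def max_def insert_commute)
  qed
qed

lemma sum_pairs_less_eq_sum_edges:
  fixes f :: "'n::{finite,linorder} \<Rightarrow> 'n \<Rightarrow> 'a::comm_monoid_add"
  shows "(\<Sum>(i, j)\<in>{(i, j). i < j}. f i j) = (\<Sum>e\<in>edges_of UNIV. f (Min e) (Max e))"
proof (rule sum.reindex_bij_witness[of _ "\<lambda>e. (Min e, Max e)" "\<lambda>(i, j). {i, j}"])
  fix e :: "'n set" assume "e \<in> edges_of UNIV"
  then show "(case (Min e, Max e) of (i, j) \<Rightarrow> {i, j}) = e" "(Min e, Max e) \<in> {(i, j). i < j}"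
    by (auto simp: edges_of_def elim!: edges_of_card_2_cases)
qed (auto simp: edges_of_def card_2_iff min_def max_def)

lemma discrete_subgroup_int_vecs: "discrete_subgroup (int_vecs :: (real ^ 'n::finite) set)"
  unfolding discrete_subgroup_def
proof (intro conjI allI impI ballI)
  show "(0 :: real ^ 'n) \<in> int_vecs" by (simp add: int_vecs_def)
  show "x - y \<in> int_vecs" if "x \<in> int_vecs" "y \<in> int_vecs" for x y :: "real ^ 'n"
    using that by (simp add: int_vecs_def)
  fix B :: "(real ^ 'n) set" assume "bounded B"
  then obtain r where r: "\<And>x. x \<in> B \<Longrightarrow> norm x \<le> r" by (auto simp: bounded_iff)
  have fin: "finite {z::real. z \<in> \<int> \<and> \<bar>z\<bar> \<le> r}" by (rule finite_abs_int_segment)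
  have "int_vecs \<inter> B \<subseteq> vec_lambda ` (UNIV \<rightarrow>\<^sub>E {z. z \<in> \<int> \<and> \<bar>z\<bar> \<le> r})"
  proof
    fix x assume x: "x \<in> int_vecs \<inter> B"
    have "\<bar>x $ i\<bar> \<le> r" for i
      using component_le_norm_cart[of x i] r[of x] x by simp
    then have "($) x \<in> UNIV \<rightarrow>\<^sub>E {z. z \<in> \<int> \<and> \<bar>z\<bar> \<le> r}"
      using x by (auto simp: int_vecs_def)
    then show "x \<in> vec_lambda ` (UNIV \<rightarrow>\<^sub>E {z. z \<in> \<int> \<and> \<bar>z\<bar> \<le> r})"
      by (rule rev_image_eqI) (simp add: vec_nth_inverse)
  qed
  moreover have "finite (vec_lambda ` ((UNIV::'n set) \<rightarrow>\<^sub>E {z::real. z \<in> \<int> \<and> \<bar>z\<bar> \<le> r}))"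
    using fin by (intro finite_imageI finite_PiE) auto
  ultimately show "finite (int_vecs \<inter> B)" by (rule finite_subset)
qed

lemma axis_in_int_vecs: "axis i 1 \<in> int_vecs"
  by (simp add: int_vecs_def axis_def)

lemma gen_in_int_vecs: "gen a \<in> int_vecs"
proof -
  note L = discrete_subgroup_int_vecs
  show ?thesis
    by (cases a) (auto simp: edge_vec_def R_vec_def
        intro!: discrete_subgroup_diff[OF L] discrete_subgroup_sum[OF L] axis_in_int_vecs)
qed

lemma points_of_sum_segments:
  fixes P :: "'i \<Rightarrow> 'a::euclidean_space convex_polytope"
  assumes "finite A" "\<And>a. a \<in> A \<Longrightarrow> points_of (P a) = (\<lambda>s. w a + s *\<^sub>R v a) ` {0..1}"
  shows "points_of (\<Sum>a\<in>A. nat_multiple (l a) (P a)) =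
    (\<lambda>x. (\<Sum>a\<in>A. real (l a) *\<^sub>R w a) + x) ` segment_sum v l A"
  using assms
proof (induction A rule: finite_induct)
  case empty
  then show ?case by (simp add: points_of_zero)
next
  case (insert b A)
  have mult: "points_of (nat_multiple k (P b)) = (\<lambda>s. real k *\<^sub>R w b + s *\<^sub>R v b) ` {0..real k}" for k
  proof (induction k)
    case 0
    then show ?case by (simp add: points_of_zero)
  next
    case (Suc k)
    show ?case
    proof (intro equalityI subsetI)
      fix x assume "x \<in> points_of (nat_multiple (Suc k) (P b))"
      then obtain s r where x: "x = (real k *\<^sub>R w b + s *\<^sub>R v b) + (w b + r *\<^sub>R v b)"
          and sr: "s \<in> {0..real k}" "r \<in> {0..1}"
        using insert.prems by (auto simp: points_of_plus Suc set_plus_def)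
      have "x = real (Suc k) *\<^sub>R w b + (s + r) *\<^sub>R v b" by (simp add: x algebra_simps)
      moreover have "s + r \<in> {0..real (Suc k)}" using sr by auto
      ultimately show "x \<in> (\<lambda>s. real (Suc k) *\<^sub>R w b + s *\<^sub>R v b) ` {0..real (Suc k)}" by blast
    next
      fix x assume "x \<in> (\<lambda>s. real (Suc k) *\<^sub>R w b + s *\<^sub>R v b) ` {0..real (Suc k)}"
      then obtain s where s: "x = real (Suc k) *\<^sub>R w b + s *\<^sub>R v b" "0 \<le> s" "s \<le> real k + 1"
        unfolding image_iff Bex_def atLeastAtMost_iff by (auto simp: add.commute)
      define r where "r = min 1 s"
      have "x = (real k *\<^sub>R w b + (s - r) *\<^sub>R v b) + (w b + r *\<^sub>R v b)"
        by (simp add: s algebra_simps)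
      moreover have "s - r \<in> {0..real k}" "r \<in> {0..1}" using s by (auto simp: r_def min_def)
      ultimately show "x \<in> points_of (nat_multiple (Suc k) (P b))"
        using insert.prems unfolding nat_multiple_simps points_of_plus Suc set_plus_def by blast
    qed
  qed
  let ?c = "\<Sum>a\<in>A. real (l a) *\<^sub>R w a"
  have "points_of (\<Sum>a\<in>insert b A. nat_multiple (l a) (P a)) =
      {x + y | x y. x \<in> (\<lambda>s. real (l b) *\<^sub>R w b + s *\<^sub>R v b) ` {0..real (l b)} \<and>
         y \<in> (\<lambda>x. ?c + x) ` segment_sum v l A}"
    using insert by (simp add: points_of_plus mult set_plus_def) blast
  also have "\<dots> = {(real (l b) *\<^sub>R w b + s *\<^sub>R v b) + (?c + x) | s x. s \<in> {0..real (l b)} \<and> x \<in> segment_sum v l A}"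
    by blast
  also have "\<dots> = {real (l b) *\<^sub>R w b + ?c + (x + s *\<^sub>R v b) | s x. s \<in> {0..real (l b)} \<and> x \<in> segment_sum v l A}"
    by (simp add: ac_simps)
  also have "\<dots> = (\<lambda>x. (\<Sum>a\<in>insert b A. real (l a) *\<^sub>R w a) + x) ` segment_sum v l (insert b A)"
    unfolding segment_sum_insert[OF insert.hyps] sum.insert[OF insert.hyps] by blast
  finally show ?case .
qed

lemma points_of_q_seg:
  fixes i j :: "'n::finite"
  shows "points_of (q_seg i j) = (\<lambda>s. axis i 1 + s *\<^sub>R (axis j 1 - axis i 1)) ` {0..1}"
  unfolding q_seg.rep_eq closed_segment_image_interval
  by (intro image_cong refl) (simp add: algebra_simps)

lemma points_of_r_seg:
  fixes k :: "'n::finite"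
  shows "points_of (r_seg k) = (\<lambda>s. s *\<^sub>R R_vec k) ` {0..1}"
  unfolding r_seg.rep_eq closed_segment_image_interval by simp

definition gen_coeff :: "('n::{finite,linorder} \<Rightarrow> 'n \<Rightarrow> 'a) \<Rightarrow> ('n \<Rightarrow> 'a) \<Rightarrow> 'n set + 'n \<Rightarrow> 'a" where
  "gen_coeff l m = case_sum (\<lambda>e. l (Min e) (Max e)) m"

text \<open>Up to an integer translation, \<open>[e\<^sub>i, e\<^sub>j]\<close> is \<open>[0, e\<^sub>j - e\<^sub>i]\<close>.\<close>

lemma points_of_zonotope:
  fixes l :: "'n::{finite,linorder} \<Rightarrow> 'n \<Rightarrow> nat"
  obtains c where "c \<in> int_vecs"
    "points_of (zonotope l m) = (\<lambda>x. c + x) ` segment_sum gen (gen_coeff l m) (edges_of UNIV <+> UNIV)"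
proof -
  define P :: "'n set + 'n \<Rightarrow> (real, 'n) vec convex_polytope" where
    "P = case_sum (\<lambda>e. q_seg (Min e) (Max e)) r_seg"
  define w :: "'n set + 'n \<Rightarrow> (real, 'n) vec" where "w = case_sum (\<lambda>e. axis (Min e) 1) (\<lambda>_. 0)"
  let ?A = "(edges_of UNIV :: 'n set set) <+> (UNIV :: 'n set)"
  let ?c = "\<Sum>a\<in>?A. real (gen_coeff l m a) *\<^sub>R w a"
  have "zonotope l m = (\<Sum>a\<in>?A. nat_multiple (gen_coeff l m a) (P a))"
    by (simp add: zonotope_def sum_pairs_less_eq_sum_edges sum.Plus gen_coeff_def P_def)
  moreover have "points_of (P a) = (\<lambda>s. w a + s *\<^sub>R gen a) ` {0..1}" for a
    by (cases a) (simp_all add: P_def w_def gen_def points_of_q_seg points_of_r_seg edge_vec_def)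
  ultimately have "points_of (zonotope l m) = (\<lambda>x. ?c + x) ` segment_sum gen (gen_coeff l m) ?A"
    by (simp add: points_of_sum_segments)
  moreover have "?c \<in> int_vecs"
  proof -
    note L = discrete_subgroup_int_vecs
    have "w a \<in> int_vecs" for a
      by (cases a) (auto simp: w_def axis_in_int_vecs discrete_subgroup_zero[OF L])
    then show ?thesis
      by (intro discrete_subgroup_sum[OF L] discrete_subgroup_scale_int[OF L]) auto
  qed
  ultimately show ?thesis using that by blast
qed

text \<open>The counting polynomial, with the sets of generators split into an edge set \<open>F\<close> and a vertex set
  \<open>M\<close>.\<close>

definition lattice_poly :: "('n::{finite,linorder} \<Rightarrow> 'n \<Rightarrow> real) \<Rightarrow> ('n \<Rightarrow> real) \<Rightarrow> real" where
  "lattice_poly l m = (\<Sum>F\<in>Pow (edges_of UNIV). \<Sum>M\<in>Pow UNIV.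
     (\<Prod>e\<in>F. l (Min e) (Max e)) * (\<Prod>k\<in>M. m k) * real (card (torus_kernel int_vecs gen (F <+> M))))"

lemma sum_Pow_Plus:
  assumes "finite A" "finite B"
  shows "sum f (Pow (A <+> B)) = (\<Sum>F\<in>Pow A. \<Sum>M\<in>Pow B. f (F <+> M))"
proof -
  have "sum f (Pow (A <+> B)) = (\<Sum>(F, M)\<in>Pow A \<times> Pow B. f (F <+> M))"
  proof (rule sum.reindex_bij_witness[of _ "\<lambda>(F, M). F <+> M" "\<lambda>S. (Inl -` S, Inr -` S)"])
    fix S assume "S \<in> Pow (A <+> B)"
    then show "(Inl -` S, Inr -` S) \<in> Pow A \<times> Pow B" by auto
    have "x \<in> (Inl -` S <+> Inr -` S) \<longleftrightarrow> x \<in> S" for x by (cases x) auto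
    then have *: "Inl -` S <+> Inr -` S = S" by blast
    then show "(case (Inl -` S, Inr -` S) of (F, M) \<Rightarrow> F <+> M) = S" by simp
    show "(case (Inl -` S, Inr -` S) of (F, M) \<Rightarrow> f (F <+> M)) = f S" using * by simp
  qed auto
  then show ?thesis by (simp add: sum.cartesian_product)
qed

lemma lattice_count_zonotope:
  fixes l :: "'n::{finite,linorder} \<Rightarrow> 'n \<Rightarrow> nat"
  shows "real (lattice_count (zonotope l m)) = lattice_poly (\<lambda>i j. real (l i j)) (\<lambda>k. real (m k))"
proof -
  let ?A = "(edges_of UNIV :: 'n set set) <+> (UNIV :: 'n set)"
  note L = discrete_subgroup_int_vecs
  obtain c where c: "c \<in> int_vecs"
      "points_of (zonotope l m) = (\<lambda>x. c + x) ` segment_sum gen (gen_coeff l m) ?A"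
    by (rule points_of_zonotope)
  have *: "c + x \<in> int_vecs \<longleftrightarrow> x \<in> int_vecs" for x
    using discrete_subgroup_add[OF L c(1), of x] discrete_subgroup_diff[OF L _ c(1), of "c + x"] by auto
  have "{x \<in> points_of (zonotope l m). \<forall>i. x $ i \<in> \<int>} = int_vecs \<inter> points_of (zonotope l m)"
    by (auto simp: int_vecs_def)
  also have "\<dots> = (\<lambda>x. c + x) ` (int_vecs \<inter> segment_sum gen (gen_coeff l m) ?A)"
    unfolding c(2) using * by blast
  finally have "{x \<in> points_of (zonotope l m). \<forall>i. x $ i \<in> \<int>} =
      (\<lambda>x. c + x) ` (int_vecs \<inter> segment_sum gen (gen_coeff l m) ?A)" .
  then have "lattice_count (zonotope l m) = card (int_vecs \<inter> segment_sum gen (gen_coeff l m) ?A)"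
    by (simp add: lattice_count_def card_image)
  also have "\<dots> = (\<Sum>S\<in>Pow ?A. (\<Prod>a\<in>S. gen_coeff l m a) * card (torus_kernel int_vecs gen S))"
    by (rule card_lattice_points_segment_sum[OF _ L]) (auto simp: gen_in_int_vecs)
  finally show ?thesis
    by (simp add: sum_Pow_Plus lattice_poly_def prod.Plus gen_coeff_def)
qed

lemma virtual_lattice_count_virtual_zonotope:
  fixes l :: "'n::{finite,linorder} \<Rightarrow> 'n \<Rightarrow> int"
  assumes "t \<in> int_vecs"
  shows "virtual_lattice_count (virtual_zonotope l m + virt (point t)) =
    lattice_poly (\<lambda>i j. real_of_int (l i j)) (\<lambda>k. real_of_int (m k))"
proof -
  define p :: "((real, 'n) vec, 'n) vec \<times> (real, 'n) vec \<Rightarrow> real" where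
    "p x = lattice_poly (\<lambda>i j. fst x $ i $ j) (\<lambda>k. snd x $ k)" for x
  have 1: "real_polynomial_function (\<lambda>x. fst x $ i $ j :: real)"
    for i j :: 'n
    by (intro real_polynomial_function.intros(1) bounded_linear_compose[OF bounded_linear_vec_nth]
        bounded_linear_compose[OF bounded_linear_vec_nth bounded_linear_fst])
  have 2: "real_polynomial_function (\<lambda>x. snd x $ i :: real)" for i :: 'n
    by (intro real_polynomial_function.intros(1) bounded_linear_compose[OF bounded_linear_vec_nth bounded_linear_snd])
  have "real_polynomial_function p"
    unfolding p_def lattice_poly_def
    by (intro real_polynomial_function_sum real_polynomial_function.intros(2,4)
        real_polynomial_function_prod 1 2) auto
  moreover have "p (\<chi> i j. real (l i j), \<chi> k. real (m k)) = real (lattice_count (zonotope l m))" for l m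
    by (simp add: p_def lattice_count_zonotope)
  ultimately have "virtual_lattice_count (virtual_zonotope l m + virt (point t)) =
      p (\<chi> i j. real_of_int (l i j), \<chi> k. real_of_int (m k))"
    using assms by (intro virtual_lattice_count_eq) (auto simp: int_vecs_def)
  then show ?thesis by (simp add: p_def)
qed

lemma int_multiple_simps [simp]: "int_multiple 1 x = x" "int_multiple (- 1) x = - x"
  by (simp_all add: int_multiple_def nat_multiple_def)

lemma virtual_lattice_count_cyclopermutohedron:
  "virtual_lattice_count (cyclopermutohedron :: (real ^ 'n::{finite,linorder}) virtual_polytope) =
    lattice_poly (\<lambda>_ (_::'n). 1) (\<lambda>_. - 1)"
proof -
  have "(cyclopermutohedron :: (real ^ 'n::{finite,linorder}) virtual_polytope) =
      virtual_zonotope (\<lambda>_ _. 1) (\<lambda>_. - 1) + virt (point (\<chi> i. 1))"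
    by (simp add: cyclopermutohedron_def virtual_zonotope_def sum_negf)
  then show ?thesis
    using virtual_lattice_count_virtual_zonotope[of "\<chi> i. 1" "\<lambda>_ (_::'n). 1" "\<lambda>_. - 1"]
    by (simp add: int_vecs_def)
qed

lemma convex_points_of: "convex (points_of P)" and compact_points_of: "compact (points_of P)"
  using points_of[of P] polytope_imp_convex polytope_imp_compact by auto

text \<open>Ties in \<open>a\<close> are broken by the order of the indices.\<close>

lemma exists_decreasing_ranking:
  fixes a :: "'n::{finite,linorder} \<Rightarrow> real"
  obtains \<pi> where "bij_betw \<pi> UNIV {1..CARD('n)}" "\<And>i j. \<pi> i < \<pi> j \<Longrightarrow> a j \<le> a i"
proof -
  define before where "before i = {j. a j > a i \<or> (a j = a i \<and> j < i)}" for i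
  define \<pi> where "\<pi> i = Suc (card (before i))" for i
  have less: "\<pi> i < \<pi> j" if "i \<in> before j" for i j
  proof -
    have "before i \<subset> before j" using that by (auto simp: before_def)
    then show ?thesis by (simp add: \<pi>_def psubset_card_mono)
  qed
  have total: "i \<in> before j \<or> j \<in> before i" if "i \<noteq> j" for i j
    using that by (auto simp: before_def)
  have "inj \<pi>"
    using total less by (metis injI less_irrefl)
  moreover have "\<pi> i \<le> CARD('n)" for i
  proof -
    have "before i \<subset> UNIV" by (auto simp: before_def)
    then have "card (before i) < CARD('n)" by (intro psubset_card_mono) auto
    then show ?thesis by (simp add: \<pi>_def)
  qed
  then have "range \<pi> \<subseteq> {1..CARD('n)}" by (auto simp: \<pi>_def)
  ultimately have "bij_betw \<pi> UNIV {1..CARD('n)}"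
    by (simp add: bij_betw_def card_subset_eq card_image)
  moreover have "a j \<le> a i" if "\<pi> i < \<pi> j" for i j
  proof (rule ccontr)
    assume "\<not> a j \<le> a i"
    then have "j \<in> before i" by (simp add: before_def)
    then show False using less[of j i] that by simp
  qed
  ultimately show ?thesis using that by blast
qed

text \<open>A permutation \<open>\<pi>\<close> is the sum over all edges of the unit vector at the end with the larger value of \<open>\<pi>\<close>,
  plus the all-ones vector. Conversely, a linear functional \<open>a\<close> attains its minimum on the zonotope by
  choosing in every edge the end with the smaller value of \<open>a\<close>. The permutation that ranks the coordinates
  of \<open>a\<close> decreasingly makes these choices, so no hyperplane separates a point of the zonotope from the
  permutohedron.\<close>

lemma permutohedron_eq_zonotope:
  "(permutohedron :: (real ^ 'n::{finite,linorder}) convex_polytope) =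
     zonotope (\<lambda>_ _. 1) (\<lambda>_. 0) + point (\<chi> i. 1)"
proof -
  let ?P = "permutohedron :: (real, 'n) vec convex_polytope"
  let ?B = "{\<pi>. bij_betw \<pi> (UNIV :: 'n set) {1..CARD('n)}}"
  let ?E = "edges_of UNIV :: 'n set set"
  define v :: "('n \<Rightarrow> nat) \<Rightarrow> (real, 'n) vec" where "v \<pi> = (\<chi> i. real (\<pi> i))" for \<pi>
  define Q where "Q = (zonotope (\<lambda>_ _. 1) (\<lambda>_. 0) + point (\<chi> i. 1) :: (real, 'n) vec convex_polytope)"
  define one :: "(real, 'n) vec" where "one = (\<chi> i. 1)"
  define pick where "pick \<pi> e = (if \<pi> (Min e) < \<pi> (Max e) then Max e else Min e)"
    for \<pi> :: "'n \<Rightarrow> nat" and e :: "'n set"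
  define zp where "zp s = (\<Sum>e\<in>?E. axis (Min e) 1 + s e *\<^sub>R edge_vec e) + one"
    for s :: "'n set \<Rightarrow> real"
  have "zonotope (\<lambda>_ _. 1) (\<lambda>_. 0) = (\<Sum>e\<in>?E. nat_multiple 1 (q_seg (Min e) (Max e)))"
    by (simp add: zonotope_def sum_pairs_less_eq_sum_edges)
  then have "points_of (zonotope (\<lambda>_ _. 1) (\<lambda>_. 0)) =
      (\<lambda>x. (\<Sum>e\<in>?E. real 1 *\<^sub>R axis (Min e) 1) + x) ` segment_sum edge_vec (\<lambda>_. 1) ?E"
    using points_of_sum_segments[of ?E "\<lambda>e. q_seg (Min e) (Max e)" "\<lambda>e. axis (Min e) 1" edge_vec "\<lambda>_. 1"]
    by (simp add: points_of_q_seg edge_vec_def)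
  then have Q_eq: "points_of Q = zp ` {s. \<forall>e\<in>?E. 0 \<le> s e \<and> s e \<le> 1}"
    unfolding Q_def points_of_plus_point segment_sum_def zp_def
    by (auto simp: sum.distrib one_def image_iff add.assoc)
  have P_eq: "points_of ?P = convex hull (v ` ?B)"
    unfolding permutohedron.rep_eq v_def ..
  have v_eq: "v \<pi> = (\<Sum>e\<in>?E. axis (pick \<pi> e) 1) + one" if "\<pi> \<in> ?B" for \<pi>
  proof -
    have inj: "\<pi> i = \<pi> j \<longleftrightarrow> i = j" for i j using that by (auto simp: bij_betw_def inj_eq)
    have "(\<Sum>e\<in>?E. axis (pick \<pi> e) 1 $ i) + 1 = real (\<pi> i)" for i
    proof -
      have "(\<Sum>e\<in>?E. axis (pick \<pi> e) (1::real) $ i) = real (card {e \<in> ?E. pick \<pi> e = i})"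
        by (simp add: axis_def sum.If_cases Int_def eq_commute cong: if_cong)
      also have "bij_betw (\<lambda>j. {i, j}) {j. \<pi> j < \<pi> i} {e \<in> ?E. pick \<pi> e = i}"
        unfolding bij_betw_def
      proof (intro conjI equalityI subsetI)
        show "inj_on (\<lambda>j. {i, j}) {j. \<pi> j < \<pi> i}" by (auto simp: inj_on_def doubleton_eq_iff)
      next
        fix e assume "e \<in> (\<lambda>j. {i, j}) ` {j. \<pi> j < \<pi> i}"
        then obtain j where j: "e = {i, j}" "\<pi> j < \<pi> i" by auto
        then have "i \<noteq> j" by auto
        then show "e \<in> {e \<in> ?E. pick \<pi> e = i}"
          using j by (auto simp: edges_of_def pick_def min_def max_def)
      next
        fix e assume e: "e \<in> {e \<in> ?E. pick \<pi> e = i}"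
        then obtain x y where "x < y" "e = {x, y}" "Min e = x" "Max e = y"
          by (auto simp: edges_of_def elim!: edges_of_card_2_cases)
        then show "e \<in> (\<lambda>j. {i, j}) ` {j. \<pi> j < \<pi> i}"
          using e inj[of x y] by (cases "\<pi> x < \<pi> y") (auto simp: pick_def)
      qed
      then have "card {e \<in> ?E. pick \<pi> e = i} = card {j. \<pi> j < \<pi> i}"
        by (rule bij_betw_same_card[symmetric])
      also have "\<dots> = card (\<pi> ` {j. \<pi> j < \<pi> i})"
        by (rule card_image[symmetric]) (simp add: inj_on_def inj)
      also have "\<pi> ` {j. \<pi> j < \<pi> i} = {1..<\<pi> i}"
      proof (intro equalityI subsetI)
        fix y assume "y \<in> \<pi> ` {j. \<pi> j < \<pi> i}"
        then show "y \<in> {1..<\<pi> i}" using that by (auto simp: bij_betw_def)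
      next
        fix y assume y: "y \<in> {1..<\<pi> i}"
        moreover have "\<pi> i \<in> {1..CARD('n)}" using that by (auto simp: bij_betw_def)
        ultimately have "y \<in> {1..CARD('n)}" by auto
        then have "y \<in> range \<pi>" using that by (auto simp: bij_betw_def)
        then show "y \<in> \<pi> ` {j. \<pi> j < \<pi> i}" using y by auto
      qed
      finally have "(\<Sum>e\<in>?E. axis (pick \<pi> e) (1::real) $ i) = real (\<pi> i - 1)" by simp
      moreover have "\<pi> i \<in> {1..CARD('n)}" using that by (auto simp: bij_betw_def)
      ultimately show ?thesis by (simp add: of_nat_diff)
    qed
    then show ?thesis by (simp add: vec_eq_iff v_def one_def)
  qed
  have "points_of ?P \<subseteq> points_of Q"
    unfolding P_eq
  proof (rule hull_minimal)
    show "v ` ?B \<subseteq> points_of Q"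
    proof clarify
      fix \<pi> assume \<pi>: "bij_betw \<pi> (UNIV :: 'n set) {1..CARD('n)}"
      define s where "s e = (if \<pi> (Min e) < \<pi> (Max e) then 1 else 0 :: real)" for e
      have "axis (pick \<pi> e) 1 = axis (Min e) 1 + s e *\<^sub>R edge_vec e" for e
        by (simp add: pick_def s_def edge_vec_def)
      then have "v \<pi> = zp s" using v_eq \<pi> by (simp add: zp_def)
      then show "v \<pi> \<in> points_of Q" unfolding Q_eq by (auto simp: s_def)
    qed
  qed (rule convex_points_of)
  moreover have "points_of Q \<subseteq> points_of ?P"
  proof
    fix x assume "x \<in> points_of Q"
    then obtain s where s: "x = zp s" "\<And>e. e \<in> ?E \<Longrightarrow> 0 \<le> s e \<and> s e \<le> 1" by (auto simp: Q_eq)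
    show "x \<in> points_of ?P"
    proof (rule ccontr)
      assume "x \<notin> points_of ?P"
      then obtain a b where ab: "a \<bullet> x < b" "\<And>y. y \<in> points_of ?P \<Longrightarrow> a \<bullet> y > b"
        using separating_hyperplane_closed_point[OF convex_points_of compact_imp_closed[OF compact_points_of]]
        by blast
      obtain \<pi> where \<pi>: "bij_betw \<pi> UNIV {1..CARD('n)}" "\<And>i j. \<pi> i < \<pi> j \<Longrightarrow> a $ j \<le> a $ i"
        using exists_decreasing_ranking[of "($) a"] by blast
      have "a \<bullet> v \<pi> = (\<Sum>e\<in>?E. a $ pick \<pi> e) + a \<bullet> one"
        using v_eq \<pi>(1) by (simp add: inner_add_right inner_sum_right inner_axis)
      also have "(\<Sum>e\<in>?E. a $ pick \<pi> e) \<le> (\<Sum>e\<in>?E. a $ Min e + s e * (a $ Max e - a $ Min e))"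
      proof (rule sum_mono)
        fix e assume e: "e \<in> ?E"
        show "a $ pick \<pi> e \<le> a $ Min e + s e * (a $ Max e - a $ Min e)"
        proof (cases "\<pi> (Min e) < \<pi> (Max e)")
          case True
          have "(1 - s e) * (a $ Max e - a $ Min e) \<le> 0"
            using s(2)[OF e] \<pi>(2)[OF True] by (intro mult_nonneg_nonpos) auto
          then show ?thesis using True by (simp add: pick_def algebra_simps)
        next
          case False
          have "\<pi> (Max e) < \<pi> (Min e)"
          proof -
            have "Min e \<noteq> Max e"
              using e by (auto simp: edges_of_def elim!: edges_of_card_2_cases)
            then show ?thesis using False \<pi>(1) by (metis bij_betw_def inj_eq linorder_neqE_nat)
          qed
          then have "0 \<le> s e * (a $ Max e - a $ Min e)"
            using s(2)[OF e] \<pi>(2) by (intro mult_nonneg_nonneg) auto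
          then show ?thesis using False by (simp add: pick_def)
        qed
      qed
      also have "\<dots> + a \<bullet> one = a \<bullet> x"
        by (simp add: s(1) zp_def inner_add_right inner_sum_right inner_axis edge_vec_def
            inner_diff_right)
      finally have "a \<bullet> v \<pi> \<le> a \<bullet> x" by simp
      moreover have "v \<pi> \<in> points_of ?P" unfolding P_eq using \<pi>(1) by (intro hull_inc) blast
      ultimately show False using ab by force
    qed
  qed
  ultimately show ?thesis
    unfolding Q_def[symmetric] points_of_inject_iff by blast
qed

lemma lattice_count_permutohedron:
  "real (lattice_count (permutohedron :: (real ^ 'n::{finite,linorder}) convex_polytope)) =
    lattice_poly (\<lambda>_ (_::'n). 1) (\<lambda>_. 0)"
  unfolding permutohedron_eq_zonotope
  by (simp add: lattice_count_add_point lattice_count_zonotope)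

section \<open>Forests with prescribed roots\<close>

definition conn :: "'v set set \<Rightarrow> ('v \<times> 'v) set" where
  "conn E = {(u, w). {u, w} \<in> E}\<^sup>*"

lemma conn_refl [simp, intro]: "(u, u) \<in> conn E"
  by (simp add: conn_def)

lemma conn_sym: "(u, w) \<in> conn E \<Longrightarrow> (w, u) \<in> conn E"
  using sym_rtrancl[of "{(u, w). {u, w} \<in> E}"]
  by (auto simp: conn_def sym_def insert_commute)

lemma conn_trans [trans]: "(u, v) \<in> conn E \<Longrightarrow> (v, w) \<in> conn E \<Longrightarrow> (u, w) \<in> conn E"
  by (auto simp: conn_def)

lemma conn_edge: "{u, w} \<in> E \<Longrightarrow> (u, w) \<in> conn E"
  by (auto simp: conn_def)

lemma conn_step: "(u, v) \<in> conn E \<Longrightarrow> {v, w} \<in> E \<Longrightarrow> (u, w) \<in> conn E"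
  using conn_trans conn_edge by metis

lemma conn_mono: "(u, w) \<in> conn E \<Longrightarrow> E \<subseteq> E' \<Longrightarrow> (u, w) \<in> conn E'"
  unfolding conn_def by (rule subsetD[OF rtrancl_mono]) auto

lemma conn_closed_induct [consumes 1, case_names base step]:
  assumes "(u, w) \<in> conn E" "P u"
    and "\<And>x y. P x \<Longrightarrow> {x, y} \<in> E \<Longrightarrow> P y"
  shows "P w"
  using assms(1) unfolding conn_def
  by (induction rule: rtrancl_induct) (use assms in auto)

lemma conn_path:
  assumes "(u, w) \<in> conn E"
  shows "\<exists>p. p \<noteq> [] \<and> hd p = u \<and> last p = w \<and> distinct p \<and> (\<forall>i. Suc i < length p \<longrightarrow> {p ! i, p ! Suc i} \<in> E)"
  using assms unfolding conn_def
proof (induction rule: converse_rtrancl_induct)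
  case base
  show ?case by (intro exI[of _ "[w]"]) simp
next
  case (step x y)
  then obtain p where p: "p \<noteq> []" "hd p = y" "last p = w" "distinct p"
    "\<And>i. Suc i < length p \<Longrightarrow> {p ! i, p ! Suc i} \<in> E" by blast
  show ?case
  proof (cases "x \<in> set p")
    case True
    then obtain i where i: "i < length p" "p ! i = x" by (auto simp: in_set_conv_nth)
    then show ?thesis
      using p by (intro exI[of _ "drop i p"]) (auto simp: hd_drop_conv_nth)
  next
    case False
    have "{(x # p) ! i, (x # p) ! Suc i} \<in> E" if "Suc i < length (x # p)" for i
    proof (cases i)
      case 0
      then show ?thesis using step.hyps(1) p by (simp add: hd_conv_nth)
    next
      case (Suc j)
      then show ?thesis using that p(5)[of j] by simp
    qed
    then show ?thesis using p False by (intro exI[of _ "x # p"]) auto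
  qed
qed

text \<open>A cycle consists of any of its edges and a simple path between the ends that avoids the edge.\<close>

lemma is_forest_iff_bridges:
  "is_forest V E \<longleftrightarrow> is_graph V E \<and> (\<forall>u w. {u, w} \<in> E \<longrightarrow> (u, w) \<notin> conn (E - {{u, w}}))"
proof (intro iffI conjI allI impI notI)
  assume "is_forest V E"
  then show "is_graph V E" by (simp add: is_forest_def)
next
  fix u w assume forest: "is_forest V E" and uw: "{u, w} \<in> E" and con: "(u, w) \<in> conn (E - {{u, w}})"
  then have "u \<noteq> w" by (auto simp: is_forest_def is_graph_def)
  from conn_path[OF con] obtain p where p: "p \<noteq> []" "hd p = u" "last p = w" "distinct p"
    "\<And>i. Suc i < length p \<Longrightarrow> {p ! i, p ! Suc i} \<in> E - {{u, w}}" by blast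
  have "length p \<noteq> 1" using p(2,3) \<open>u \<noteq> w\<close> by (auto simp: length_Suc_conv)
  moreover have "length p \<noteq> 2"
  proof
    assume "length p = 2"
    then obtain a b where "p = [a, b]" by (auto simp: length_Suc_conv eval_nat_numeral)
    then show False using p(2,3) p(5)[of 0] by auto
  qed
  ultimately have len: "length p \<ge> 3" using p(1) by (cases "length p") auto
  have "{p ! i, p ! (Suc i mod length p)} \<in> E" if "i < length p" for i
  proof (cases "Suc i < length p")
    case True
    then show ?thesis using p(5)[of i] by simp
  next
    case False
    then have i: "Suc i = length p" using that by simp
    then have "p ! i = w" "p ! 0 = u" using p(1-3) by (auto simp: last_conv_nth hd_conv_nth i[symmetric])
    then show ?thesis using uw by (simp add: i insert_commute)
  qed
  then have "is_cycle E p" using len p(4) by (simp add: is_cycle_def)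
  then show False using forest by (auto simp: is_forest_def)
next
  assume a: "is_graph V E \<and> (\<forall>u w. {u, w} \<in> E \<longrightarrow> (u, w) \<notin> conn (E - {{u, w}}))"
  show "is_forest V E"
    unfolding is_forest_def
  proof (intro conjI notI)
    show "is_graph V E" using a by simp
    assume "\<exists>c. is_cycle E c"
    then obtain c where c: "length c \<ge> 3" "distinct c"
      "\<And>i. i < length c \<Longrightarrow> {c ! i, c ! (Suc i mod length c)} \<in> E" by (auto simp: is_cycle_def)
    let ?e = "{c ! 0, c ! 1}"
    have e: "?e \<in> E" using c(3)[of 0] c(1) by (cases "c = []") auto
    have avoid: "c ! i \<noteq> c ! 0" "i \<noteq> 1 \<Longrightarrow> c ! i \<noteq> c ! 1" if "1 \<le> i" "i < length c" for i
    proof -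
      have "0 < length c" "1 < length c" using c(1) by linarith+
      then show "c ! i \<noteq> c ! 0" "i \<noteq> 1 \<Longrightarrow> c ! i \<noteq> c ! 1"
        using that nth_eq_iff_index_eq[OF c(2)] by (metis not_one_le_zero, metis)
    qed
    have "(c ! 1, c ! Suc i) \<in> conn (E - {?e})" if "Suc i < length c" for i
      using that
    proof (induction i)
      case (Suc i)
      have "{c ! Suc i, c ! Suc (Suc i)} \<in> E" using c(3)[of "Suc i"] Suc.prems by simp
      moreover have "c ! 0 \<notin> {c ! Suc i, c ! Suc (Suc i)}"
        using avoid(1)[of "Suc i"] avoid(1)[of "Suc (Suc i)"] Suc.prems by auto
      ultimately have "{c ! Suc i, c ! Suc (Suc i)} \<in> E - {?e}" by auto
      then show ?case using Suc by (auto intro: conn_step)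
    qed simp
    from this[of "length c - 2"] have "(c ! 1, c ! (length c - 1)) \<in> conn (E - {?e})"
      using c(1) by (simp add: Suc_diff_Suc numeral_2_eq_2)
    moreover have "{c ! (length c - 1), c ! 0} \<in> E - {?e}"
    proof -
      have "length c - 1 < length c" "Suc (length c - 1) = length c" using c(1) by linarith+
      then have "{c ! (length c - 1), c ! 0} \<in> E"
        using c(3)[of "length c - 1"] by (simp only: mod_self)
      moreover have "c ! 1 \<notin> {c ! (length c - 1), c ! 0}"
      proof -
        have "1 \<le> length c - 1" "length c - 1 < length c" "length c - 1 \<noteq> 1" "1 < length c"
          using c(1) by linarith+
        then have "c ! (length c - 1) \<noteq> c ! 1" "c ! 1 \<noteq> c ! 0" using avoid by blast+
        then show ?thesis by force
      qed
      ultimately show ?thesis by auto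
    qed
    ultimately have "(c ! 1, c ! 0) \<in> conn (E - {?e})" by (rule conn_step)
    then show False using a e conn_sym by metis
  qed
qed

lemma conn_in_vertices:
  assumes "is_graph W E" "(u, w) \<in> conn E" "u \<in> W"
  shows "w \<in> W"
  using assms(2,3) by (induction rule: conn_closed_induct) (use assms(1) in \<open>auto simp: is_graph_def\<close>)

lemma is_forest_graph: "is_forest W F \<Longrightarrow> is_graph W F"
  by (simp add: is_forest_def)

lemma is_forest_bridge: "is_forest W F \<Longrightarrow> {u, w} \<in> F \<Longrightarrow> (u, w) \<notin> conn (F - {{u, w}})"
  by (simp add: is_forest_iff_bridges)

definition rooted_forests :: "'v set \<Rightarrow> 'v set \<Rightarrow> 'v set set set" where
  "rooted_forests W R = {F. is_forest W F \<and> R \<subseteq> W \<and> (\<forall>w\<in>W. \<exists>!r. r \<in> R \<and> (r, w) \<in> conn F)}"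

text \<open>Inverse to the deletion of a set of roots: \<open>F\<close> is the forest that remains, rooted at the set \<open>U\<close> of the
  former neighbours of the deleted roots, and \<open>f u\<close> is the deleted root next to \<open>u\<close>.\<close>

definition attach :: "'v set \<times> 'v set set \<times> ('v \<Rightarrow> 'v) \<Rightarrow> 'v set set" where
  "attach = (\<lambda>(U, F, f). F \<union> (\<lambda>u. {u, f u}) ` U)"

lemma rooted_forestsD:
  assumes "F \<in> rooted_forests W R"
  shows "is_forest W F" "R \<subseteq> W" "\<And>w. w \<in> W \<Longrightarrow> \<exists>r\<in>R. (r, w) \<in> conn F"
    "\<And>r r'. r \<in> R \<Longrightarrow> r' \<in> R \<Longrightarrow> (r, r') \<in> conn F \<Longrightarrow> r = r'"
proof -
  show f: "is_forest W F" "R \<subseteq> W" and "\<And>w. w \<in> W \<Longrightarrow> \<exists>r\<in>R. (r, w) \<in> conn F"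
    using assms by (auto simp: rooted_forests_def)
  show "r = r'" if "r \<in> R" "r' \<in> R" "(r, r') \<in> conn F" for r r'
    using assms that f(2) conn_refl[of r' F] unfolding rooted_forests_def by blast
qed

lemma rooted_forestsI:
  assumes "is_forest W F" "R \<subseteq> W" "\<And>w. w \<in> W \<Longrightarrow> \<exists>r\<in>R. (r, w) \<in> conn F"
    "\<And>r r'. r \<in> R \<Longrightarrow> r' \<in> R \<Longrightarrow> (r, r') \<in> conn F \<Longrightarrow> r = r'"
  shows "F \<in> rooted_forests W R"
  unfolding rooted_forests_def
proof (intro CollectI conjI ballI assms(1,2))
  fix w assume "w \<in> W"
  then obtain r where r: "r \<in> R" "(r, w) \<in> conn F" using assms(3) by blast
  show "\<exists>!r. r \<in> R \<and> (r, w) \<in> conn F"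
  proof (rule ex1I)
    show "r \<in> R \<and> (r, w) \<in> conn F" using r by simp
    fix r' assume r': "r' \<in> R \<and> (r', w) \<in> conn F"
    then have "(r', r) \<in> conn F" using conn_trans conn_sym[OF r(2)] by metis
    then show "r' = r" using assms(4) r r' by simp
  qed
qed

text \<open>To see that an edge is a bridge, one takes the set \<open>D\<close> of the vertices on the side of that edge
  that is turned away from the deleted roots. No other edge leaves \<open>D\<close>: every tree of \<open>F\<close> has a single
  element of \<open>U\<close>, hence a single connection to the deleted roots.\<close>

lemma attach_in_rooted_forests:
  assumes R: "R \<subseteq> W" and F: "F \<in> rooted_forests (W - R) U" and f: "f \<in> U \<rightarrow> R"
  shows "attach (U, F, f) \<in> rooted_forests W R"
proof -
  note FD = rooted_forestsD[OF F]
  let ?G = "attach (U, F, f)"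
  have G: "?G = F \<union> (\<lambda>u. {u, f u}) ` U" by (simp add: attach_def)
  have UW: "U \<subseteq> W - R" by (rule FD(2))
  have graphF: "is_graph (W - R) F" by (rule is_forest_graph[OF FD(1)])
  have FW: "e \<subseteq> W - R" if "e \<in> F" for e using graphF that by (auto simp: is_graph_def)
  have graphG: "is_graph W ?G"
    unfolding is_graph_def
  proof
    fix e assume "e \<in> ?G"
    then consider "e \<in> F" | u where "u \<in> U" "e = {u, f u}" unfolding G by auto
    then show "e \<subseteq> W \<and> card e = 2"
    proof cases
      case 1
      then show ?thesis using graphF by (auto simp: is_graph_def)
    next
      case 2
      have "f u \<in> R" using f 2 by auto
      then have "u \<noteq> f u" using UW 2 by auto
      then show ?thesis using 2 UW R \<open>f u \<in> R\<close> by auto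
    qed
  qed
  have closed: "y \<in> D" if H: "H \<subseteq> ?G" and con: "(x, y) \<in> conn H" and x: "x \<in> D" and D: "D \<inter> R = {}"
    and cl: "\<And>a b. a \<in> D \<Longrightarrow> {a, b} \<in> F \<Longrightarrow> {a, b} \<in> H \<Longrightarrow> b \<in> D"
    and st: "\<And>v. v \<in> U \<Longrightarrow> v \<in> D \<Longrightarrow> {v, f v} \<notin> H" for x y D H
    using con x
  proof (induction rule: conn_closed_induct)
    case (step a b)
    then consider "{a, b} \<in> F" | v where "v \<in> U" "{a, b} = {v, f v}" using H unfolding G by auto
    then show ?case
    proof cases
      case 1
      then show ?thesis using cl step by blast
    next
      case 2
      have "f v \<notin> D" using f 2(1) D by auto
      then have "a \<noteq> f v" using step by blast
      then have "a = v" "b = f v" using 2(2) by (auto simp: doubleton_eq_iff)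
      then show ?thesis using st[OF 2(1)] step \<open>a = v\<close> by blast
    qed
  qed
  have forest: "is_forest W ?G"
    unfolding is_forest_iff_bridges
  proof (intro conjI graphG allI impI)
    fix x y assume xy: "{x, y} \<in> ?G"
    have bridgeF: "(x, y) \<notin> conn (?G - {{x, y}})"
      if xyF: "{x, y} \<in> F" and u: "u \<in> U" "(u, x) \<in> conn F" "(u, x) \<notin> conn (F - {{x, y}})" for x y u
    proof
      assume con: "(x, y) \<in> conn (?G - {{x, y}})"
      define D where "D = {z. (x, z) \<in> conn (F - {{x, y}})}"
      have xW: "x \<in> W - R" using FW[OF xyF] by auto
      have "y \<in> D"
      proof (rule closed[OF _ con])
        show "x \<in> D" by (simp add: D_def)
        have "is_graph (W - R) (F - {{x, y}})" using graphF by (simp add: is_graph_def)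
        then show "D \<inter> R = {}" using conn_in_vertices[OF _ _ xW] by (auto simp: D_def)
        show "b \<in> D" if "a \<in> D" "{a, b} \<in> F" "{a, b} \<in> ?G - {{x, y}}" for a b
          using that by (auto simp: D_def intro: conn_step)
        show "{v, f v} \<notin> ?G - {{x, y}}" if v: "v \<in> U" "v \<in> D" for v
        proof -
          have xv: "(x, v) \<in> conn (F - {{x, y}})" using v by (simp add: D_def)
          then have "(x, v) \<in> conn F" by (rule conn_mono) auto
          then have "u = v" using FD(4)[OF u(1) v(1)] conn_trans[OF u(2)] by blast
          then show ?thesis using u(3) conn_sym[OF xv] by simp
        qed
      qed auto
      then show False using is_forest_bridge[OF FD(1) xyF] by (simp add: D_def)
    qed
    from xy consider "{x, y} \<in> F" | u where "u \<in> U" "{x, y} = {u, f u}" unfolding G by auto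
    then show "(x, y) \<notin> conn (?G - {{x, y}})"
    proof cases
      case 1
      have "x \<in> W - R" using FW[OF 1] by auto
      then obtain u where u: "u \<in> U" "(u, x) \<in> conn F" using FD(3) by blast
      show ?thesis
      proof (cases "(u, x) \<in> conn (F - {{x, y}})")
        case False
        then show ?thesis using bridgeF[OF 1 u] by simp
      next
        case True
        have "(u, y) \<notin> conn (F - {{x, y}})"
          using True is_forest_bridge[OF FD(1) 1] conn_sym conn_trans by metis
        moreover have "(u, y) \<in> conn F" using u(2) 1 by (rule conn_step)
        moreover have "{y, x} = {x, y}" by auto
        ultimately have "(y, x) \<notin> conn (?G - {{x, y}})" using bridgeF[of y x u] 1 u(1) by simp
        then show ?thesis using conn_sym by metis
      qed
    next
      case 2
      have fu: "f u \<in> R" using f 2 by auto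
      have "(u, f u) \<notin> conn (?G - {{u, f u}})"
      proof
        assume con: "(u, f u) \<in> conn (?G - {{u, f u}})"
        define D where "D = {z. (u, z) \<in> conn F}"
        have uW: "u \<in> W - R" using UW 2 by auto
        have DR: "D \<inter> R = {}" using conn_in_vertices[OF graphF _ uW] by (auto simp: D_def)
        have "f u \<in> D"
        proof (rule closed[OF _ con _ DR])
          show "u \<in> D" by (simp add: D_def)
          show "b \<in> D" if "a \<in> D" "{a, b} \<in> F" "{a, b} \<in> ?G - {{u, f u}}" for a b
            using that by (auto simp: D_def intro: conn_step)
          show "{v, f v} \<notin> ?G - {{u, f u}}" if "v \<in> U" "v \<in> D" for v
            using FD(4)[OF 2(1) that(1)] that(2) by (auto simp: D_def)
        qed auto
        then show False using DR fu by auto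
      qed
      moreover have "(x = u \<and> y = f u) \<or> (x = f u \<and> y = u)" using 2(2) by (auto simp: doubleton_eq_iff)
      ultimately show ?thesis unfolding 2(2) using conn_sym[of x y "?G - {{u, f u}}"] by blast
    qed
  qed
  show ?thesis
  proof (rule rooted_forestsI[OF forest R])
    fix w assume w: "w \<in> W"
    show "\<exists>r\<in>R. (r, w) \<in> conn ?G"
    proof (cases "w \<in> R")
      case False
      then obtain u where u: "u \<in> U" "(u, w) \<in> conn F" using FD(3) w by blast
      have "{f u, u} \<in> ?G" unfolding G using u by (auto simp: insert_commute)
      then have "(f u, w) \<in> conn ?G"
        using conn_trans[OF conn_edge conn_mono[OF u(2)]] G by blast
      then show ?thesis using f u(1) by blast
    qed auto
  next
    fix r r' assume r: "r \<in> R" "r' \<in> R" and con: "(r, r') \<in> conn ?G"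
    \<comment> \<open>\<open>r\<close> and the trees of \<open>F\<close> that are attached to it\<close>
    define D where "D = insert r {z. \<exists>u\<in>U. f u = r \<and> (u, z) \<in> conn F}"
    from con have "r' \<in> D"
    proof (induction rule: conn_closed_induct)
      case base
      show ?case by (simp add: D_def)
    next
      case (step x y)
      from step(2) consider "{x, y} \<in> F" | u where "u \<in> U" "{x, y} = {u, f u}" unfolding G by auto
      then show ?case
      proof cases
        case 1
        then have "x \<noteq> r" using FW r(1) by blast
        then show ?thesis using step(1) 1 by (auto simp: D_def intro: conn_step)
      next
        case 2
        have fu: "f u \<in> R" using f 2 by auto
        then have "f u \<noteq> u" using UW 2 by auto
        show ?thesis
        proof (cases "x = u")
          case True
          then have y: "y = f u" using 2 by (auto simp: doubleton_eq_iff)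
          have "x \<noteq> r" using True 2(1) UW r(1) by auto
          then obtain u' where u': "u' \<in> U" "f u' = r" "(u', x) \<in> conn F"
            using step(1) by (auto simp: D_def)
          then have "u' = u" using FD(4) 2(1) True by blast
          then show ?thesis using y u' by (simp add: D_def)
        next
          case False
          then have xy: "x = f u" "y = u" using 2 by (auto simp: doubleton_eq_iff)
          have "x \<notin> W - R" using xy fu by auto
          then have "x = r"
            using step(1) conn_in_vertices[OF graphF] UW by (auto simp: D_def)
          then show ?thesis using xy 2(1) by (auto simp: D_def)
        qed
      qed
    qed
    moreover have "r' \<notin> W - R" using r by auto
    ultimately show "r = r'" using conn_in_vertices[OF graphF] UW by (auto simp: D_def)
  qed
qed

text \<open>No edge joins two roots and no other vertex has two roots as neighbours, since roots lie in
  different trees. So the neighbours of the roots have well-defined parents, and they lie in different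
  trees after the deletion of the roots: otherwise there would be a cycle through a root or a path between
  two roots.\<close>

lemma detach_rooted_forest:
  assumes G: "G \<in> rooted_forests W R"
  obtains U F f where "F \<in> rooted_forests (W - R) U" "f \<in> U \<rightarrow>\<^sub>E R" "G = attach (U, F, f)"
proof -
  note GD = rooted_forestsD[OF G]
  have graph: "is_graph W G" by (rule is_forest_graph[OF GD(1)])
  define F where "F = {e \<in> G. e \<subseteq> W - R}"
  define U where "U = {u \<in> W - R. \<exists>r\<in>R. {u, r} \<in> G}"
  define f where "f = (\<lambda>u\<in>U. SOME r. r \<in> R \<and> {u, r} \<in> G)"
  have f: "f u \<in> R" "{u, f u} \<in> G" if "u \<in> U" for u
  proof -
    have "\<exists>r. r \<in> R \<and> {u, r} \<in> G" using that by (auto simp: U_def)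
    from someI_ex[OF this] show "f u \<in> R" "{u, f u} \<in> G" using that by (simp_all add: f_def)
  qed
  have f_unique: "r = f u" if "u \<in> U" "r \<in> R" "{u, r} \<in> G" for u r
  proof -
    have "(r, u) \<in> conn G" using that by (auto intro: conn_sym conn_edge)
    then have "(r, f u) \<in> conn G" using f(2)[OF that(1)] by (rule conn_step)
    then show ?thesis using GD(4) f(1)[OF that(1)] that(2) by blast
  qed
  have FG: "F \<subseteq> G" by (auto simp: F_def)
  have "G = attach (U, F, f)"
    unfolding attach_def prod.case
  proof (intro equalityI subsetI)
    fix e assume e: "e \<in> G"
    then have "card e = 2" "e \<subseteq> W" using graph by (auto simp: is_graph_def)
    then obtain x y where xy: "e = {x, y}" "x \<noteq> y" "x \<in> W" "y \<in> W" by (auto simp: card_2_iff)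
    have nRR: "\<not> (x \<in> R \<and> y \<in> R)" using GD(4) conn_edge e xy by metis
    consider "x \<notin> R" "y \<notin> R" | "x \<notin> R" "y \<in> R" | "x \<in> R" "y \<notin> R" using nRR by blast
    then show "e \<in> F \<union> (\<lambda>u. {u, f u}) ` U"
    proof cases
      case 1
      then show ?thesis using e xy by (auto simp: F_def)
    next
      case 2
      then have "x \<in> U" using xy e by (auto simp: U_def)
      then show ?thesis using f_unique[of x y] 2 e xy(1) by blast
    next
      case 3
      have e': "{y, x} \<in> G" using e xy by (simp add: insert_commute)
      have "y \<in> U" using xy e' 3 by (auto simp: U_def)
      then have "e = {y, f y}" using f_unique[of y x] 3 e' xy(1) by (simp add: insert_commute)
      then show ?thesis using \<open>y \<in> U\<close> by blast
    qed
  next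
    fix e assume "e \<in> F \<union> (\<lambda>u. {u, f u}) ` U"
    then show "e \<in> G" using FG f by auto
  qed
  moreover have "f \<in> U \<rightarrow>\<^sub>E R" using f(1) by (auto simp: f_def)
  moreover have "F \<in> rooted_forests (W - R) U"
  proof (rule rooted_forestsI)
    have "is_graph (W - R) F" using graph by (auto simp: is_graph_def F_def)
    moreover have "(u, w) \<notin> conn (F - {{u, w}})" if "{u, w} \<in> F" for u w
      using is_forest_bridge[OF GD(1), of u w] conn_mono[of u w "F - {{u, w}}" "G - {{u, w}}"] FG that
      by blast
    ultimately show "is_forest (W - R) F" by (simp add: is_forest_iff_bridges)
    show "U \<subseteq> W - R" by (auto simp: U_def)
  next
    fix w assume w: "w \<in> W - R"
    then obtain r where r: "r \<in> R" "(r, w) \<in> conn G" using GD(3) by blast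
    from r(2) have "w \<in> W \<and> (w \<in> R \<or> (\<exists>u\<in>U. (u, w) \<in> conn F))"
    proof (induction rule: conn_closed_induct)
      case base
      then show ?case using r GD(2) by auto
    next
      case (step x y)
      have yW: "y \<in> W" using step graph by (auto simp: is_graph_def)
      show ?case
      proof (cases "y \<in> R")
        case False
        show ?thesis
        proof (cases "x \<in> R")
          case True
          then have "y \<in> U" using yW False step(2) by (auto simp: U_def insert_commute)
          then show ?thesis using yW by blast
        next
          case xR: False
          then have "{x, y} \<in> F" using step yW False by (auto simp: F_def)
          then show ?thesis using step(1) xR yW by (auto intro: conn_step)
        qed
      qed (use yW in auto)
    qed
    then show "\<exists>u\<in>U. (u, w) \<in> conn F" using w by auto
  next
    fix u v assume uv: "u \<in> U" "v \<in> U" "(u, v) \<in> conn F"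
    show "u = v"
    proof (rule ccontr)
      assume "u \<noteq> v"
      have "(u, v) \<in> conn G" using uv(3) FG by (rule conn_mono)
      then have "(u, f v) \<in> conn G" using f(2)[OF uv(2)] by (rule conn_step)
      moreover have "(f u, u) \<in> conn G" using f(2)[OF uv(1)] by (auto intro: conn_sym conn_edge)
      ultimately have "(f u, f v) \<in> conn G" using conn_trans by metis
      then have fuv: "f u = f v" using GD(4) f(1) uv by blast
      have "{u, f u} \<notin> F" using f(1)[OF uv(1)] by (auto simp: F_def)
      then have "F \<subseteq> G - {{u, f u}}" using FG by auto
      then have "(u, v) \<in> conn (G - {{u, f u}})" using conn_mono[OF uv(3)] by blast
      moreover have "{v, f v} \<noteq> {u, f u}" using \<open>u \<noteq> v\<close> fuv by (auto simp: doubleton_eq_iff)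
      then have "{v, f u} \<in> G - {{u, f u}}" using f(2)[OF uv(2)] fuv by auto
      ultimately have "(u, f u) \<in> conn (G - {{u, f u}})" by (rule conn_step)
      then show False using is_forest_bridge[OF GD(1) f(2)[OF uv(1)]] by simp
    qed
  qed
  ultimately show ?thesis using that by blast
qed

lemma finite_rooted_forests: "finite W \<Longrightarrow> finite (rooted_forests W R)"
  by (rule finite_subset[of _ "Pow (Pow W)"]) (auto simp: rooted_forests_def is_forest_def is_graph_def)

lemma card_rooted_forests_step:
  assumes W: "finite W" and R: "R \<subseteq> W"
  shows "card (rooted_forests W R) =
    (\<Sum>U\<in>Pow (W - R). card R ^ card U * card (rooted_forests (W - R) U))"
proof -
  let ?S = "SIGMA U:Pow (W - R). rooted_forests (W - R) U \<times> (U \<rightarrow>\<^sub>E R)"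
  have finR: "finite R" using W R finite_subset by auto
  have recover: "F = {e \<in> attach (U, F, f). e \<subseteq> W - R}"
    "U = {u \<in> W - R. \<exists>r\<in>R. {u, r} \<in> attach (U, F, f)}"
    "u \<in> U \<Longrightarrow> r \<in> R \<Longrightarrow> {u, r} \<in> attach (U, F, f) \<Longrightarrow> r = f u"
    "u \<in> U \<Longrightarrow> f u \<in> R \<and> {u, f u} \<in> attach (U, F, f)"
    if F: "F \<in> rooted_forests (W - R) U" and f: "f \<in> U \<rightarrow>\<^sub>E R" for U F f u r
  proof -
    have U: "U \<subseteq> W - R" by (rule rooted_forestsD(2)[OF F])
    have FW: "e \<subseteq> W - R" if "e \<in> F" for e
      using is_forest_graph[OF rooted_forestsD(1)[OF F]] that by (auto simp: is_graph_def)
    have fR: "f v \<in> R" if "v \<in> U" for v using f that by auto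
    show "F = {e \<in> attach (U, F, f). e \<subseteq> W - R}"
      using FW fR by (auto simp: attach_def)
    have star: "u \<in> U \<and> r = f u" if ur: "{u, r} \<in> attach (U, F, f)" "u \<in> W - R" "r \<in> R" for u r
    proof -
      have "{u, r} \<notin> F" using FW ur(3) by blast
      then obtain v where "v \<in> U" "{u, r} = {v, f v}" using ur(1) by (auto simp: attach_def)
      then show ?thesis using fR ur U by (auto simp: doubleton_eq_iff)
    qed
    show "U = {u \<in> W - R. \<exists>r\<in>R. {u, r} \<in> attach (U, F, f)}"
    proof (intro equalityI subsetI)
      fix v assume "v \<in> U"
      then show "v \<in> {u \<in> W - R. \<exists>r\<in>R. {u, r} \<in> attach (U, F, f)}"
        using U fR by (auto simp: attach_def)
    qed (use star in blast)
    show "r = f u" if "u \<in> U" "r \<in> R" "{u, r} \<in> attach (U, F, f)"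
      using star that U by blast
    show "f u \<in> R \<and> {u, f u} \<in> attach (U, F, f)" if "u \<in> U"
      using fR that by (auto simp: attach_def)
  qed
  have "bij_betw attach ?S (rooted_forests W R)"
    unfolding bij_betw_def
  proof (intro conjI equalityI subsetI)
    show "inj_on attach ?S"
    proof (rule inj_onI)
      fix p p' assume p: "p \<in> ?S" and p': "p' \<in> ?S" and pp': "attach p = attach p'"
      from p obtain U F f where Uf: "p = (U, F, f)" and
        a: "F \<in> rooted_forests (W - R) U" "f \<in> U \<rightarrow>\<^sub>E R" by auto
      from p' obtain U' F' f' where Uf': "p' = (U', F', f')" and
        a': "F' \<in> rooted_forests (W - R) U'" "f' \<in> U' \<rightarrow>\<^sub>E R" by auto
      have eq: "attach (U, F, f) = attach (U', F', f')" using pp' Uf Uf' by simp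
      have "U = U'" using recover(2)[OF a] recover(2)[OF a'] eq by simp
      moreover have "F = F'" using recover(1)[OF a] recover(1)[OF a'] eq by simp
      moreover have "f = f'"
      proof (rule extensionalityI[of _ U])
        show "f \<in> extensional U" "f' \<in> extensional U" using a a' \<open>U = U'\<close> by (auto simp: PiE_def)
        show "f u = f' u" if "u \<in> U" for u
          using recover(4)[OF a that] recover(3)[OF a', of u "f u"] that \<open>U = U'\<close> eq by simp
      qed
      ultimately show "p = p'" by (simp add: Uf Uf')
    qed
  next
    fix G assume "G \<in> attach ` ?S"
    then show "G \<in> rooted_forests W R"
      using attach_in_rooted_forests[OF R] by (force simp: PiE_def)
  next
    fix G assume "G \<in> rooted_forests W R"
    then obtain U F f where "F \<in> rooted_forests (W - R) U" "f \<in> U \<rightarrow>\<^sub>E R" "G = attach (U, F, f)"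
      by (rule detach_rooted_forest)
    moreover have "U \<subseteq> W - R" by (rule rooted_forestsD(2)) fact
    ultimately show "G \<in> attach ` ?S" by blast
  qed
  then have "card (rooted_forests W R) = card ?S" by (rule bij_betw_same_card[symmetric])
  also have "\<dots> = (\<Sum>U\<in>Pow (W - R). card (rooted_forests (W - R) U \<times> (U \<rightarrow>\<^sub>E R)))"
    using W finR by (intro card_SigmaI ballI finite_cartesian_product finite_rooted_forests finite_PiE)
      (auto intro: finite_subset)
  also have "\<dots> = (\<Sum>U\<in>Pow (W - R). card R ^ card U * card (rooted_forests (W - R) U))"
    using W by (intro sum.cong refl) (auto simp: card_cartesian_product card_PiE dest: finite_subset)
  finally show ?thesis .
qed

lemma sum_Pow_card:
  fixes f :: "nat \<Rightarrow> 'b::comm_semiring_1"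
  assumes "finite A"
  shows "(\<Sum>S\<in>Pow A. f (card S)) = (\<Sum>k\<le>card A. of_nat (card A choose k) * f k)"
proof -
  have "(\<Sum>S\<in>Pow A. f (card S)) = (\<Sum>k\<in>{..card A}. \<Sum>S\<in>{S \<in> Pow A. card S = k}. f (card S))"
    using assms by (intro sum.group[symmetric]) (auto intro: card_mono)
  also have "\<dots> = (\<Sum>k\<le>card A. of_nat (card A choose k) * f k)"
    using n_subsets[OF assms] by (intro sum.cong refl) (simp add: Pow_def)
  finally show ?thesis .
qed

text \<open>Absorption of the factor \<open>k\<close> turns \<open>k (m choose k)\<close> into \<open>m (m - 1 choose k - 1)\<close>.\<close>

lemma weighted_binomial:
  fixes x y :: "'a::comm_semiring_1"
  assumes "m > 0"
  shows "(\<Sum>k\<le>m. of_nat (m choose k) * (of_nat k * x ^ k * y ^ (m - k))) = of_nat m * x * (x + y) ^ (m - 1)"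
proof -
  obtain q where q: "m = Suc q" using assms by (cases m) auto
  have "(\<Sum>k\<le>m. of_nat (m choose k) * (of_nat k * x ^ k * y ^ (m - k))) =
      (\<Sum>k\<le>q. of_nat (Suc q choose Suc k) * (of_nat (Suc k) * x ^ Suc k * y ^ (q - k)))"
    unfolding q by (subst sum.atMost_Suc_shift) simp
  also have "\<dots> = (\<Sum>k\<le>q. of_nat m * x * (of_nat (q choose k) * x ^ k * y ^ (q - k)))"
  proof (intro sum.cong refl)
    fix k
    have "of_nat (Suc q choose Suc k) * (of_nat (Suc k) :: 'a) = of_nat m * of_nat (q choose k)"
      unfolding of_nat_mult[symmetric] q by (metis Suc_times_binomial mult.commute)
    then show "of_nat (Suc q choose Suc k) * (of_nat (Suc k) * x ^ Suc k * y ^ (q - k)) =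
        of_nat m * x * (of_nat (q choose k) * x ^ k * y ^ (q - k))"
      by (simp only: power_Suc mult.assoc[symmetric]) (simp only: mult_ac)
  qed
  also have "\<dots> = of_nat m * x * (x + y) ^ q"
    by (simp add: binomial_ring sum_distrib_left)
  finally show ?thesis by (simp add: q)
qed

text \<open>The number is \<open>r m ^ (m - r - 1)\<close> for \<open>m\<close> vertices and \<open>r\<close> roots. The factor \<open>card W\<close> on the left avoids the
  exponent \<open>- 1\<close> in the case \<open>R = W\<close>. Deleting the roots gives a recursion in which the numbers of
  new roots are weighted by binomial coefficients.\<close>

theorem card_rooted_forests:
  assumes "finite W" "R \<subseteq> W"
  shows "card W * card (rooted_forests W R) = card R * card W ^ (card W - card R)"
  using assms
proof (induction "card W" arbitrary: W R rule: less_induct)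
  case less
  note W = less.prems(1) and R = less.prems(2)
  have finR: "finite R" using finite_subset[OF R W] .
  show ?case
  proof (cases "R = {}")
    case True
    have "rooted_forests W {} = {}" if "W \<noteq> {}"
      using that by (auto simp: rooted_forests_def)
    then show ?thesis using True by (cases "W = {}") auto
  next
    case False
    define m where "m = card (W - R)"
    define r where "r = card R"
    have cardW: "card W = r + m" using card_Diff_subset[OF finR R] card_mono[OF W R] by (simp add: m_def r_def)
    have r: "r > 0" using False finR by (simp add: r_def card_gt_0_iff)
    show ?thesis
    proof (cases "m = 0")
      case True
      then have WR: "W - R = {}" using W unfolding m_def by (metis card_0_eq finite_Diff)
      have "rooted_forests {} {} = {{} :: 'a set set}"
        by (auto simp: rooted_forests_def is_forest_iff_bridges is_graph_def)
      then have "card (rooted_forests W R) = 1"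
        using card_rooted_forests_step[OF W R] unfolding WR by simp
      then show ?thesis using True cardW by (simp add: r_def)
    next
      case False
      have "m * card (rooted_forests W R) = (\<Sum>U\<in>Pow (W - R). r ^ card U * (m * card (rooted_forests (W - R) U)))"
        by (simp add: card_rooted_forests_step[OF W R] sum_distrib_left r_def mult_ac)
      also have "\<dots> = (\<Sum>U\<in>Pow (W - R). r ^ card U * (card U * m ^ (m - card U)))"
        using less.hyps[of "W - R"] W cardW r by (intro sum.cong refl) (simp add: m_def)
      also have "\<dots> = (\<Sum>k\<le>m. (m choose k) * (k * r ^ k * m ^ (m - k)))"
        using sum_Pow_card[of "W - R" "\<lambda>k. r ^ k * (k * m ^ (m - k))"] W by (simp add: m_def mult_ac)
      also have "\<dots> = m * r * (r + m) ^ (m - 1)"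
        using weighted_binomial[of m r m] False by simp
      finally have "card (rooted_forests W R) = r * (r + m) ^ (m - 1)" using False by simp
      moreover have "(r + m) * (r + m) ^ (m - 1) = (r + m) ^ m"
        using False by (cases m) auto
      ultimately show ?thesis
        unfolding cardW r_def[symmetric] by simp
    qed
  qed
qed

text \<open>Multiplied by \<open>N * card W\<close>, this is the weighted binomial sum at \<open>x = - N\<close> and \<open>y = card W\<close>.\<close>

lemma sum_signed_rooted_forests:
  assumes W: "finite W" "W \<noteq> {}" and N: "N > 0"
  shows "(\<Sum>M\<in>Pow W - {{}}. (- 1) ^ card M * real N ^ (card M - 1) * real (card (rooted_forests W M))) =
    - ((real (card W) - real N) ^ (card W - 1))"
proof -
  let ?m = "card W"
  let ?S = "\<Sum>M\<in>Pow W - {{}}. (- 1) ^ card M * real N ^ (card M - 1) * real (card (rooted_forests W M))"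
  have m: "?m > 0" using W by (simp add: card_gt_0_iff)
  have "real N * real ?m * ?S = (\<Sum>M\<in>Pow W - {{}}. real (card M) * (- real N) ^ card M * real ?m ^ (?m - card M))"
    unfolding sum_distrib_left
  proof (intro sum.cong refl)
    fix M assume M: "M \<in> Pow W - {{}}"
    then have "card M > 0" using W finite_subset by (auto simp: card_gt_0_iff)
    then have N': "real N * real N ^ (card M - 1) = real N ^ card M" by (cases "card M") auto
    have RF: "real ?m * real (card (rooted_forests W M)) = real (card M) * real ?m ^ (?m - card M)"
      using card_rooted_forests[of W M] W M by (metis DiffD1 PowD of_nat_mult of_nat_power)
    have "real N * real ?m * ((- 1) ^ card M * real N ^ (card M - 1) * real (card (rooted_forests W M))) =
        (- 1) ^ card M * (real N * real N ^ (card M - 1)) * (real ?m * real (card (rooted_forests W M)))"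
      by (simp only: mult_ac)
    also have "\<dots> = real (card M) * (- real N) ^ card M * real ?m ^ (?m - card M)"
      unfolding N' RF by (simp add: power_minus[of "real N"])
    finally show "real N * real ?m * ((- 1) ^ card M * real N ^ (card M - 1) * real (card (rooted_forests W M))) =
        real (card M) * (- real N) ^ card M * real ?m ^ (?m - card M)" .
  qed
  also have "\<dots> = (\<Sum>M\<in>Pow W. real (card M) * (- real N) ^ card M * real ?m ^ (?m - card M))"
    using W by (intro sum.mono_neutral_left) auto
  also have "\<dots> = (\<Sum>k\<le>?m. real (?m choose k) * (real k * (- real N) ^ k * real ?m ^ (?m - k)))"
    using sum_Pow_card[OF W(1), of "\<lambda>k. real k * (- real N) ^ k * real ?m ^ (?m - k)"] by simp
  also have "\<dots> = real ?m * - real N * (- real N + real ?m) ^ (?m - 1)"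
    by (rule weighted_binomial[OF m])
  also have "\<dots> = real N * real ?m * - ((real ?m - real N) ^ (?m - 1))"
    by simp
  finally have eq: "real N * real ?m * ?S = real N * real ?m * - ((real ?m - real N) ^ (?m - 1))" .
  have "real N * real ?m \<noteq> 0" using N m by simp
  from mult_left_cancel[OF this, THEN iffD1, OF eq] show ?thesis .
qed

section \<open>Solutions of linear congruences on a torus\<close>

lemma card_affine_torus_points:
  assumes "n > 0"
  shows "card {s \<in> {0..<1::real}. real n * s - c \<in> \<int>} = n"
proof -
  \<comment> \<open>the solutions are \<open>(c + j) / n\<close> modulo \<open>1\<close>\<close>
  define f where "f j = frac ((c + real j) / real n)" for j :: nat
  have "bij_betw f {0..<n} {s \<in> {0..<1}. real n * s - c \<in> \<int>}"
    unfolding bij_betw_def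
  proof (intro conjI equalityI subsetI)
    show "inj_on f {0..<n}"
    proof (rule inj_onI)
      fix i j assume ij: "i \<in> {0..<n}" "j \<in> {0..<n}" and eq: "f i = f j"
      then have "(c + real i) / real n - (c + real j) / real n =
          of_int (\<lfloor>(c + real i) / real n\<rfloor> - \<lfloor>(c + real j) / real n\<rfloor>)"
        by (simp add: f_def frac_def)
      moreover have "(c + real i) / real n - (c + real j) / real n = (real i - real j) / real n"
        using assms by (simp add: diff_divide_distrib add_divide_distrib)
      ultimately have "(real i - real j) / real n \<in> \<int>" by (metis Ints_of_int)
      moreover have "\<bar>(real i - real j) / real n\<bar> < 1" using ij assms by (auto simp: field_simps)
      ultimately have "(real i - real j) / real n = 0" using Ints_nonzero_abs_ge1 by force
      then show "i = j" using assms by simp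
    qed
  next
    fix s assume "s \<in> f ` {0..<n}"
    then obtain j where j: "s = f j" by auto
    have "real n * s - c = real j - real n * of_int \<lfloor>(c + real j) / real n\<rfloor>"
      using assms by (simp add: j f_def frac_def field_simps)
    also have "\<dots> \<in> \<int>" by auto
    finally show "s \<in> {s \<in> {0..<1}. real n * s - c \<in> \<int>}" by (simp add: j f_def frac_lt_1)
  next
    fix s assume s: "s \<in> {s \<in> {0..<1}. real n * s - c \<in> \<int>}"
    then obtain z where z: "real n * s - c = of_int z" by (auto elim: Ints_cases)
    define j where "j = nat (z mod int n)"
    have "z = int n * (z div int n) + int j" using assms by (simp add: j_def)
    then have "of_int z = real n * of_int (z div int n) + real j"
      by (metis of_int_add of_int_mult of_int_of_nat_eq)
    then have "(c + real j) / real n = s - of_int (z div int n)" using z assms by (simp add: field_simps)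
    then have "frac ((c + real j) / real n) = s"
      using s by (subst frac_unique_iff) auto
    moreover have "j < n" using assms by (simp add: j_def nat_less_iff)
    ultimately show "s \<in> f ` {0..<n}" by (auto simp: f_def)
  qed
  from bij_betw_same_card[OF this] show ?thesis by simp
qed

text \<open>By Bezout's identity, the integers \<open>k\<close> with \<open>k T \<in> \<int>\<close> form an ideal.\<close>

lemma mult_Gcd_in_Ints_iff:
  fixes D :: "nat set" and T :: real
  assumes "finite D"
  shows "(\<forall>d\<in>D. real d * T \<in> \<int>) \<longleftrightarrow> real (Gcd D) * T \<in> \<int>"
  using assms
proof (induction D rule: finite_induct)
  case (insert d D)
  have "real (gcd d g) * T \<in> \<int> \<longleftrightarrow> real d * T \<in> \<int> \<and> real g * T \<in> \<int>" for g
  proof (intro iffI conjI)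
    assume a: "real (gcd d g) * T \<in> \<int>"
    have mult: "real k * T \<in> \<int>" if "gcd d g dvd k" for k
    proof -
      from that obtain q where "k = gcd d g * q" by blast
      then have "real k * T = real q * (real (gcd d g) * T)" by simp
      then show ?thesis using a by (metis Ints_mult Ints_of_nat)
    qed
    show "real d * T \<in> \<int>" "real g * T \<in> \<int>" by (auto intro: mult)
  next
    assume a: "real d * T \<in> \<int> \<and> real g * T \<in> \<int>"
    obtain u v where "u * int d + v * int g = gcd (int d) (int g)" using bezout_int by blast
    then have "real (gcd d g) = of_int u * real d + of_int v * real g"
      by (metis gcd_int_int_eq of_int_add of_int_mult of_int_of_nat_eq)
    then have "real (gcd d g) * T = of_int u * (real d * T) + of_int v * (real g * T)"
      by (simp add: algebra_simps)
    then show "real (gcd d g) * T \<in> \<int>" using a by (auto intro!: Ints_add Ints_mult)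
  qed
  then show ?case using insert.IH by simp
qed simp

lemma frac_diff_Ints: "x - frac x \<in> \<int>"
  by (simp add: frac_def)

text \<open>The fractional part \<open>\<tau>\<close> of the total \<open>sum s M\<close> is one of the \<open>Gcd D\<close> multiples of \<open>1 / Gcd D\<close>. Given
  \<open>\<tau>\<close>, all coordinates except one, \<open>s k0\<close>, can be chosen independently in \<open>n\<close> ways, and \<open>s k0\<close> is determined
  by the total. The congruence for \<open>k0\<close> then follows from the others, because \<open>d \<tau>\<close> is an integer.\<close>

lemma card_weighted_torus_solutions:
  fixes w :: "'k \<Rightarrow> nat" and D :: "nat set"
  assumes M: "finite M" "M \<noteq> {}" and D: "finite D" "Gcd D > 0" "Gcd D dvd d" and n: "n = sum w M + d" "n > 0"
  shows "card {s \<in> M \<rightarrow>\<^sub>E {0..<1::real}. (\<forall>k\<in>M. real n * s k - real (w k) * sum s M \<in> \<int>) \<and>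
      (\<forall>e\<in>D. real e * sum s M \<in> \<int>)} = n ^ (card M - 1) * Gcd D"
proof -
  define g where "g = Gcd D"
  obtain k0 where k0: "k0 \<in> M" using M by auto
  define M' where "M' = M - {k0}"
  have M': "finite M'" "k0 \<notin> M'" "M = insert k0 M'" using M k0 by (auto simp: M'_def)
  define Q where "Q = {s \<in> M \<rightarrow>\<^sub>E {0..<1::real}. (\<forall>k\<in>M. real n * s k - real (w k) * sum s M \<in> \<int>) \<and>
      real g * sum s M \<in> \<int>}"
  define T where "T = {\<tau> \<in> {0..<1::real}. real g * \<tau> - 0 \<in> \<int>}"
  define B where "B \<tau> k = {s \<in> {0..<1::real}. real n * s - real (w k) * \<tau> \<in> \<int>}" for \<tau> k
  let ?S = "SIGMA \<tau>:T. PiE M' (B \<tau>)"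
  define f where "f = (\<lambda>(\<tau>, s). s(k0 := frac (\<tau> - sum s M')) :: 'k \<Rightarrow> real)"
  have sumf: "sum (f (\<tau>, s)) M = frac (\<tau> - sum s M') + sum s M'" for \<tau> s
  proof -
    have "sum (f (\<tau>, s)) M' = sum s M'"
      using M' by (intro sum.cong) (auto simp: f_def)
    then show ?thesis using M' by (simp add: f_def)
  qed
  have sumf_Ints: "sum (f (\<tau>, s)) M - \<tau> \<in> \<int>" for \<tau> s
    unfolding sumf by (simp add: frac_def)
  have Ints_cong: "real a * x - y \<in> \<int> \<longleftrightarrow> real a * x' - y' \<in> \<int>"
    if "x - x' \<in> \<int>" "y - y' \<in> \<int>" for a x x' y y'
  proof -
    have "real a * x - y = real a * x' - y' + (real a * (x - x') - (y - y'))" by (simp add: algebra_simps)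
    moreover have "real a * (x - x') - (y - y') \<in> \<int>" by (rule Ints_diff[OF Ints_mult[OF Ints_of_nat that(1)] that(2)])
    ultimately show ?thesis by (metis Ints_add Ints_diff add_diff_cancel_right')
  qed
  have Ints_mult_diff: "real a * x - real a * y \<in> \<int>" if "x - y \<in> \<int>" for a x y
    using Ints_mult[OF _ that, of "real a"] by (simp add: right_diff_distrib)
  have "bij_betw f ?S Q"
    unfolding bij_betw_def
  proof (intro conjI equalityI subsetI)
    show "inj_on f ?S"
    proof (rule inj_onI)
      fix p p' assume p: "p \<in> ?S" and p': "p' \<in> ?S" and eq: "f p = f p'"
      obtain \<tau> s where ts: "p = (\<tau>, s)" by (cases p)
      obtain \<tau>' s' where ts': "p' = (\<tau>', s')" by (cases p')
      have "s = s'"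
      proof (rule extensionalityI[of _ M'])
        show "s \<in> extensional M'" "s' \<in> extensional M'" using p p' ts ts' by (auto simp: PiE_def)
        fix k assume "k \<in> M'"
        then have "k \<noteq> k0" using M' by auto
        then have "f p k = s k" "f p' k = s' k" by (simp_all add: f_def ts ts')
        then show "s k = s' k" using eq by simp
      qed
      have "\<tau> - \<tau>' = (sum (f p') M - \<tau>') - (sum (f p) M - \<tau>)" using eq by simp
      also have "\<dots> \<in> \<int>" using sumf_Ints by (simp add: ts ts')
      finally have "\<tau> - \<tau>' \<in> \<int>" .
      moreover have "\<bar>\<tau> - \<tau>'\<bar> < 1" using p p' ts ts' by (auto simp: T_def)
      ultimately have "\<tau> - \<tau>' = 0" using Ints_nonzero_abs_ge1 by force
      then show "p = p'" using \<open>s = s'\<close> by (simp add: ts ts')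
    qed
  next
    fix x assume "x \<in> f ` ?S"
    then obtain \<tau> s where x: "x = f (\<tau>, s)" and \<tau>: "\<tau> \<in> T" and s: "s \<in> PiE M' (B \<tau>)" by auto
    have xE: "x \<in> M \<rightarrow>\<^sub>E {0..<1}"
      using s M' unfolding x f_def B_def by (auto simp: PiE_iff frac_lt_1 extensional_def)
    have sum_x: "sum x M - \<tau> \<in> \<int>" unfolding x by (rule sumf_Ints)
    have B: "real n * s k - real (w k) * \<tau> \<in> \<int>" if "k \<in> M'" for k
      using s that by (auto simp: B_def)
    have g\<tau>: "real g * \<tau> \<in> \<int>" using \<tau> by (simp add: T_def)
    have "real g * sum x M \<in> \<int>"
      using Ints_cong[OF sum_x, of 0 0 g] g\<tau> by simp
    moreover have "real n * x k - real (w k) * sum x M \<in> \<int>" if "k \<in> M" for k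
    proof -
      have "real n * x k - real (w k) * \<tau> \<in> \<int>"
      proof (cases "k = k0")
        case False
        then show ?thesis using that M' B by (auto simp: x f_def)
      next
        case True
        have xk: "x k - (\<tau> - sum s M') \<in> \<int>" by (simp add: x f_def True frac_def)
        have sw: "sum w M = w k0 + sum w M'" using M' by simp
        have "real n * (\<tau> - sum s M') - real (w k0) * \<tau> =
            (real n - real (w k0) - real (sum w M')) * \<tau> - (\<Sum>k\<in>M'. real n * s k - real (w k) * \<tau>)"
          by (simp add: sum_subtractf sum_distrib_left sum_distrib_right algebra_simps)
        also have "real n - real (w k0) - real (sum w M') = real d" using n sw by simp
        finally have eq: "real n * (\<tau> - sum s M') - real (w k0) * \<tau> =
            real d * \<tau> - (\<Sum>k\<in>M'. real n * s k - real (w k) * \<tau>)" .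
        obtain q where q: "d = g * q" using D(3) by (auto simp: g_def)
        have "real d * \<tau> = real q * (real g * \<tau>)" by (simp add: q)
        then have dT: "real d * \<tau> \<in> \<int>" using g\<tau> by (metis Ints_mult Ints_of_nat)
        have "real n * (\<tau> - sum s M') - real (w k0) * \<tau> \<in> \<int>"
          unfolding eq by (rule Ints_diff[OF dT Ints_sum[OF B]])
        then show ?thesis using Ints_cong[OF xk, of "real (w k) * \<tau>" "real (w k) * \<tau>" n] True by simp
      qed
      then show ?thesis using Ints_cong[of "x k" "x k" "real (w k) * sum x M" "real (w k) * \<tau>" n]
          Ints_mult_diff[OF sum_x] by simp
    qed
    ultimately show "x \<in> Q" using xE by (simp add: Q_def)
  next
    fix x assume x: "x \<in> Q"
    define \<tau> where "\<tau> = frac (sum x M)"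
    define s where "s = restrict x M'"
    have \<tau>_Ints: "sum x M - \<tau> \<in> \<int>" unfolding \<tau>_def by (rule frac_diff_Ints)
    have "real g * \<tau> \<in> \<int>"
      using x Ints_cong[OF \<tau>_Ints, of 0 0 g] by (simp add: Q_def)
    then have \<tau>: "\<tau> \<in> T" by (simp add: T_def \<tau>_def frac_lt_1)
    have "s k \<in> B \<tau> k" if "k \<in> M'" for k
    proof -
      have k: "k \<in> M" using that M' by simp
      then have "real n * x k - real (w k) * \<tau> \<in> \<int>"
        using x Ints_cong[of "x k" "x k" "real (w k) * sum x M" "real (w k) * \<tau>" n]
          Ints_mult_diff[OF \<tau>_Ints] by (simp add: Q_def)
      then show ?thesis using x k that by (auto simp: B_def s_def Q_def)
    qed
    then have s: "s \<in> PiE M' (B \<tau>)" by (auto simp: s_def)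
    have ss: "sum s M' = sum x M'" by (simp add: s_def)
    have "x k0 \<in> {0..<1}" using x k0 by (auto simp: Q_def)
    moreover have "\<tau> - sum s M' - x k0 \<in> \<int>"
    proof -
      have "\<tau> - sum s M' - x k0 = - (sum x M - \<tau>)" using M' by (simp add: ss)
      then show ?thesis using \<tau>_Ints by (metis Ints_minus)
    qed
    ultimately have "frac (\<tau> - sum s M') = x k0" by (auto simp: frac_unique_iff)
    then have "f (\<tau>, s) = x"
      using x M' by (auto simp: f_def s_def Q_def fun_eq_iff PiE_def extensional_def)
    then show "x \<in> f ` ?S" using \<tau> s by force
  qed
  then have "card Q = card ?S" by (rule bij_betw_same_card[symmetric])
  also have "\<dots> = (\<Sum>\<tau>\<in>T. card (PiE M' (B \<tau>)))"
  proof (rule card_SigmaI)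
    have gT: "card T = g" unfolding T_def using D by (intro card_affine_torus_points) (simp add: g_def)
    then show "finite T" using D by (metis card.infinite g_def less_irrefl)
    have "finite (B \<tau> k)" for \<tau> k
      using card_affine_torus_points[OF n(2), of "real (w k) * \<tau>"] n(2)
      unfolding B_def by (metis card.infinite less_irrefl)
    then show "\<forall>\<tau>\<in>T. finite (PiE M' (B \<tau>))" using M' by (auto intro: finite_PiE)
  qed
  also have "\<dots> = (\<Sum>\<tau>\<in>T. n ^ card M')"
    using M' card_affine_torus_points[OF n(2)] by (intro sum.cong refl) (simp add: card_PiE B_def)
  also have "\<dots> = n ^ (card M - 1) * Gcd D"
    using D M' card_affine_torus_points[of g 0] by (simp add: T_def g_def)
  finally show ?thesis
    using mult_Gcd_in_Ints_iff[OF D(1)] by (simp add: Q_def g_def)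
qed

section \<open>Multiplicities of edges and vertices\<close>

abbreviation class_of :: "'v set set \<Rightarrow> 'v \<Rightarrow> 'v set" where
  "class_of F i \<equiv> {j. (i, j) \<in> conn F}"

lemma class_of_eq: "(i, j) \<in> conn F \<Longrightarrow> class_of F i = class_of F j"
  using conn_trans conn_sym by (metis (no_types, lifting))

definition edge_span :: "'n::{finite,linorder} set set \<Rightarrow> (real, 'n) vec set" where
  "edge_span F = range (\<lambda>t. \<Sum>e\<in>F. t e *\<^sub>R edge_vec e)"

lemma edge_spanI: "x = (\<Sum>e\<in>F. t e *\<^sub>R edge_vec e) \<Longrightarrow> x \<in> edge_span F"
  by (auto simp: edge_span_def)

lemma edge_span_zero: "0 \<in> edge_span F"
  by (rule edge_spanI[of _ "\<lambda>_. 0"]) simp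

lemma edge_span_add:
  assumes "x \<in> edge_span F" "y \<in> edge_span F"
  shows "x + y \<in> edge_span F"
proof -
  obtain s t where "x = (\<Sum>e\<in>F. s e *\<^sub>R edge_vec e)" "y = (\<Sum>e\<in>F. t e *\<^sub>R edge_vec e)"
    using assms by (auto simp: edge_span_def)
  then have "x + y = (\<Sum>e\<in>F. (s e + t e) *\<^sub>R edge_vec e)" by (simp add: sum.distrib scaleR_add_left)
  then show ?thesis by (rule edge_spanI)
qed

lemma edge_span_scale:
  assumes "x \<in> edge_span F"
  shows "c *\<^sub>R x \<in> edge_span F"
proof -
  obtain s where "x = (\<Sum>e\<in>F. s e *\<^sub>R edge_vec e)" using assms by (auto simp: edge_span_def)
  then have "c *\<^sub>R x = (\<Sum>e\<in>F. (c * s e) *\<^sub>R edge_vec e)" by (simp add: scaleR_sum_right)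
  then show ?thesis by (rule edge_spanI)
qed

lemma edge_span_sum: "(\<And>a. a \<in> A \<Longrightarrow> f a \<in> edge_span F) \<Longrightarrow> sum f A \<in> edge_span F"
  by (induction A rule: infinite_finite_induct) (auto simp: edge_span_zero edge_span_add)

lemma edge_vec_in_edge_span:
  assumes "e \<in> F" shows "edge_vec e \<in> edge_span F"
proof -
  have "edge_vec e = (\<Sum>e'\<in>F. (if e' = e then 1 else 0) *\<^sub>R edge_vec e')"
    using assms by (simp add: if_distrib[of "\<lambda>x. x *\<^sub>R _"] cong: if_cong)
  then show ?thesis by (rule edge_spanI)
qed

lemma edge_vec_pair:
  assumes "i \<noteq> j"
  shows "edge_vec {i, j} = axis j 1 - axis i 1 \<or> edge_vec {i, j} = - (axis j 1 - axis i 1)"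
  using assms by (auto simp: edge_vec_def min_def max_def)

lemma axis_diff_in_edge_span:
  assumes F: "F \<subseteq> edges_of UNIV" and con: "(i, j) \<in> conn F"
  shows "axis j 1 - axis i 1 \<in> edge_span F"
  using con
proof (induction rule: conn_closed_induct)
  case base
  then show ?case by (simp add: edge_span_zero)
next
  case (step x y)
  have "x \<noteq> y" using step(2) F by (auto simp: edges_of_def)
  have "axis y 1 - axis x 1 \<in> edge_span F"
    using edge_vec_pair[OF \<open>x \<noteq> y\<close>] edge_vec_in_edge_span[OF step(2)]
      edge_span_scale[OF edge_vec_in_edge_span[OF step(2)], of "-1"] by auto
  from edge_span_add[OF step(1) this] show ?case by simp
qed

definition class_sum :: "'n set set \<Rightarrow> 'n \<Rightarrow> real ^ 'n::finite \<Rightarrow> real" where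
  "class_sum F i x = (\<Sum>j\<in>class_of F i. x $ j)"

lemma class_sum_add: "class_sum F i (x + y) = class_sum F i x + class_sum F i y"
  by (simp add: class_sum_def sum.distrib)

lemma class_sum_scale: "class_sum F i (c *\<^sub>R x) = c * class_sum F i x"
  by (simp add: class_sum_def sum_distrib_left)

lemma class_sum_zero: "class_sum F i 0 = 0"
  by (simp add: class_sum_def)

lemma class_sum_sum: "class_sum F i (sum f A) = (\<Sum>a\<in>A. class_sum F i (f a))"
  by (induction A rule: infinite_finite_induct) (simp_all add: class_sum_add class_sum_zero)

lemma class_sum_axis: "class_sum F i (axis j 1) = (if (i, j) \<in> conn F then 1 else 0)"
  by (simp add: class_sum_def axis_def if_distrib cong: if_cong)

lemma class_sum_diff: "class_sum F i (x - y) = class_sum F i x - class_sum F i y"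
  by (simp add: class_sum_def sum_subtractf)

lemma class_sum_int_vecs: "x \<in> int_vecs \<Longrightarrow> class_sum F i x \<in> \<int>"
  by (auto simp: class_sum_def int_vecs_def intro: Ints_sum)

lemma class_sum_edge_vec:
  assumes F: "F \<subseteq> edges_of UNIV" and e: "e \<in> F"
  shows "class_sum F i (edge_vec e) = 0"
proof -
  have "card e = 2" using F e by (auto simp: edges_of_def)
  then obtain x y where xy: "e = {x, y}" "Min e = x" "Max e = y" by (rule edges_of_card_2_cases)
  have "{x, y} \<in> F" "{y, x} \<in> F" using e xy by (auto simp: insert_commute)
  then have "(i, x) \<in> conn F \<longleftrightarrow> (i, y) \<in> conn F" using conn_step by metis
  then show ?thesis by (simp add: edge_vec_def xy(2,3) class_sum_diff class_sum_axis)
qed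

text \<open>Modulo the span of the edges, all the mass in a component can be moved to one vertex of it, where it
  becomes the sum over the component.\<close>

lemma class_sums_Ints_imp:
  fixes x :: "(real, 'n::{finite,linorder}) vec"
  assumes F: "F \<subseteq> edges_of UNIV" and x: "\<And>i. class_sum F i x \<in> \<int>"
  obtains t where "x + (\<Sum>e\<in>F. t e *\<^sub>R edge_vec e) \<in> int_vecs"
proof -
  define rep where "rep i = (SOME j. j \<in> class_of F i)" for i
  have rep: "(i, rep i) \<in> conn F" for i
    using someI[of "\<lambda>j. j \<in> class_of F i" i] by (simp add: rep_def)
  have rep_eq: "rep i = rep j" if "(i, j) \<in> conn F" for i j
    using class_of_eq[OF that] by (simp add: rep_def)
  define y where "y = (\<Sum>i\<in>UNIV. x $ i *\<^sub>R axis (rep i) (1::real))"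
  have xs: "x = (\<Sum>i\<in>UNIV. x $ i *\<^sub>R axis i (1::real))"
    by (simp add: vec_eq_iff axis_def if_distrib cong: if_cong)
  have "y - x = y - (\<Sum>i\<in>UNIV. x $ i *\<^sub>R axis i (1::real))" using xs by (rule arg_cong)
  also have "\<dots> = (\<Sum>i\<in>UNIV. x $ i *\<^sub>R (axis (rep i) (1::real) - axis i 1))"
    by (simp add: y_def sum_subtractf scaleR_diff_right)
  also have "\<dots> \<in> edge_span F"
    by (intro edge_span_sum edge_span_scale axis_diff_in_edge_span[OF F] rep)
  finally obtain t where t: "y - x = (\<Sum>e\<in>F. t e *\<^sub>R edge_vec e)" by (auto simp: edge_span_def)
  have "y $ k \<in> \<int>" for k
  proof -
    have "y $ k = (\<Sum>i\<in>{i. rep i = k}. x $ i)"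
      by (simp add: y_def axis_def if_distrib sum.If_cases Int_def eq_commute[of k] cong: if_cong)
    also have "\<dots> \<in> \<int>"
    proof (cases "rep k = k")
      case True
      have "{i. rep i = k} = class_of F k"
        using rep rep_eq True conn_sym by (metis (no_types, lifting))
      then show ?thesis using x[of k] by (simp add: class_sum_def)
    next
      case False
      have "{i. rep i = k} = {}" using rep rep_eq False by (metis (mono_tags, lifting) Collect_empty_eq)
      then show ?thesis by simp
    qed
    finally show ?thesis .
  qed
  then have "y \<in> int_vecs" by (simp add: int_vecs_def)
  moreover have "x + (\<Sum>e\<in>F. t e *\<^sub>R edge_vec e) = y" using t by (simp add: algebra_simps)
  ultimately show ?thesis using that[of t] by simp
qed

text \<open>Summation over the vertices on one side of the bridge \<open>e\<close> isolates its coefficient.\<close>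

lemma forest_coefficients_Ints:
  fixes t :: "'n::{finite,linorder} set \<Rightarrow> real"
  assumes F: "is_forest UNIV F" and x: "(\<Sum>e\<in>F. t e *\<^sub>R edge_vec e) \<in> int_vecs" and e: "e \<in> F"
  shows "t e \<in> \<int>"
proof -
  have FE: "F \<subseteq> edges_of UNIV" using is_forest_graph[OF F] by (auto simp: is_graph_def edges_of_def)
  then have "card e = 2" using e by (auto simp: edges_of_def)
  then obtain i j where ij: "e = {i, j}" "Min e = i" "Max e = j" by (rule edges_of_card_2_cases)
  let ?F = "F - {e}"
  have "class_sum ?F i (\<Sum>e\<in>F. t e *\<^sub>R edge_vec e) =
      t e * class_sum ?F i (edge_vec e) + (\<Sum>e\<in>?F. t e * class_sum ?F i (edge_vec e))"
    using e sum.remove[of F e "\<lambda>e. t e * class_sum ?F i (edge_vec e)"]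
    by (simp add: class_sum_sum class_sum_scale)
  also have "(\<Sum>e\<in>?F. t e * class_sum ?F i (edge_vec e)) = 0"
  proof (intro sum.neutral ballI)
    fix e' assume "e' \<in> ?F"
    moreover have "?F \<subseteq> edges_of UNIV" using FE by blast
    ultimately have "class_sum ?F i (edge_vec e') = 0" by (intro class_sum_edge_vec)
    then show "t e' * class_sum ?F i (edge_vec e') = 0" by simp
  qed
  also have "class_sum ?F i (edge_vec e) = - 1"
    using is_forest_bridge[OF F, of i j] e ij
    by (simp add: edge_vec_def class_sum_diff class_sum_axis)
  finally have "t e = - class_sum ?F i (\<Sum>e\<in>F. t e *\<^sub>R edge_vec e)" by simp
  then show ?thesis using class_sum_int_vecs[OF x, of ?F i] by simp
qed

lemma R_vec_eq: "R_vec k = real CARD('n) *\<^sub>R axis k 1 - (\<Sum>j\<in>UNIV. axis j 1)" for k :: "'n::finite"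
  by (simp add: R_vec_def sum_subtractf sum_constant_scaleR del: sum_constant)

lemma class_sum_R_vec:
  fixes k :: "'n::finite"
  shows "class_sum F i (R_vec k) =
    (if (i, k) \<in> conn F then real CARD('n) else 0) - real (card (class_of F i))"
  by (simp add: R_vec_eq class_sum_diff class_sum_scale class_sum_sum class_sum_axis sum.If_cases)

lemma card_torus_kernel_edge_relation:
  fixes F :: "'n::{finite,linorder} set set" and M :: "'n set"
  assumes "(\<Sum>k\<in>M. c k *\<^sub>R R_vec k) \<in> edge_span F" "k \<in> M" "c k \<noteq> 0"
  shows "card (torus_kernel int_vecs gen (F <+> M)) = 0"
proof -
  obtain t where t: "(\<Sum>k\<in>M. c k *\<^sub>R R_vec k) = (\<Sum>e\<in>F. t e *\<^sub>R edge_vec e)"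
    using assms(1) by (auto simp: edge_span_def)
  define d where "d = case_sum (\<lambda>e. - t e) c"
  show ?thesis
  proof (rule card_torus_kernel_dependent[OF discrete_subgroup_int_vecs])
    show "(\<Sum>a\<in>F <+> M. d a *\<^sub>R gen a) = 0"
      by (simp add: sum.Plus d_def t sum_negf)
    show "Inr k \<in> F <+> M" "d (Inr k) \<noteq> 0" using assms by (auto simp: d_def)
  qed (auto simp: gen_in_int_vecs)
qed

text \<open>An edge that is not a bridge is a combination of the other edges.\<close>

lemma card_torus_kernel_not_forest:
  fixes F :: "'n::{finite,linorder} set set" and M :: "'n set"
  assumes F: "F \<subseteq> edges_of UNIV" and not: "\<not> is_forest UNIV F"
  shows "card (torus_kernel int_vecs gen (F <+> M)) = 0"
proof -
  have "is_graph UNIV F" using F by (auto simp: is_graph_def edges_of_def)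
  then obtain u w where uw: "{u, w} \<in> F" "(u, w) \<in> conn (F - {{u, w}})"
    using not by (auto simp: is_forest_iff_bridges)
  have "u \<noteq> w" using uw(1) F by (auto simp: edges_of_def)
  have "axis w 1 - axis u 1 \<in> edge_span (F - {{u, w}})"
    using F by (intro axis_diff_in_edge_span uw) auto
  then have "edge_vec {u, w} \<in> edge_span (F - {{u, w}})"
    using edge_vec_pair[OF \<open>u \<noteq> w\<close>] edge_span_scale[of _ _ "-1"] by force
  then obtain t where t: "edge_vec {u, w} = (\<Sum>e\<in>F - {{u, w}}. t e *\<^sub>R edge_vec e)"
    by (auto simp: edge_span_def)
  define d where "d = case_sum (\<lambda>e. if e = {u, w} then - 1 else t e) (\<lambda>_ :: 'n. 0)"
  show ?thesis
  proof (rule card_torus_kernel_dependent[OF discrete_subgroup_int_vecs])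
    have "(\<Sum>e\<in>F. (if e = {u, w} then - 1 else t e) *\<^sub>R edge_vec e) =
        - edge_vec {u, w} + (\<Sum>e\<in>F - {{u, w}}. t e *\<^sub>R edge_vec e)"
      using uw(1) by (simp add: sum.remove[of F "{u, w}"])
    then show "(\<Sum>a\<in>F <+> M. d a *\<^sub>R gen a) = 0"
      by (simp add: sum.Plus d_def t)
    show "Inl {u, w} \<in> F <+> M" "d (Inl {u, w}) \<noteq> 0" using uw by (auto simp: d_def)
  qed (auto simp: gen_in_int_vecs)
qed

definition separated :: "'v set set \<Rightarrow> 'v set \<Rightarrow> bool" where
  "separated F M \<longleftrightarrow> (\<forall>k\<in>M. \<forall>k'\<in>M. (k, k') \<in> conn F \<longrightarrow> k = k')"

definition unreached :: "'v set set \<Rightarrow> 'v set \<Rightarrow> 'v set" where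
  "unreached F M = {w. \<forall>k\<in>M. (k, w) \<notin> conn F}"

text \<open>The difference of \<open>R\<^sub>i\<close> and \<open>R\<^sub>j\<close> is \<open>n (e\<^sub>i - e\<^sub>j)\<close>, which is spanned by edges if \<open>i\<close> and \<open>j\<close> are
  connected.\<close>

lemma card_torus_kernel_not_separated:
  fixes F :: "'n::{finite,linorder} set set"
  assumes F: "F \<subseteq> edges_of UNIV" and not: "\<not> separated F M"
  shows "card (torus_kernel int_vecs gen (F <+> M)) = 0"
proof -
  obtain k k' where k: "k \<in> M" "k' \<in> M" "(k, k') \<in> conn F" "k \<noteq> k'"
    using not by (auto simp: separated_def)
  define c where "c = (\<lambda>_. 0 :: real)(k := 1, k' := - 1)"
  have "(\<Sum>j\<in>M. c j *\<^sub>R R_vec j) = (\<Sum>j\<in>{k, k'}. c j *\<^sub>R R_vec j)"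
    using k by (intro sum.mono_neutral_right) (auto simp: c_def)
  also have "\<dots> = (- real CARD('n)) *\<^sub>R (axis k' 1 - axis k 1)"
    using k by (simp add: c_def R_vec_eq algebra_simps)
  also have "\<dots> \<in> edge_span F"
    by (intro edge_span_scale axis_diff_in_edge_span[OF F] k)
  finally show ?thesis
    using k by (intro card_torus_kernel_edge_relation[of c M F k]) (auto simp: c_def)
qed

lemma sum_over_separated_classes:
  fixes f :: "'v::finite \<Rightarrow> 'a::comm_monoid_add"
  assumes "separated F M"
  shows "(\<Sum>k\<in>M. \<Sum>j\<in>class_of F k. f j) = (\<Sum>j\<in>- unreached F M. f j)"
proof -
  have "(\<Sum>k\<in>M. \<Sum>j\<in>class_of F k. f j) = (\<Sum>j\<in>(\<Union>k\<in>M. class_of F k). f j)"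
  proof (rule sum.UNION_disjoint[symmetric])
    show "\<forall>i\<in>M. \<forall>j\<in>M. i \<noteq> j \<longrightarrow> class_of F i \<inter> class_of F j = {}"
      using assms conn_trans conn_sym unfolding separated_def
      by (metis (no_types, lifting) Int_emptyI mem_Collect_eq)
  qed auto
  also have "(\<Union>k\<in>M. class_of F k) = - unreached F M" by (auto simp: unreached_def)
  finally show ?thesis .
qed

text \<open>Let \<open>w\<^sub>k\<close> be the size of the component of \<open>k\<close> and \<open>e\<close> the all-ones vector. If the components of the \<open>k \<in> M\<close> partition the
  vertices, then \<open>\<Sum>k\<in>M. w\<^sub>k R\<^sub>k = n ((\<Sum>k\<in>M. w\<^sub>k e\<^sub>k) - e)\<close>, where the sums over each component vanish.\<close>

lemma card_torus_kernel_all_reached: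
  fixes F :: "'n::{finite,linorder} set set"
  assumes F: "F \<subseteq> edges_of UNIV" and sep: "separated F M" and all: "unreached F M = {}"
  shows "card (torus_kernel int_vecs gen (F <+> M)) = 0"
proof -
  let ?n = "real CARD('n)"
  define c where "c k = real (card (class_of F k))" for k
  have c: "c k > 0" for k by (auto simp: c_def card_gt_0_iff)
  have "(\<Sum>k\<in>M. c k) = ?n"
    using sum_over_separated_classes[OF sep, of "\<lambda>_. 1::real"] all by (simp add: c_def)
  define one :: "(real, 'n) vec" where "one = (\<Sum>j\<in>UNIV. axis j 1)"
  have "(\<Sum>k\<in>M. c k *\<^sub>R R_vec k) = ?n *\<^sub>R (\<Sum>k\<in>M. c k *\<^sub>R axis k 1) - (\<Sum>k\<in>M. c k) *\<^sub>R one"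
    by (simp add: R_vec_eq one_def[symmetric] scaleR_diff_right sum_subtractf scaleR_sum_left
        scaleR_sum_right mult.commute)
  also have "\<dots> = ?n *\<^sub>R ((\<Sum>k\<in>M. \<Sum>j\<in>class_of F k. axis k 1) - one)"
    unfolding \<open>(\<Sum>k\<in>M. c k) = ?n\<close>
    by (simp add: c_def scaleR_diff_right sum_constant_scaleR del: sum_constant)
  also have "one = (\<Sum>k\<in>M. \<Sum>j\<in>class_of F k. axis j (1::real))"
    using sum_over_separated_classes[OF sep, of "\<lambda>j. axis j (1::real)"] all by (simp add: one_def)
  also have "?n *\<^sub>R ((\<Sum>k\<in>M. \<Sum>j\<in>class_of F k. axis k 1) - (\<Sum>k\<in>M. \<Sum>j\<in>class_of F k. axis j (1::real)))
      = ?n *\<^sub>R (\<Sum>k\<in>M. \<Sum>j\<in>class_of F k. axis k 1 - axis j (1::real))"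
    by (simp add: sum_subtractf)
  also have "\<dots> \<in> edge_span F"
    by (intro edge_span_scale edge_span_sum axis_diff_in_edge_span[OF F]) (auto intro: conn_sym)
  finally have rel: "(\<Sum>k\<in>M. c k *\<^sub>R R_vec k) \<in> edge_span F" .
  have "M \<noteq> {}" using all by (auto simp: unreached_def)
  then obtain k where "k \<in> M" by auto
  then show ?thesis using card_torus_kernel_edge_relation[OF rel] c[of k] by simp
qed

text \<open>The coordinates at the edges of a forest are determined by the others, and they exist as soon as the
  sums over the components are integers.\<close>

lemma card_torus_kernel_forest:
  fixes F :: "'n::{finite,linorder} set set"
  assumes F: "is_forest UNIV F"
  shows "card (torus_kernel int_vecs gen (F <+> M)) =
    card {s \<in> M \<rightarrow>\<^sub>E {0..<1}. \<forall>i. class_sum F i (\<Sum>k\<in>M. s k *\<^sub>R R_vec k) \<in> \<int>}"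
proof -
  have FE: "F \<subseteq> edges_of UNIV" using is_forest_graph[OF F] by (auto simp: is_graph_def edges_of_def)
  note L = discrete_subgroup_int_vecs
  define Q where "Q = {s \<in> M \<rightarrow>\<^sub>E {0..<1}. \<forall>i. class_sum F i (\<Sum>k\<in>M. s k *\<^sub>R R_vec k) \<in> \<int>}"
  define res where "res t = (\<lambda>k\<in>M. t (Inr k))" for t :: "'n set + 'n \<Rightarrow> real"
  have split: "(\<Sum>a\<in>F <+> M. t a *\<^sub>R gen a) =
      (\<Sum>e\<in>F. t (Inl e) *\<^sub>R edge_vec e) + (\<Sum>k\<in>M. t (Inr k) *\<^sub>R R_vec k)" for t
    by (simp add: sum.Plus)
  have "bij_betw res (torus_kernel int_vecs gen (F <+> M)) Q"
    unfolding bij_betw_def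
  proof (intro conjI equalityI subsetI)
    show "inj_on res (torus_kernel int_vecs gen (F <+> M))"
    proof (rule inj_onI)
      fix t t' assume t: "t \<in> torus_kernel int_vecs gen (F <+> M)"
        and t': "t' \<in> torus_kernel int_vecs gen (F <+> M)" and eq: "res t = res t'"
      have R: "t (Inr k) = t' (Inr k)" if "k \<in> M" for k
        using fun_cong[OF eq, of k] that by (simp add: res_def)
      have "(\<Sum>e\<in>F. (t (Inl e) - t' (Inl e)) *\<^sub>R edge_vec e) =
          (\<Sum>a\<in>F <+> M. t a *\<^sub>R gen a) - (\<Sum>a\<in>F <+> M. t' a *\<^sub>R gen a)"
        unfolding split using R by (simp add: scaleR_diff_left sum_subtractf)
      also have "\<dots> \<in> int_vecs"
        using t t' by (intro discrete_subgroup_diff[OF L]) (auto simp: torus_kernel_def)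
      finally have Z: "t (Inl e) - t' (Inl e) \<in> \<int>" if "e \<in> F" for e
        using forest_coefficients_Ints[OF F, of "\<lambda>e. t (Inl e) - t' (Inl e)"] that by blast
      have "t (Inl e) = t' (Inl e)" if "e \<in> F" for e
      proof -
        have "t (Inl e) \<in> {0..<1}" "t' (Inl e) \<in> {0..<1}"
          using t t' that by (auto simp: torus_kernel_def)
        then have "\<bar>t (Inl e) - t' (Inl e)\<bar> < 1" by auto
        then show ?thesis using Ints_nonzero_abs_ge1[OF Z[OF that]] by linarith
      qed
      then have "t a = t' a" if "a \<in> F <+> M" for a
        using R that by auto
      moreover have "t \<in> extensional (F <+> M)" "t' \<in> extensional (F <+> M)"
        using t t' by (auto simp: torus_kernel_def PiE_def)
      ultimately show "t = t'" using extensionalityI by blast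
    qed
  next
    fix s assume "s \<in> res ` torus_kernel int_vecs gen (F <+> M)"
    then obtain t where t: "t \<in> torus_kernel int_vecs gen (F <+> M)" "s = res t" by auto
    have "class_sum F i (\<Sum>k\<in>M. s k *\<^sub>R R_vec k) \<in> \<int>" for i
    proof -
      have "class_sum F i (\<Sum>a\<in>F <+> M. t a *\<^sub>R gen a) =
          class_sum F i (\<Sum>e\<in>F. t (Inl e) *\<^sub>R edge_vec e) + class_sum F i (\<Sum>k\<in>M. s k *\<^sub>R R_vec k)"
        unfolding split class_sum_add by (simp add: t res_def)
      also have "class_sum F i (\<Sum>e\<in>F. t (Inl e) *\<^sub>R edge_vec e) = 0"
        by (simp add: class_sum_sum class_sum_scale class_sum_edge_vec[OF FE])
      finally show ?thesis
        using t class_sum_int_vecs[of "\<Sum>a\<in>F <+> M. t a *\<^sub>R gen a" F i] by (simp add: torus_kernel_def)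
    qed
    moreover have "s \<in> M \<rightarrow>\<^sub>E {0..<1}" using t by (fastforce simp: res_def torus_kernel_def)
    ultimately show "s \<in> Q" by (simp add: Q_def)
  next
    fix s assume s: "s \<in> Q"
    then have "\<And>i. class_sum F i (\<Sum>k\<in>M. s k *\<^sub>R R_vec k) \<in> \<int>" by (simp add: Q_def)
    from class_sums_Ints_imp[OF FE this] obtain t where
      t: "(\<Sum>k\<in>M. s k *\<^sub>R R_vec k) + (\<Sum>e\<in>F. t e *\<^sub>R edge_vec e) \<in> int_vecs" by blast
    define t' where "t' = restrict (case_sum (\<lambda>e. frac (t e)) s) (F <+> M)"
    have "(\<Sum>a\<in>F <+> M. t' a *\<^sub>R gen a) =
        (\<Sum>e\<in>F. frac (t e) *\<^sub>R edge_vec e) + (\<Sum>k\<in>M. s k *\<^sub>R R_vec k)"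
      unfolding split by (intro arg_cong2[where f = "(+)"] sum.cong refl) (simp_all add: t'_def InlI InrI)
    also have "\<dots> = ((\<Sum>k\<in>M. s k *\<^sub>R R_vec k) + (\<Sum>e\<in>F. t e *\<^sub>R edge_vec e)) -
        (\<Sum>e\<in>F. of_int \<lfloor>t e\<rfloor> *\<^sub>R gen (Inl e))"
      by (simp add: frac_def scaleR_diff_left sum_subtractf)
    also have "\<dots> \<in> int_vecs"
      by (intro discrete_subgroup_diff[OF L t] discrete_subgroup_sum[OF L]
          discrete_subgroup_scale_int[OF L gen_in_int_vecs]) auto
    finally have "(\<Sum>a\<in>F <+> M. t' a *\<^sub>R gen a) \<in> int_vecs" .
    moreover have "t' \<in> (F <+> M) \<rightarrow>\<^sub>E {0..<1}"
      using s by (auto simp: t'_def Q_def frac_lt_1 PiE_iff)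
    ultimately have "t' \<in> torus_kernel int_vecs gen (F <+> M)" by (simp add: torus_kernel_def)
    moreover have "res t' = s"
      using s by (auto simp: res_def t'_def Q_def fun_eq_iff PiE_def extensional_def)
    ultimately show "s \<in> res ` torus_kernel int_vecs gen (F <+> M)" by blast
  qed
  from bij_betw_same_card[OF this] show ?thesis by (simp add: Q_def)
qed

text \<open>If \<open>M\<close> misses no tree, both sides are \<open>0\<close>, since the gcd of the empty set is \<open>0\<close>. Otherwise let
  \<open>T\<close> be the sum of the coordinates \<open>s k\<close> at \<open>M\<close>: a tree of size \<open>w\<close> gives the condition \<open>n s k - w T \<in> \<int>\<close> if it contains
  \<open>k \<in> M\<close>, and \<open>w T \<in> \<int>\<close> if it is missed.\<close>

theorem card_torus_kernel_forest_roots: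
  fixes F :: "'n::{finite,linorder} set set"
  assumes F: "is_forest UNIV F" and sep: "separated F M" and M: "M \<noteq> {}"
  shows "card (torus_kernel int_vecs gen (F <+> M)) =
    CARD('n) ^ (card M - 1) * Gcd (card ` class_of F ` unreached F M)"
proof (cases "unreached F M = {}")
  case True
  have "F \<subseteq> edges_of UNIV" using is_forest_graph[OF F] by (auto simp: is_graph_def edges_of_def)
  from card_torus_kernel_all_reached[OF this sep True] show ?thesis by (simp add: True)
next
  case False
  let ?n = "CARD('n)"
  let ?U = "unreached F M"
  define w where "w i = card (class_of F i)" for i
  define D where "D = w ` ?U"
  have D: "D = card ` class_of F ` ?U" by (auto simp: D_def w_def)
  have wpos: "w i > 0" for i by (auto simp: w_def card_gt_0_iff)
  have cls: "class_sum F i (\<Sum>k\<in>M. s k *\<^sub>R R_vec k) =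
      real ?n * (\<Sum>k\<in>{k \<in> M. (i, k) \<in> conn F}. s k) - real (w i) * sum s M" for s i
  proof -
    have "class_sum F i (\<Sum>k\<in>M. s k *\<^sub>R R_vec k) =
        (\<Sum>k\<in>M. (if (i, k) \<in> conn F then s k * real ?n else 0) - s k * real (w i))"
      unfolding class_sum_sum class_sum_scale class_sum_R_vec
      by (intro sum.cong refl) (simp add: w_def algebra_simps)
    also have "\<dots> = (\<Sum>k\<in>{k \<in> M. (i, k) \<in> conn F}. s k * real ?n) - sum s M * real (w i)"
      by (simp add: sum_subtractf sum.inter_filter sum_distrib_right)
    finally show ?thesis by (simp add: sum_distrib_right[symmetric] mult.commute)
  qed
  have cls_M: "class_sum F k (\<Sum>k\<in>M. s k *\<^sub>R R_vec k) = real ?n * s k - real (w k) * sum s M"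
    if "k \<in> M" for s k
  proof -
    have eq: "{k' \<in> M. (k, k') \<in> conn F} = {k}" using sep that by (auto simp: separated_def)
    show ?thesis unfolding cls eq by simp
  qed
  have cls_U: "class_sum F i (\<Sum>k\<in>M. s k *\<^sub>R R_vec k) = - (real (w i) * sum s M)"
    if "i \<in> ?U" for s i
  proof -
    have eq: "{k \<in> M. (i, k) \<in> conn F} = {}" using that by (auto simp: unreached_def dest: conn_sym)
    show ?thesis unfolding cls eq by simp
  qed
  have cls_eq: "class_sum F i x = class_sum F j x" if "(i, j) \<in> conn F" for i j x
    using class_of_eq[OF that] by (simp add: class_sum_def)
  have iff: "(\<forall>i. class_sum F i (\<Sum>k\<in>M. s k *\<^sub>R R_vec k) \<in> \<int>) \<longleftrightarrow>
      (\<forall>k\<in>M. real ?n * s k - real (w k) * sum s M \<in> \<int>) \<and> (\<forall>e\<in>D. real e * sum s M \<in> \<int>)" for s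
  proof (intro iffI conjI ballI)
    assume a: "\<forall>i. class_sum F i (\<Sum>k\<in>M. s k *\<^sub>R R_vec k) \<in> \<int>"
    show "real ?n * s k - real (w k) * sum s M \<in> \<int>" if "k \<in> M" for k
      using a cls_M[OF that] by metis
    show "real e * sum s M \<in> \<int>" if e: "e \<in> D" for e
    proof -
      obtain i where "i \<in> ?U" "e = w i" using e by (auto simp: D_def)
      then show ?thesis using a cls_U[of i s] by (metis Ints_minus minus_minus)
    qed
  next
    assume a: "(\<forall>k\<in>M. real ?n * s k - real (w k) * sum s M \<in> \<int>) \<and> (\<forall>e\<in>D. real e * sum s M \<in> \<int>)"
    show "\<forall>i. class_sum F i (\<Sum>k\<in>M. s k *\<^sub>R R_vec k) \<in> \<int>"
    proof
      fix i
      show "class_sum F i (\<Sum>k\<in>M. s k *\<^sub>R R_vec k) \<in> \<int>"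
      proof (cases "i \<in> ?U")
        case True
        then show ?thesis using a cls_U[OF True, of s] by (auto simp: D_def)
      next
        case False
        then obtain k where k: "k \<in> M" "(k, i) \<in> conn F" by (auto simp: unreached_def)
        then show ?thesis using a cls_M[OF k(1), of s] cls_eq[OF k(2)] by metis
      qed
    qed
  qed
  have reached: "sum w M = card (- ?U)"
    using sum_over_separated_classes[OF sep, of "\<lambda>_. 1::nat"] by (simp add: w_def)
  have nU: "?n = sum w M + card ?U"
    unfolding reached by (simp add: card_Un_disjoint[symmetric] Compl_partition2)
  have dvd: "Gcd D dvd card ?U"
  proof -
    have "disjoint (class_of F ` ?U)"
    proof (rule disjointI)
      fix A B assume AB: "A \<in> class_of F ` ?U" "B \<in> class_of F ` ?U" "A \<noteq> B"
      then obtain i j where ij: "A = class_of F i" "B = class_of F j" by auto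
      show "A \<inter> B = {}"
      proof (rule ccontr)
        assume "A \<inter> B \<noteq> {}"
        then obtain x where x: "(i, x) \<in> conn F" "(j, x) \<in> conn F" by (auto simp: ij)
        then show False using class_of_eq[OF x(1)] class_of_eq[OF x(2)] AB(3) ij by simp
      qed
    qed
    then have "card (\<Union> (class_of F ` ?U)) = sum card (class_of F ` ?U)"
      by (rule card_Union_disjoint) simp
    moreover have "\<Union> (class_of F ` ?U) = ?U"
    proof (intro equalityI subsetI)
      fix x assume "x \<in> \<Union> (class_of F ` ?U)"
      then obtain i where i: "i \<in> ?U" "(i, x) \<in> conn F" by auto
      have "(k, x) \<notin> conn F" if "k \<in> M" for k
      proof
        assume "(k, x) \<in> conn F"
        then have "(k, i) \<in> conn F" using conn_sym[OF i(2)] by (rule conn_trans)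
        then show False using i(1) that by (simp add: unreached_def)
      qed
      then show "x \<in> ?U" by (simp add: unreached_def)
    qed auto
    ultimately have "card ?U = sum card (class_of F ` ?U)" by simp
    also have "Gcd D dvd \<dots>"
      unfolding D by (intro dvd_sum Gcd_dvd) auto
    finally show ?thesis .
  qed
  have Dpos: "Gcd D > 0"
  proof -
    obtain i where "i \<in> ?U" using False by auto
    then have "Gcd D dvd w i" by (intro Gcd_dvd) (simp add: D_def)
    then show ?thesis using wpos[of i] by (metis dvd_0_left_iff neq0_conv)
  qed
  have "card (torus_kernel int_vecs gen (F <+> M)) =
      card {s \<in> M \<rightarrow>\<^sub>E {0..<1::real}. (\<forall>k\<in>M. real ?n * s k - real (w k) * sum s M \<in> \<int>) \<and>
        (\<forall>e\<in>D. real e * sum s M \<in> \<int>)}"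
    unfolding card_torus_kernel_forest[OF F] iff ..
  also have "\<dots> = ?n ^ (card M - 1) * Gcd D"
    by (rule card_weighted_torus_solutions[OF _ M _ Dpos dvd nU]) (auto simp: D_def)
  finally show ?thesis by (simp only: D)
qed

lemma card_torus_kernel_edges:
  fixes F :: "'n::{finite,linorder} set set"
  assumes F: "F \<subseteq> edges_of UNIV"
  shows "card (torus_kernel int_vecs gen (F <+> ({} :: 'n set))) = (if is_forest UNIV F then 1 else 0)"
  using card_torus_kernel_not_forest[OF F, of "{}"] card_torus_kernel_forest[of F "{}"]
  by (auto simp: class_sum_zero)

section \<open>Summation over forests\<close>

definition forests_on :: "'v set \<Rightarrow> 'v set set set" where
  "forests_on W = {F. is_forest W F}"

lemma finite_forests_on: "finite W \<Longrightarrow> finite (forests_on W)"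
  by (rule finite_subset[of _ "Pow (Pow W)"]) (auto simp: forests_on_def is_forest_def is_graph_def)

text \<open>\<^const>\<open>Phi\<close> for forests on an arbitrary vertex set.\<close>

definition gcd_sum :: "'v set \<Rightarrow> nat" where
  "gcd_sum W = (\<Sum>F\<in>forests_on W. Gcd (card ` components W F))"

lemma components_eq_class_of:
  assumes "is_graph W F"
  shows "components W F = class_of F ` W"
proof -
  have "components W F = (\<lambda>x. {y. x \<in> W \<and> y \<in> W \<and> (x, y) \<in> conn F}) ` W"
    by (auto simp: components_def quotient_def conn_def)
  also have "\<dots> = class_of F ` W"
    using conn_in_vertices[OF assms] by (intro image_cong refl) auto
  finally show ?thesis .
qed

lemma conn_image: "(u, w) \<in> conn F \<Longrightarrow> (h u, h w) \<in> conn ((`) h ` F)"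
proof (induction rule: conn_closed_induct)
  case (step x y)
  have "h ` {x, y} \<in> (`) h ` F" using step(2) by (rule imageI)
  then show ?case using step(1) by (auto intro: conn_step)
qed simp

lemma is_forest_image:
  assumes h: "bij_betw h A B" and F: "is_forest A F"
  shows "is_forest B ((`) h ` F)"
    and "card ` components B ((`) h ` F) = card ` components A F"
    and "(`) (the_inv_into A h) ` (`) h ` F = F"
proof -
  define g where "g = the_inv_into A h"
  have gh: "g (h x) = x" if "x \<in> A" for x
    using h that by (simp add: g_def bij_betw_def the_inv_into_f_f)
  have hg: "h (g y) = y" "g y \<in> A" if "y \<in> B" for y
    using h that by (auto simp: g_def bij_betw_def f_the_inv_into_f the_inv_into_into)
  have graph: "is_graph A F" by (rule is_forest_graph[OF F])
  have FA: "e \<subseteq> A" if "e \<in> F" for e using graph that by (auto simp: is_graph_def)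
  have ghe: "g ` h ` e = e" if "e \<subseteq> A" for e
    using gh that by (force simp: image_image)
  have inj: "inj_on h A" using h by (simp add: bij_betw_def)
  have graphB: "is_graph B ((`) h ` F)"
    unfolding is_graph_def
  proof
    fix e' assume "e' \<in> (`) h ` F"
    then obtain e where e: "e \<in> F" "e' = h ` e" by auto
    have "card e' = card e" unfolding e(2) by (rule card_image[OF inj_on_subset[OF inj FA[OF e(1)]]])
    then show "e' \<subseteq> B \<and> card e' = 2"
      using e graph h FA[OF e(1)] by (auto simp: is_graph_def bij_betw_def)
  qed
  have inv: "(`) g ` (`) h ` F = F"
  proof -
    have "(`) g ` (`) h ` F = (\<lambda>e. g ` h ` e) ` F" by (rule image_image)
    also have "\<dots> = (\<lambda>e. e) ` F" by (intro image_cong refl ghe FA)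
    finally show ?thesis by simp
  qed
  show "(`) (the_inv_into A h) ` (`) h ` F = F" using inv by (simp add: g_def)
  show "is_forest B ((`) h ` F)"
    unfolding is_forest_iff_bridges
  proof (intro conjI graphB allI impI notI)
    fix x y assume xy: "{x, y} \<in> (`) h ` F" and con: "(x, y) \<in> conn ((`) h ` F - {{x, y}})"
    have xyF: "{g x, g y} \<in> F" using imageI[OF xy, of "(`) g"] inv by simp
    have "x \<in> B" "y \<in> B" using bspec[OF graphB[unfolded is_graph_def] xy] by auto
    have "(`) g ` ((`) h ` F - {{x, y}}) \<subseteq> F - {{g x, g y}}"
    proof
      fix e' assume "e' \<in> (`) g ` ((`) h ` F - {{x, y}})"
      then obtain e where e: "e \<in> F" "h ` e \<noteq> {x, y}" "e' = g ` h ` e" by auto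
      have "e' = e" using ghe[OF FA[OF e(1)]] e(3) by simp
      moreover have "e \<noteq> {g x, g y}" using e(2) hg \<open>x \<in> B\<close> \<open>y \<in> B\<close> by auto
      ultimately show "e' \<in> F - {{g x, g y}}" using e(1) by simp
    qed
    then have "(g x, g y) \<in> conn (F - {{g x, g y}})" using conn_mono[OF conn_image[OF con]] by blast
    then show False using is_forest_bridge[OF F xyF] by simp
  qed
  have cls: "class_of ((`) h ` F) (h u) = h ` class_of F u" if u: "u \<in> A" for u
  proof (intro equalityI subsetI)
    fix y assume "y \<in> class_of ((`) h ` F) (h u)"
    then have con: "(h u, y) \<in> conn ((`) h ` F)" by simp
    have "h u \<in> B" using u h by (auto simp: bij_betw_def)
    then have yB: "y \<in> B" by (rule conn_in_vertices[OF graphB con])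
    have "(u, g y) \<in> conn F" using conn_image[OF con, of g] inv gh[OF u] by simp
    then show "y \<in> h ` class_of F u" using hg(1)[OF yB] by (metis (mono_tags, lifting) image_eqI mem_Collect_eq)
  next
    fix y assume "y \<in> h ` class_of F u"
    then show "y \<in> class_of ((`) h ` F) (h u)" using conn_image by auto
  qed
  have card_cls: "card (class_of ((`) h ` F) (h u)) = card (class_of F u)" if u: "u \<in> A" for u
  proof -
    have "class_of F u \<subseteq> A" using conn_in_vertices[OF graph _ u] by auto
    then show ?thesis unfolding cls[OF u] by (intro card_image inj_on_subset[OF inj])
  qed
  have B: "B = h ` A" using h by (simp add: bij_betw_def)
  have "card ` components B ((`) h ` F) = (\<lambda>u. card (class_of ((`) h ` F) (h u))) ` A"
    unfolding components_eq_class_of[OF graphB] unfolding B image_image ..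
  also have "\<dots> = (\<lambda>u. card (class_of F u)) ` A" by (intro image_cong refl card_cls)
  also have "\<dots> = card ` components A F"
    unfolding components_eq_class_of[OF graph] image_image ..
  finally show "card ` components B ((`) h ` F) = card ` components A F" .
qed

lemma sum_forests_on_transfer:
  assumes h: "bij_betw h A B"
  shows "(\<Sum>F\<in>forests_on A. f (card ` components A F)) = (\<Sum>F\<in>forests_on B. f (card ` components B F))"
proof -
  let ?g = "the_inv_into A h"
  have g: "bij_betw ?g B A" using h by (rule bij_betw_the_inv_into)
  have hg: "h (?g y) = y" if "y \<in> B" for y
    using h that by (auto simp: bij_betw_def f_the_inv_into_f)
  show ?thesis
  proof (rule sum.reindex_bij_witness[of _ "(`) ((`) ?g)" "(`) ((`) h)"])
    fix F assume F: "F \<in> forests_on A"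
    show "(`) ?g ` (`) h ` F = F" "(`) h ` F \<in> forests_on B"
      "f (card ` components B ((`) h ` F)) = f (card ` components A F)"
      using is_forest_image[OF h, of F] F by (simp_all add: forests_on_def)
  next
    fix F assume F: "F \<in> forests_on B"
    show "(`) ?g ` F \<in> forests_on A"
      using is_forest_image(1)[OF g, of F] F by (simp add: forests_on_def)
    have "h ` ?g ` e = e" if "e \<in> F" for e
    proof -
      have "e \<subseteq> B" using F that by (auto simp: forests_on_def is_forest_def is_graph_def)
      then show ?thesis using hg by (force simp: image_image)
    qed
    then show "(`) h ` (`) ?g ` F = F" by (simp add: image_image cong: image_cong)
  qed
qed

lemma forests_eq: "forests v = forests_on {1..v}"
  by (simp add: forests_def forests_on_def)

lemma gcd_sum_eq_Phi:
  assumes "finite W"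
  shows "gcd_sum W = Phi (card W)"
proof -
  obtain h where h: "bij_betw h W {1..card W}"
    using finite_same_card_bij[OF assms, of "{1..card W}"] by auto
  from sum_forests_on_transfer[OF h, of Gcd] show ?thesis
    by (simp add: gcd_sum_def Phi_def forests_eq)
qed

lemma card_forests_on:
  assumes "finite W"
  shows "card (forests_on W) = num_forests (card W)"
proof -
  obtain h where h: "bij_betw h W {1..card W}"
    using finite_same_card_bij[OF assms, of "{1..card W}"] by auto
  from sum_forests_on_transfer[OF h, of "\<lambda>_. 1::nat"] show ?thesis
    by (simp add: num_forests_def forests_eq)
qed

text \<open>A path cannot leave a part of a disjoint union.\<close>

lemma conn_Un_disjoint:
  assumes "is_graph U E" "is_graph V E'" "U \<inter> V = {}" "x \<in> U"
  shows "(x, y) \<in> conn (E \<union> E') \<longleftrightarrow> (x, y) \<in> conn E"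
proof
  assume "(x, y) \<in> conn (E \<union> E')"
  then have "(x, y) \<in> conn E \<and> y \<in> U"
  proof (induction rule: conn_closed_induct)
    case (step a b)
    have "{a, b} \<notin> E'"
    proof
      assume "{a, b} \<in> E'"
      then have "a \<in> V" using bspec[OF assms(2)[unfolded is_graph_def]] by force
      then show False using step(1) assms(3) by auto
    qed
    then have ab: "{a, b} \<in> E" using step(2) by blast
    have "b \<in> U" using bspec[OF assms(1)[unfolded is_graph_def] ab] by simp
    then show ?case using step(1) conn_step[OF _ ab] by blast
  qed (simp add: assms)
  then show "(x, y) \<in> conn E" by simp
next
  assume "(x, y) \<in> conn E"
  then show "(x, y) \<in> conn (E \<union> E')" by (rule conn_mono) simp
qed

lemma is_forest_Un_disjoint:
  assumes E: "is_forest U E" and E': "is_forest V E'" and disj: "U \<inter> V = {}"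
  shows "is_forest (U \<union> V) (E \<union> E')"
proof -
  have half: "(u, w) \<notin> conn ((E \<union> E') - {{u, w}})"
    if E: "is_forest U E" and E': "is_forest V E'" and disj: "U \<inter> V = {}" and uw: "{u, w} \<in> E"
    for U V :: "'a set" and E E' u w
  proof
    assume "(u, w) \<in> conn ((E \<union> E') - {{u, w}})"
    then have "(u, w) \<in> conn ((E - {{u, w}}) \<union> E')" by (rule conn_mono) auto
    moreover have "is_graph U (E - {{u, w}})" "u \<in> U"
      using is_forest_graph[OF E] uw by (auto simp: is_graph_def)
    ultimately have "(u, w) \<in> conn (E - {{u, w}})"
      using conn_Un_disjoint[OF _ is_forest_graph[OF E'] disj] by blast
    then show False using is_forest_bridge[OF E uw] by simp
  qed
  have "is_graph (U \<union> V) (E \<union> E')"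
    using is_forest_graph[OF E] is_forest_graph[OF E'] by (auto simp: is_graph_def)
  moreover have "(u, w) \<notin> conn ((E \<union> E') - {{u, w}})" if "{u, w} \<in> E \<union> E'" for u w
    using that half[OF E E' disj] half[OF E' E] disj by (auto simp: Un_commute Int_commute)
  ultimately show ?thesis by (simp add: is_forest_iff_bridges)
qed

lemma is_forest_restrict:
  assumes "is_forest W F"
  shows "is_forest U {e \<in> F. e \<subseteq> U}"
proof -
  have "(u, w) \<notin> conn ({e \<in> F. e \<subseteq> U} - {{u, w}})" if "{u, w} \<in> F" for u w
    using is_forest_bridge[OF assms that] conn_mono[of u w _ "F - {{u, w}}"] by blast
  then show ?thesis
    using is_forest_graph[OF assms] by (auto simp: is_forest_iff_bridges is_graph_def)
qed

lemma split_at_unreached: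
  fixes F :: "'v set set" and M :: "'v set"
  assumes F: "is_forest UNIV F"
  defines "U \<equiv> unreached F M"
  shows "F = {e \<in> F. e \<subseteq> U} \<union> {e \<in> F. e \<subseteq> - U}"
proof -
  have closed: "y \<in> U" if "{x, y} \<in> F" "x \<in> U" for x y
  proof -
    have "{y, x} \<in> F" using that by (simp add: insert_commute)
    then show ?thesis using that(2) conn_step unfolding U_def unreached_def by fastforce
  qed
  show ?thesis
  proof (intro equalityI subsetI)
    fix e assume e: "e \<in> F"
    then have "card e = 2" using is_forest_graph[OF F] by (auto simp: is_graph_def)
    then obtain x y where xy: "e = {x, y}" by (auto simp: card_2_iff)
    have "{x, y} \<in> F" "{y, x} \<in> F" using e xy by (auto simp: insert_commute)
    then show "e \<in> {e \<in> F. e \<subseteq> U} \<union> {e \<in> F. e \<subseteq> - U}"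
      using closed[of x y] closed[of y x] e xy by blast
  qed auto
qed

lemma join_reached_unreached:
  fixes F1 F2 :: "'v set set"
  assumes F1: "is_forest U F1" and F2: "F2 \<in> rooted_forests (- U) M"
  shows "is_forest UNIV (F1 \<union> F2)" "separated (F1 \<union> F2) M" "unreached (F1 \<union> F2) M = U"
    "class_of (F1 \<union> F2) ` U = components U F1"
proof -
  note FD = rooted_forestsD[OF F2]
  have g1: "is_graph U F1" and g2: "is_graph (- U) F2"
    using F1 FD(1) by (auto simp: is_forest_def)
  have c1: "(x, y) \<in> conn (F1 \<union> F2) \<longleftrightarrow> (x, y) \<in> conn F1" if "x \<in> U" for x y
    using conn_Un_disjoint[OF g1 g2 _ that] by simp
  have c2: "(x, y) \<in> conn (F1 \<union> F2) \<longleftrightarrow> (x, y) \<in> conn F2" if "x \<in> - U" for x y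
    using conn_Un_disjoint[OF g2 g1 _ that] by (simp add: Un_commute)
  show "is_forest UNIV (F1 \<union> F2)"
    using is_forest_Un_disjoint[OF F1 FD(1)] by simp
  show "separated (F1 \<union> F2) M"
    unfolding separated_def using FD(2,4) c2 by blast
  show "unreached (F1 \<union> F2) M = U"
  proof (intro equalityI subsetI)
    fix w assume w: "w \<in> unreached (F1 \<union> F2) M"
    show "w \<in> U"
    proof (rule ccontr)
      assume "w \<notin> U"
      then obtain k where "k \<in> M" "(k, w) \<in> conn F2" using FD(3)[of w] by auto
      then show False using w c2[of k w] FD(2) by (auto simp: unreached_def)
    qed
  next
    fix w assume "w \<in> U"
    then show "w \<in> unreached (F1 \<union> F2) M"
      using c2 conn_in_vertices[OF g2] FD(2) unfolding unreached_def by blast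
  qed
  show "class_of (F1 \<union> F2) ` U = components U F1"
    using c1 by (simp add: components_eq_class_of[OF g1] cong: image_cong)
qed

text \<open>A pair \<open>(F, M)\<close> amounts to the set \<open>U\<close> of the vertices that cannot be reached from \<open>M\<close>, a forest on \<open>U\<close>, and
  a forest on the other vertices that is rooted at \<open>M\<close>.\<close>

lemma sum_forests_separated:
  fixes g :: "nat \<Rightarrow> real"
  shows "(\<Sum>F\<in>forests_on (UNIV :: 'v::finite set). \<Sum>M\<in>{M. M \<noteq> {} \<and> separated F M}. g (card M) * real (Gcd (card ` class_of F ` unreached F M)))
    = (\<Sum>U\<in>Pow (UNIV :: 'v set). real (gcd_sum U) *
        (\<Sum>M\<in>Pow (- U) - {{}}. g (card M) * real (card (rooted_forests (- U) M))))"
proof -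
  let ?X = "SIGMA F:forests_on (UNIV :: 'v set). {M. M \<noteq> {} \<and> separated F M}"
  let ?Y = "SIGMA U:Pow (UNIV :: 'v set). forests_on U \<times> (SIGMA M:Pow (- U) - {{}}. rooted_forests (- U) M)"
  have fin: "finite (forests_on U)" for U :: "'v set" by (simp add: finite_forests_on)
  have "(\<Sum>F\<in>forests_on (UNIV :: 'v set). \<Sum>M\<in>{M. M \<noteq> {} \<and> separated F M}. g (card M) * real (Gcd (card ` class_of F ` unreached F M)))
      = (\<Sum>(F, M)\<in>?X. g (card M) * real (Gcd (card ` class_of F ` unreached F M)))"
    by (subst sum.Sigma) (auto simp: fin)
  also have "\<dots> = (\<Sum>(U, F1, M, F2)\<in>?Y. g (card M) * real (Gcd (card ` components U F1)))"
  proof (rule sum.reindex_bij_witness[of _ "\<lambda>(U, F1, M, F2). (F1 \<union> F2, M)"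
        "\<lambda>(F, M). (unreached F M, {e \<in> F. e \<subseteq> unreached F M}, M, {e \<in> F. e \<subseteq> - unreached F M})"])
    fix p assume "p \<in> ?X"
    then obtain F M where p: "p = (F, M)" and F: "is_forest UNIV F" and M: "M \<noteq> {}" "separated F M"
      by (auto simp: forests_on_def)
    let ?U = "unreached F M"
    let ?F1 = "{e \<in> F. e \<subseteq> ?U}" and ?F2 = "{e \<in> F. e \<subseteq> - ?U}"
    have split: "?F1 \<union> ?F2 = F" by (rule split_at_unreached[OF F, symmetric])
    have f1: "is_forest ?U ?F1" and f2: "is_forest (- ?U) ?F2"
      by (rule is_forest_restrict[OF F])+
    have MU: "M \<subseteq> - ?U" by (auto simp: unreached_def)
    have c2: "(x, y) \<in> conn F \<longleftrightarrow> (x, y) \<in> conn ?F2" if "x \<in> - ?U" for x y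
      using conn_Un_disjoint[OF is_forest_graph[OF f2] is_forest_graph[OF f1] _ that] split
      by (simp add: Un_commute)
    have R: "?F2 \<in> rooted_forests (- ?U) M"
    proof (rule rooted_forestsI[OF f2 MU])
      fix w assume "w \<in> - ?U"
      then obtain k where k: "k \<in> M" "(k, w) \<in> conn F" by (auto simp: unreached_def)
      then show "\<exists>r\<in>M. (r, w) \<in> conn ?F2" using c2[of k w] MU by blast
    next
      fix r r' assume "r \<in> M" "r' \<in> M" "(r, r') \<in> conn ?F2"
      then show "r = r'" using c2[of r r'] MU M(2) unfolding separated_def by blast
    qed
    show "(case (case p of (F, M) \<Rightarrow> (unreached F M, {e \<in> F. e \<subseteq> unreached F M}, M, {e \<in> F. e \<subseteq> - unreached F M}))
        of (U, F1, M, F2) \<Rightarrow> (F1 \<union> F2, M)) = p"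
      using split by (simp add: p)
    show "(case p of (F, M) \<Rightarrow> (unreached F M, {e \<in> F. e \<subseteq> unreached F M}, M, {e \<in> F. e \<subseteq> - unreached F M})) \<in> ?Y"
      using f1 R M MU by (simp add: p forests_on_def)
    show "(case (case p of (F, M) \<Rightarrow> (unreached F M, {e \<in> F. e \<subseteq> unreached F M}, M, {e \<in> F. e \<subseteq> - unreached F M}))
        of (U, F1, M, F2) \<Rightarrow> g (card M) * real (Gcd (card ` components U F1))) =
        (case p of (F, M) \<Rightarrow> g (card M) * real (Gcd (card ` class_of F ` unreached F M)))"
      using join_reached_unreached(4)[OF f1 R] split by (simp add: p)
  next
    fix q assume "q \<in> ?Y"
    then obtain U F1 M F2 where q: "q = (U, F1, M, F2)" and F1: "is_forest U F1"
        and F2: "F2 \<in> rooted_forests (- U) M" and M: "M \<noteq> {}"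
      by (auto simp: forests_on_def)
    note J = join_reached_unreached[OF F1 F2]
    have e1: "e \<subseteq> U \<and> e \<noteq> {}" if "e \<in> F1" for e
      using is_forest_graph[OF F1] that by (auto simp: is_graph_def)
    have e2: "e \<subseteq> - U \<and> e \<noteq> {}" if "e \<in> F2" for e
      using is_forest_graph[OF rooted_forestsD(1)[OF F2]] that by (auto simp: is_graph_def)
    have "{e \<in> F1 \<union> F2. e \<subseteq> U} = F1" "{e \<in> F1 \<union> F2. e \<subseteq> - U} = F2"
      using e1 e2 by blast+
    then show "(case (case q of (U, F1, M, F2) \<Rightarrow> (F1 \<union> F2, M)) of (F, M) \<Rightarrow>
        (unreached F M, {e \<in> F. e \<subseteq> unreached F M}, M, {e \<in> F. e \<subseteq> - unreached F M})) = q"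
      using J(3) by (simp add: q)
    show "(case q of (U, F1, M, F2) \<Rightarrow> (F1 \<union> F2, M)) \<in> ?X"
      using J M by (simp add: q forests_on_def)
  qed
  also have "\<dots> = (\<Sum>U\<in>Pow (UNIV :: 'v set). \<Sum>F1\<in>forests_on U. \<Sum>M\<in>Pow (- U) - {{}}. \<Sum>F2\<in>rooted_forests (- U) M.
      g (card M) * real (Gcd (card ` components U F1)))"
  proof -
    have "sum h ?Y = (\<Sum>U\<in>Pow UNIV. \<Sum>F1\<in>forests_on U. \<Sum>M\<in>Pow (- U) - {{}}. \<Sum>F2\<in>rooted_forests (- U) M.
        h (U, F1, M, F2))" for h :: "'v set \<times> 'v set set \<times> 'v set \<times> 'v set set \<Rightarrow> real"
      by (simp add: sum.Sigma fin finite_rooted_forests case_prod_unfold)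
    then show ?thesis by (simp only: prod.case)
  qed
  also have "\<dots> = (\<Sum>U\<in>Pow (UNIV :: 'v set). real (gcd_sum U) *
        (\<Sum>M\<in>Pow (- U) - {{}}. g (card M) * real (card (rooted_forests (- U) M))))"
    unfolding gcd_sum_def of_nat_sum sum_product
    by (intro sum.cong refl) (simp add: mult_ac)
  finally show ?thesis .
qed

lemma lattice_poly_edges_only:
  "lattice_poly (\<lambda>_ (_::'n::{finite,linorder}). 1) (\<lambda>_. 0) = real (num_forests CARD('n))"
proof -
  have "lattice_poly (\<lambda>_ (_::'n). 1) (\<lambda>_. 0) =
      (\<Sum>F\<in>Pow (edges_of (UNIV :: 'n set)). \<Sum>M\<in>{{} :: 'n set}. real (card (torus_kernel int_vecs gen (F <+> M))))"
    unfolding lattice_poly_def by (intro sum.cong refl sum.mono_neutral_cong_right) auto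
  also have "\<dots> = (\<Sum>F\<in>Pow (edges_of (UNIV :: 'n set)). if is_forest UNIV F then 1 else 0)"
    by (intro sum.cong refl) (simp add: card_torus_kernel_edges)
  also have "\<dots> = real (card (forests_on (UNIV :: 'n set)))"
  proof -
    have "{F \<in> Pow (edges_of (UNIV :: 'n set)). is_forest UNIV F} = forests_on UNIV"
      by (auto simp: forests_on_def is_forest_def is_graph_def edges_of_def)
    then show ?thesis by (simp add: sum.If_cases Int_def)
  qed
  finally show ?thesis by (simp add: card_forests_on)
qed

text \<open>The sets \<open>U = {}\<close> and \<open>U = UNIV\<close> contribute nothing: the former because the gcd of no trees is \<open>0\<close>, the latter
  because it leaves no vertices for the nonempty set \<open>M\<close>.\<close>

lemma lattice_poly_cyclopermutohedron:
  fixes n defines "n \<equiv> CARD('n::{finite,linorder})"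
  shows "lattice_poly (\<lambda>_ (_::'n). 1) (\<lambda>_. - 1) = real (num_forests n)
    - (\<Sum>v = 1..n - 1. real (n choose v) * (- real v) ^ (n - v - 1) * real (Phi v))"
proof -
  let ?E = "edges_of (UNIV :: 'n set)"
  define K where "K F M = real (card (torus_kernel int_vecs gen (F <+> M)))" for F :: "'n set set" and M :: "'n set"
  define g where "g k = (- 1) ^ k * real n ^ (k - 1)" for k
  have n: "n > 0" by (simp add: n_def)
  have fE: "forests_on UNIV \<subseteq> Pow ?E"
    by (auto simp: forests_on_def is_forest_def is_graph_def edges_of_def)
  have poly: "lattice_poly (\<lambda>_ (_::'n). 1) m = (\<Sum>F\<in>Pow ?E. K F {}) + (\<Sum>F\<in>Pow ?E. \<Sum>M\<in>UNIV - {{}}. prod m M * K F M)"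
    for m
    unfolding lattice_poly_def sum.distrib[symmetric] K_def
    by (intro sum.cong refl, subst sum.remove[of _ "{}"]) simp_all
  have base: "(\<Sum>F\<in>Pow ?E. K F {}) = real (num_forests n)"
  proof -
    have "(\<Sum>F\<in>Pow ?E. \<Sum>M\<in>UNIV - {{}}. (\<Prod>k\<in>M. 0) * K F M) = 0"
      by (intro sum.neutral ballI) auto
    then show ?thesis
      using poly[of "\<lambda>_. 0"] lattice_poly_edges_only[where 'n = 'n] by (simp only: n_def)
  qed
  have "(\<Sum>F\<in>Pow ?E. \<Sum>M\<in>UNIV - {{}}. (\<Prod>k\<in>M. - 1) * K F M) =
      (\<Sum>F\<in>forests_on (UNIV :: 'n set). \<Sum>M\<in>{M. M \<noteq> {} \<and> separated F M}.
        g (card M) * real (Gcd (card ` class_of F ` unreached F M)))"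
  proof (rule sum.mono_neutral_cong_right)
    show "\<forall>F\<in>Pow ?E - forests_on UNIV. (\<Sum>M\<in>UNIV - {{}}. (\<Prod>k\<in>M. - 1) * K F M) = 0"
    proof
      fix F assume "F \<in> Pow ?E - forests_on UNIV"
      then have "K F M = 0" for M
        using card_torus_kernel_not_forest[of F M] by (simp add: K_def forests_on_def)
      then show "(\<Sum>M\<in>UNIV - {{}}. (\<Prod>k\<in>M. - 1) * K F M) = 0" by simp
    qed
  next
    fix F :: "'n set set" assume F: "F \<in> forests_on UNIV"
    show "(\<Sum>M\<in>UNIV - {{}}. (\<Prod>k\<in>M. - 1) * K F M) =
        (\<Sum>M\<in>{M. M \<noteq> {} \<and> separated F M}. g (card M) * real (Gcd (card ` class_of F ` unreached F M)))"
    proof (rule sum.mono_neutral_cong_right)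
      have "K F M = 0" if "M \<in> UNIV - {{}} - {M. M \<noteq> {} \<and> separated F M}" for M
        using that card_torus_kernel_not_separated[of F M] fE F by (auto simp: K_def)
      then show "\<forall>M\<in>UNIV - {{}} - {M. M \<noteq> {} \<and> separated F M}. (\<Prod>k\<in>M. - 1) * K F M = 0"
        by (intro ballI) (simp only: mult_zero_right)
    next
      fix M assume M: "M \<in> {M. M \<noteq> {} \<and> separated F M}"
      then show "(\<Prod>k\<in>M. - 1) * K F M = g (card M) * real (Gcd (card ` class_of F ` unreached F M))"
        using card_torus_kernel_forest_roots[of F M] F by (simp add: K_def g_def forests_on_def n_def)
    qed auto
  qed (use fE in auto)
  also have "\<dots> = (\<Sum>U\<in>Pow (UNIV :: 'n set). real (gcd_sum U) *
        (\<Sum>M\<in>Pow (- U) - {{}}. g (card M) * real (card (rooted_forests (- U) M))))"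
    by (rule sum_forests_separated)
  also have "\<dots> = (\<Sum>U\<in>Pow (UNIV :: 'n set). if card U \<in> {1..n - 1}
      then real (Phi (card U)) * - ((- real (card U)) ^ (n - card U - 1)) else 0)"
  proof (intro sum.cong refl)
    fix U :: "'n set"
    have cU: "card U \<le> n" "card (- U) = n - card U"
      by (auto simp: n_def card_mono Compl_eq_Diff_UNIV card_Diff_subset)
    consider "U = {}" | "U = UNIV" | "U \<noteq> {}" "U \<noteq> UNIV" by blast
    then show "real (gcd_sum U) * (\<Sum>M\<in>Pow (- U) - {{}}. g (card M) * real (card (rooted_forests (- U) M))) =
      (if card U \<in> {1..n - 1} then real (Phi (card U)) * - ((- real (card U)) ^ (n - card U - 1)) else 0)"
    proof cases
      case 1
      have "gcd_sum ({} :: 'n set) = 0" by (simp add: gcd_sum_def components_def)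
      then show ?thesis using 1 by simp
    next
      case 2
      then have "card U = n" by (simp add: n_def)
      then have "card U \<notin> {1..n - 1}" using n by auto
      then show ?thesis using 2 by simp
    next
      case 3
      have "card U \<noteq> 0" using 3(1) by simp
      moreover have "card U \<noteq> n" using 3(2) card_eq_UNIV_imp_eq_UNIV[OF finite, of U] unfolding n_def by blast
      ultimately have U: "card U \<in> {1..n - 1}" using cU(1) unfolding atLeastAtMost_iff by linarith
      have "- U \<noteq> {}" using 3 by auto
      from sum_signed_rooted_forests[OF _ this n]
      have "(\<Sum>M\<in>Pow (- U) - {{}}. g (card M) * real (card (rooted_forests (- U) M))) =
          - ((real (n - card U) - real n) ^ (n - card U - 1))"
        by (simp add: g_def cU)
      also have "real (n - card U) - real n = - real (card U)" using cU by simp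
      finally show ?thesis using U gcd_sum_eq_Phi[of U] by simp
    qed
  qed
  also have "\<dots> = (\<Sum>v\<le>n. real (n choose v) * (if v \<in> {1..n - 1} then real (Phi v) * - ((- real v) ^ (n - v - 1)) else 0))"
    using sum_Pow_card[of "UNIV :: 'n set" "\<lambda>v. if v \<in> {1..n - 1} then real (Phi v) * - ((- real v) ^ (n - v - 1)) else 0"]
    by (simp add: n_def)
  also have "\<dots> = (\<Sum>v = 1..n - 1. - (real (n choose v) * (- real v) ^ (n - v - 1) * real (Phi v)))"
    by (intro sum.mono_neutral_cong_right) auto
  also have "\<dots> = - (\<Sum>v = 1..n - 1. real (n choose v) * (- real v) ^ (n - v - 1) * real (Phi v))"
    by (rule sum_negf)
  finally show ?thesis using poly[of "\<lambda>_. - 1"] base by (simp only:)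
qed

theorem theorem4:
  fixes n :: nat
  assumes "n = CARD('n::{finite,linorder})"
  shows "virtual_lattice_count (cyclopermutohedron :: (real ^ 'n::{finite,linorder}) virtual_polytope)
           = real (num_forests n)
             - (\<Sum>v = 1..n - 1. real (n choose v) * (- real v) ^ (n - v - 1) * real (Phi v))
       \<and> virtual_lattice_count (cyclopermutohedron :: (real ^ 'n::{finite,linorder}) virtual_polytope)
           = real (lattice_count (permutohedron :: (real ^ 'n::{finite,linorder}) convex_polytope))
             - (\<Sum>v = 1..n - 1. real (n choose v) * (- real v) ^ (n - v - 1) * real (Phi v))"
  using assms lattice_poly_cyclopermutohedron[where 'n = 'n]
  by (simp add: virtual_lattice_count_cyclopermutohedron lattice_count_permutohedron
      lattice_poly_edges_only)

end
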